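(* Let $1\to G\to H\xrightarrow{j} Q\to 1$ be an extension of a finite group $Q$ by a finite group $G$, with $H$ identified with $G\rtimes_{s,\tau}Q$ by means of a section $s$ of $j$ with $s(1)=1$ and its associated map $\tau:Q\times Q\to G$. Let $q\in Q$ and let $\langle q\rangle$ be its conjugacy class in $Q$. Let $C(q)\subset Q$ be the centralizer of $q$, and let $\widehat{G}^q\subset\widehat{G}$ be the set of elements of $\widehat{G}$ fixed by $q$, on which $C(q)$ acts. Then the number of conjugacy classes of $H$ that are mapped by $j$ to the conjugacy class $\langle q\rangle$ of $Q$ (that is, that are contained in $j^{-1}(\langle q\rangle)$) is equal to the number of $C(q)$-orbits $O_i$ of $\widehat{G}^q$ such that there exists $[\rho_i]\in O_i$ with $$\gamma^{[\rho_i]}_{q_1,q}=1\quad\text{for all } q_1\in Q_i:=\mathrm{Stab}_{C(q)}([\rho_i]),$$ where $\gamma^{[\rho_i]}_{q_1,q}:=c^{[\rho_i]}(q_1,q)\,c^{[\rho_i]}(q,q_1)^{-1}\in U(1)$ and $c$ is the $U(1)$-valued cocycle on $\widehat{G}\rtimes Q$ associated to the extension.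
   Context: All groups are finite. $G$ is regarded as a normal subgroup of $H$ (the kernel of $j$). Section and $\tau$: fix a map $s:Q\to H$ with $j\circ s=\mathrm{id}$ and $s(1)=1$, and put $\tau(q_1,q_2):=s(q_1)s(q_2)s(q_1q_2)^{-1}\in G$. $G\rtimes_{s,\tau}Q$ is the set $G\times Q$ with the product $(g_1,q_1)\cdot(g_2,q_2)=(g_1\,\mathrm{Ad}_{s(q_1)}(g_2)\,\tau(q_1,q_2),\,q_1q_2)$, where $\mathrm{Ad}_h(g)=hgh^{-1}$; the map $h\mapsto (h\,s(j(h))^{-1},j(h))$ is a group isomorphism $H\to G\rtimes_{s,\tau}Q$. Action on $\widehat{G}$: $\widehat{G}$ is the set of isomorphism classes of irreducible complex representations of $G$. For each class $[\rho]\in\widehat{G}$ a unitary representative $\rho:G\to\mathrm{End}(V_\rho)$ is chosen. For $q\in Q$, $q([\rho])\in\widehat{G}$ denotes the class of the representation $g\mapsto\rho(\mathrm{Ad}_{s(q)}(g))$. This is independent of the choice of $s$ and defines a right action of $Q$ on $\widehat{G}$, written on the left, so that $q_2(q_1([\rho]))=(q_1q_2)([\rho])$. The chosen representative of the class $q([\rho])$ is also denoted $q([\rho]):G\to\mathrm{End}(V_{q([\rho])})$. $\widehat{G}\rtimes Q$ denotes the transformation groupoid of this action. Cocycle $c$: for each $[\rho]\in\widehat{G}$ and $q\in Q$ choose a unitary isomorphism $T_q^{[\rho]}:V_\rho\to V_{q([\rho])}$ with $$\rho(\mathrm{Ad}_{s(q)}(g))=(T_q^{[\rho]})^{-1}\circ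 q([\rho])(g)\circ T_q^{[\rho]}\quad\text{for all } g\in G,$$ and with $T_1^{[\rho]}=\mathrm{id}$. Then $c^{[\rho]}(q_1,q_2)\in U(1)$ is the constant determined by $$T^{q_1([\rho])}_{q_2}\circ T^{[\rho]}_{q_1}=c^{[\rho]}(q_1,q_2)\,T^{[\rho]}_{q_1q_2}\,\rho(\tau(q_1,q_2))^{-1}.$$ *)

theory Defs
  imports
    "HOL-Algebra.Group_Action"
    "Jordan_Normal_Form.Schur_Decomposition"
    "Jordan_Normal_Form.VS_Connect"
begin

definition conj_act :: "('a, 'm) monoid_scheme \<Rightarrow> 'a \<Rightarrow> 'a \<Rightarrow> 'a" where
  "conj_act G h = (\<lambda>g \<in> carrier G. h \<otimes>\<^bsub>G\<^esub> g \<otimes>\<^bsub>G\<^esub> inv\<^bsub>G\<^esub> h)"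

definition conj_class :: "('a, 'm) monoid_scheme \<Rightarrow> 'a \<Rightarrow> 'a set" where
  "conj_class G g = orbit G (conj_act G) g"

definition conj_classes :: "('a, 'm) monoid_scheme \<Rightarrow> 'a set set" where
  "conj_classes G = orbits G (carrier G) (conj_act G)"

definition centralizer :: "('a, 'm) monoid_scheme \<Rightarrow> 'a \<Rightarrow> 'a set" where
  "centralizer G q = {r \<in> carrier G. r \<otimes>\<^bsub>G\<^esub> q = q \<otimes>\<^bsub>G\<^esub> r}"

text \<open>
  A representation on an \<open>n\<close>-dimensional Hilbert space is given in an orthonormal basis, that
  is, as a homomorphism into the invertible complex \<open>n \<times> n\<close> matrices acting on the space
  \<open>carrier_vec n\<close> with its standard Hermitian inner product.
\<close>

abbreviation mat_mon :: "nat \<Rightarrow> complex mat ring" where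
  "mat_mon n \<equiv> ring_mat TYPE(complex) n ()"

abbreviation GL :: "nat \<Rightarrow> complex mat monoid" where
  "GL n \<equiv> units_of (mat_mon n)"

definition unitary_mat :: "nat \<Rightarrow> complex mat \<Rightarrow> bool" where
  "unitary_mat n U \<longleftrightarrow>
     U \<in> carrier_mat n n \<and> U * mat_adjoint U = 1\<^sub>m n \<and> mat_adjoint U * U = 1\<^sub>m n"

type_synonym 'a mat_rep = "'a \<Rightarrow> complex mat"

definition irreducible_rep :: "('a, 'm) monoid_scheme \<Rightarrow> nat \<Rightarrow> 'a mat_rep \<Rightarrow> bool" where
  "irreducible_rep G n \<rho> \<longleftrightarrow>
     \<rho> \<in> hom G (GL n) \<and> n \<noteq> 0 \<and>
     (\<forall>W. VectorSpace.subspace class_ring W (module_vec TYPE(complex) n) \<longrightarrow>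
          (\<forall>g \<in> carrier G. \<forall>w \<in> W. \<rho> g *\<^sub>v w \<in> W) \<longrightarrow>
          W = {0\<^sub>v n} \<or> W = carrier_vec n)"

definition irreducible_reps :: "('a, 'm) monoid_scheme \<Rightarrow> 'a mat_rep set" where
  "irreducible_reps G = {\<rho>. \<exists>n. irreducible_rep G n \<rho>}"

definition rep_dim :: "('a, 'm) monoid_scheme \<Rightarrow> 'a mat_rep \<Rightarrow> nat" where
  "rep_dim G \<rho> = dim_row (\<rho> \<one>\<^bsub>G\<^esub>)"

text \<open>
  Only the values on \<open>carrier G\<close> are compared, so the values of a representation outside
  \<open>carrier G\<close> do not affect its isomorphism class.
\<close>

definition rep_iso :: "('a, 'm) monoid_scheme \<Rightarrow> ('a mat_rep \<times> 'a mat_rep) set" where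
  "rep_iso G = {(\<rho>, \<sigma>). \<rho> \<in> irreducible_reps G \<and> \<sigma> \<in> irreducible_reps G \<and>
     rep_dim G \<rho> = rep_dim G \<sigma> \<and>
     (\<exists>P \<in> carrier (GL (rep_dim G \<rho>)). \<forall>g \<in> carrier G. P * \<rho> g = \<sigma> g * P)}"

definition dual :: "('a, 'm) monoid_scheme \<Rightarrow> 'a mat_rep set set" where
  "dual G = irreducible_reps G // rep_iso G"

text \<open>
  In the rest, \<open>G\<close> is a normal subgroup of \<open>H\<close> with quotient \<open>Q\<close>, and \<open>s\<close> is a section of the
  quotient map.
\<close>

definition tau :: "('a, 'm) monoid_scheme \<Rightarrow> ('b, 'n) monoid_scheme \<Rightarrow> ('b \<Rightarrow> 'a) \<Rightarrow> 'b \<Rightarrow> 'b \<Rightarrow> 'a"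
  where "tau H Q s q\<^sub>1 q\<^sub>2 = s q\<^sub>1 \<otimes>\<^bsub>H\<^esub> s q\<^sub>2 \<otimes>\<^bsub>H\<^esub> inv\<^bsub>H\<^esub> (s (q\<^sub>1 \<otimes>\<^bsub>Q\<^esub> q\<^sub>2))"

text \<open>
  The class of the representation mapping \<open>g\<close> to \<open>\<rho> (Ad (s q) g)\<close>, for any \<open>\<rho>\<close> in the class
  \<open>C\<close>.  This is a right action written on the left: \<open>dual_act q\<^sub>2 (dual_act q\<^sub>1 C)\<close> is
  \<open>dual_act (q\<^sub>1 q\<^sub>2) C\<close>.  The library's \<open>orbit\<close>, \<open>orbits\<close>, \<open>stabilizer\<close> and \<open>invariants\<close>, used
  for it below, are defined for arbitrary maps and have the intended meaning for right actions.
\<close>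

definition dual_act ::
  "('a, 'm) monoid_scheme \<Rightarrow> ('a, 'm) monoid_scheme \<Rightarrow> ('b \<Rightarrow> 'a) \<Rightarrow> 'b \<Rightarrow>
   'a mat_rep set \<Rightarrow> 'a mat_rep set" where
  "dual_act G H s q C = (\<Union>\<rho> \<in> C. rep_iso G `` {\<lambda>g. \<rho> (conj_act H (s q) g)})"

text \<open>\<open>R C\<close> is the representative chosen in the class \<open>C\<close>.\<close>

definition unitary_representatives ::
  "('a, 'm) monoid_scheme \<Rightarrow> ('a mat_rep set \<Rightarrow> 'a mat_rep) \<Rightarrow> bool" where
  "unitary_representatives G R \<longleftrightarrow>
     (\<forall>C \<in> dual G. R C \<in> C \<and> (\<forall>g \<in> carrier G. unitary_mat (rep_dim G (R C)) (R C g)))"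

text \<open>\<open>T q C\<close> is the chosen isomorphism from the space of \<open>R C\<close> to that of
  \<open>R (dual_act G H s q C)\<close>; these spaces have the same dimension.\<close>

definition unitary_intertwiners ::
  "('a, 'm) monoid_scheme \<Rightarrow> ('a, 'm) monoid_scheme \<Rightarrow> ('b, 'n) monoid_scheme \<Rightarrow> ('b \<Rightarrow> 'a) \<Rightarrow>
   ('a mat_rep set \<Rightarrow> 'a mat_rep) \<Rightarrow> ('b \<Rightarrow> 'a mat_rep set \<Rightarrow> complex mat) \<Rightarrow> bool" where
  "unitary_intertwiners G H Q s R T \<longleftrightarrow>
     (\<forall>C \<in> dual G.
        T \<one>\<^bsub>Q\<^esub> C = 1\<^sub>m (rep_dim G (R C)) \<and>
        (\<forall>q \<in> carrier Q.
           unitary_mat (rep_dim G (R C)) (T q C) \<and>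
           (\<forall>g \<in> carrier G.
              R C (conj_act H (s q) g) =
              inv\<^bsub>mat_mon (rep_dim G (R C))\<^esub> (T q C) * R (dual_act G H s q C) g * T q C)))"

definition cocycle ::
  "('a, 'm) monoid_scheme \<Rightarrow> ('a, 'm) monoid_scheme \<Rightarrow> ('b, 'n) monoid_scheme \<Rightarrow> ('b \<Rightarrow> 'a) \<Rightarrow>
   ('a mat_rep set \<Rightarrow> 'a mat_rep) \<Rightarrow> ('b \<Rightarrow> 'a mat_rep set \<Rightarrow> complex mat) \<Rightarrow>
   'a mat_rep set \<Rightarrow> 'b \<Rightarrow> 'b \<Rightarrow> complex" where
  "cocycle G H Q s R T C q\<^sub>1 q\<^sub>2 =
     (THE z. cmod z = 1 \<and>
        T q\<^sub>2 (dual_act G H s q\<^sub>1 C) * T q\<^sub>1 C =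
        z \<cdot>\<^sub>m (T (q\<^sub>1 \<otimes>\<^bsub>Q\<^esub> q\<^sub>2) C *
              inv\<^bsub>mat_mon (rep_dim G (R C))\<^esub> (R C (tau H Q s q\<^sub>1 q\<^sub>2))))"

definition gamma ::
  "('a, 'm) monoid_scheme \<Rightarrow> ('a, 'm) monoid_scheme \<Rightarrow> ('b, 'n) monoid_scheme \<Rightarrow> ('b \<Rightarrow> 'a) \<Rightarrow>
   ('a mat_rep set \<Rightarrow> 'a mat_rep) \<Rightarrow> ('b \<Rightarrow> 'a mat_rep set \<Rightarrow> complex mat) \<Rightarrow>
   'a mat_rep set \<Rightarrow> 'b \<Rightarrow> 'b \<Rightarrow> complex" where
  "gamma G H Q s R T C q\<^sub>1 q =
     cocycle G H Q s R T C q\<^sub>1 q * inverse (cocycle G H Q s R T C q q\<^sub>1)"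

end

theory Submission
  imports
    Defs
    "Jordan_Normal_Form.Spectral_Radius"
    "HOL-Library.Function_Algebras"
begin

text \<open>
  Both sides are the dimension of the space \<open>V\<close> of functions on the fiber \<open>X = j\<^sup>-\<^sup>1(q)\<close> that are
  invariant under conjugation by the preimage \<open>K\<close> of the centralizer of \<open>q\<close>.  The indicator functions
  of the conjugacy classes form one basis of \<open>V\<close>.  For the other one, a representation \<open>\<rho>\<close> fixed by
  \<open>q\<close> extends to the coset \<open>X = G s(q)\<close> by \<open>g s(q) \<mapsto> \<rho>(g) T\<^sub>q\<^sup>-\<^sup>1\<close>; the traces \<open>F \<rho>\<close> of these extensions
  form an orthogonal basis of the \<open>G\<close>-invariant functions on \<open>X\<close> (Schur orthogonality and completeness
  of matrix coefficients), and conjugation by \<open>s(r)\<close> maps \<open>F \<rho>\<close> to \<open>\<gamma>\<^sub>r\<^sub>,\<^sub>q F (r \<rho>)\<close>.  So the average of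
  \<open>F \<rho>\<close> over \<open>K\<close> depends up to a nonzero scalar only on the orbit of \<open>\<rho>\<close>, it is nonzero exactly if
  \<open>\<gamma>\<close> is trivial on the stabilizer, and the nonzero averages form an orthogonal basis of \<open>V\<close>.
\<close>

section \<open>Orthogonal families of functions\<close>

text \<open>The factor \<open>gamma\<close> measures how far the intertwiners of two commuting
  elements are from commuting. For \<open>r\<close> in the centralizer of \<open>q\<close> and a
  class fixed by \<open>q\<close>, both products of the intertwiners of \<open>r\<close> and
  \<open>q\<close> are multiples of the intertwiner of the product, each corrected by its own value
  of \<open>tau\<close>. Conjugating a point of the fiber by \<open>s r\<close> produces exactly
  these two values of \<open>tau\<close>, so inside the trace only the ratio of the two constants
  survives. Triviality of \<open>gamma\<close> on a stabilizer is then tied to the nonvanishing of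
  the average \<open>E C\<close>. If \<open>r\<close> fixes \<open>C\<close>, then
  \<open>E C\<close> equals \<open>gam C r\<close> times itself, so a nonzero \<open>E C\<close>
  forces \<open>gam C r = 1\<close>. Conversely, if all these factors are 1, the inner product of
  \<open>E C\<close> with \<open>F C\<close> is a positive multiple of the order of the stabilizer.
  All functions are total on a type, so those in the spaces that are counted must vanish off a
  finite set. This gives finite dimension, and with it the finiteness of the set of classes fixed by
  \<open>q\<close>.\<close>

definition fscale :: "complex \<Rightarrow> ('x \<Rightarrow> complex) \<Rightarrow> 'x \<Rightarrow> complex" where
  "fscale c f = (\<lambda>x. c * f x)"

lemma fscale_apply [simp]: "fscale c f x = c * f x"
  by (simp add: fscale_def)

interpretation fs: vector_space fscale
  by standard (auto simp: fscale_def fun_eq_iff algebra_simps)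

lemma sum_fun_apply: "(\<Sum>i\<in>I. f i) x = (\<Sum>i\<in>I. f i x)" for f :: "'i \<Rightarrow> 'x \<Rightarrow> complex"
  by (induction I rule: infinite_finite_induct) auto

text \<open>Pairing a vanishing combination with one member isolates its coefficient. The pairing
  sees only the values on \<open>X\<close>, yet it yields independence of the total
  functions.\<close>

lemma orthogonal_independent:
  fixes A :: "('x \<Rightarrow> complex) set"
  assumes nz: "\<And>f. f \<in> A \<Longrightarrow> (\<Sum>x\<in>X. f x * cnj (f x)) \<noteq> 0"
    and orth: "\<And>f g. f \<in> A \<Longrightarrow> g \<in> A \<Longrightarrow> f \<noteq> g \<Longrightarrow> (\<Sum>x\<in>X. f x * cnj (g x)) = 0"
  shows "fs.independent A"
proof (subst fs.independent_explicit_finite_subsets, intro allI impI ballI)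
  fix S u v
  assume S: "S \<subseteq> A" "finite S" and z: "(\<Sum>x\<in>S. fscale (u x) x) = 0" and v: "v \<in> S"
  have "0 = (\<Sum>x\<in>X. (\<Sum>w\<in>S. fscale (u w) w) x * cnj (v x))"
    using z by simp
  also have "\<dots> = (\<Sum>x\<in>X. \<Sum>w\<in>S. u w * (w x * cnj (v x)))"
    by (simp add: sum_fun_apply sum_distrib_right mult.assoc)
  also have "\<dots> = (\<Sum>w\<in>S. u w * (\<Sum>x\<in>X. w x * cnj (v x)))"
    by (subst sum.swap) (simp add: sum_distrib_left)
  also have "\<dots> = (\<Sum>w\<in>S. if w = v then u v * (\<Sum>x\<in>X. v x * cnj (v x)) else 0)"
    using S v orth by (intro sum.cong) auto
  also have "\<dots> = u v * (\<Sum>x\<in>X. v x * cnj (v x))"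
    using S v by simp
  finally show "u v = 0"
    using nz[of v] S v by auto
qed

section \<open>Schur's lemma\<close>

lemma index_mult_mat_sum:
  assumes "A \<in> carrier_mat n m" "B \<in> carrier_mat m p" "i < n" "k < p"
  shows "(A * B) $$ (i, k) = (\<Sum>l<m. A $$ (i, l) * B $$ (l, k))"
  using assms by (simp add: scalar_prod_def atLeast0LessThan)

lemma index_mult_mat_vec_sum:
  assumes "A \<in> carrier_mat n m" "v \<in> carrier_vec m" "i < n"
  shows "(A *\<^sub>v v) $ i = (\<Sum>l<m. A $$ (i, l) * v $ l)"
  using assms by (simp add: scalar_prod_def atLeast0LessThan)

lemma eq_mat_on_vec:
  fixes A B :: "complex mat"
  assumes A: "A \<in> carrier_mat n m" and B: "B \<in> carrier_mat n m"
    and eq: "\<And>v. v \<in> carrier_vec m \<Longrightarrow> A *\<^sub>v v = B *\<^sub>v v"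
  shows "A = B"
proof (rule eq_matI)
  fix i k assume "i < dim_row B" "k < dim_col B"
  then have ik: "i < n" "k < m" using B by auto
  have "M $$ (i, k) = (M *\<^sub>v unit_vec m k) $ i" if "M \<in> carrier_mat n m" for M :: "complex mat"
    using that ik by simp
  from this[OF A] this[OF B] eq[of "unit_vec m k"] show "A $$ (i, k) = B $$ (i, k)"
    by simp
qed (use A B in auto)

definition mtrace :: "complex mat \<Rightarrow> complex" where
  "mtrace A = (\<Sum>i<dim_row A. A $$ (i, i))"

lemma mtrace_mult:
  assumes "A \<in> carrier_mat n m" "B \<in> carrier_mat m n"
  shows "mtrace (A * B) = (\<Sum>i<n. \<Sum>l<m. A $$ (i, l) * B $$ (l, i))"
proof -
  have "mtrace (A * B) = (\<Sum>i<n. (A * B) $$ (i, i))"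
    using assms by (simp add: mtrace_def)
  also have "\<dots> = (\<Sum>i<n. \<Sum>l<m. A $$ (i, l) * B $$ (l, i))"
    using index_mult_mat_sum[OF assms] by (intro sum.cong) auto
  finally show ?thesis .
qed

lemma mtrace_commute:
  assumes "A \<in> carrier_mat n m" "B \<in> carrier_mat m n"
  shows "mtrace (A * B) = mtrace (B * A)"
  unfolding mtrace_mult[OF assms] mtrace_mult[OF assms(2,1)]
  by (subst sum.swap) (simp add: mult.commute)

lemma mtrace_one [simp]: "mtrace (1\<^sub>m n) = of_nat n"
  by (simp add: mtrace_def)

lemma mtrace_smult:
  assumes "A \<in> carrier_mat n n"
  shows "mtrace (c \<cdot>\<^sub>m A) = c * mtrace A"
  using assms
  by (auto simp: mtrace_def sum_distrib_left intro!: sum.cong)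

text \<open>Reduces the subspaces in the definition of irreducibility to closure conditions, which
  can be checked directly for kernels, images and coordinate spaces.\<close>

lemma subspace_module_vec_iff:
  "VectorSpace.subspace class_ring W (module_vec TYPE(complex) n) \<longleftrightarrow>
     W \<subseteq> carrier_vec n \<and> 0\<^sub>v n \<in> W \<and> (\<forall>u\<in>W. \<forall>v\<in>W. u + v \<in> W) \<and> (\<forall>c. \<forall>v\<in>W. c \<cdot>\<^sub>v v \<in> W)"
proof -
  interpret vec_space "TYPE(complex)" n .
  have "vectorspace class_ring (module_vec TYPE(complex) n)"
    "Module.module class_ring (module_vec TYPE(complex) n)"
    by unfold_locales
  then show ?thesis
    by (auto simp: VectorSpace.subspace_def submodule_def module_vec_simps)
qed

section \<open>Irreducible matrix representations and their intertwiners\<close>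

context
  fixes G :: "('a, 'm) monoid_scheme" (structure)
  assumes grp: "group G"
begin

interpretation group G by (rule grp)

lemma GL_carrier: "A \<in> carrier (GL n) \<longleftrightarrow>
  A \<in> carrier_mat n n \<and> (\<exists>B\<in>carrier_mat n n. B * A = 1\<^sub>m n \<and> A * B = 1\<^sub>m n)"
  by (auto simp: units_of_carrier Units_def ring_mat_simps)

lemma irreducible_rep_carrier:
  assumes "irreducible_rep G n \<rho>" "g \<in> carrier G"
  shows "\<rho> g \<in> carrier_mat n n"
proof -
  have "\<rho> g \<in> carrier (GL n)"
    using assms by (auto simp: irreducible_rep_def intro: hom_in_carrier)
  then show ?thesis by (simp only: GL_carrier)
qed

lemma irreducible_rep_mult:
  assumes "irreducible_rep G n \<rho>" "g \<in> carrier G" "h \<in> carrier G"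
  shows "\<rho> (g \<otimes> h) = \<rho> g * \<rho> h"
proof -
  have "\<rho> (g \<otimes> h) = \<rho> g \<otimes>\<^bsub>GL n\<^esub> \<rho> h"
    using assms by (intro hom_mult) (auto simp: irreducible_rep_def)
  then show ?thesis by (simp only: units_of_mult ring_mat_simps)
qed

lemma irreducible_rep_pos: "irreducible_rep G n \<rho> \<Longrightarrow> 0 < n"
  by (simp add: irreducible_rep_def)

lemma irreducible_rep_one:
  assumes "irreducible_rep G n \<rho>"
  shows "\<rho> \<one> = 1\<^sub>m n"
proof -
  have r: "Group.monoid (mat_mon n)"
    using ring.is_monoid[OF ring_mat] .
  have "group_hom G (GL n) \<rho>"
    using assms monoid.units_group[OF r] grp
    by (simp add: irreducible_rep_def group_hom_def group_hom_axioms_def)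
  from group_hom.hom_one[OF this] show ?thesis
    by (simp add: units_of_one ring_mat_simps)
qed

lemma irreducible_rep_inv:
  assumes "irreducible_rep G n \<rho>" "g \<in> carrier G"
  shows "\<rho> g * \<rho> (inv g) = 1\<^sub>m n" "\<rho> (inv g) * \<rho> g = 1\<^sub>m n"
  using assms irreducible_rep_mult[OF assms(1), of g "inv g"]
    irreducible_rep_mult[OF assms(1), of "inv g" g] irreducible_rep_one[OF assms(1)]
  by auto

lemma irreducible_rep_subspace:
  assumes "irreducible_rep G n \<rho>"
    and "W \<subseteq> carrier_vec n" "0\<^sub>v n \<in> W" "\<And>u v. u \<in> W \<Longrightarrow> v \<in> W \<Longrightarrow> u + v \<in> W"
    and "\<And>c v. v \<in> W \<Longrightarrow> c \<cdot>\<^sub>v v \<in> W"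
    and "\<And>g w. g \<in> carrier G \<Longrightarrow> w \<in> W \<Longrightarrow> \<rho> g *\<^sub>v w \<in> W"
  shows "W = {0\<^sub>v n} \<or> W = carrier_vec n"
proof -
  have "VectorSpace.subspace class_ring W (module_vec TYPE(complex) n)"
    unfolding subspace_module_vec_iff using assms(2-5) by blast
  with assms(1,6) show ?thesis
    unfolding irreducible_rep_def by blast
qed

text \<open>Kernel and image of an intertwiner are invariant subspaces. Since \<open>A\<close> is
  nonzero, irreducibility of \<open>\<sigma>\<close> makes the kernel zero and irreducibility of
  \<open>\<rho>\<close> makes the image everything.\<close>

lemma schur_invertible:
  assumes r: "irreducible_rep G n \<rho>" and s: "irreducible_rep G m \<sigma>"
    and A: "A \<in> carrier_mat n m" and nz: "A \<noteq> 0\<^sub>m n m"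
    and tw: "\<And>g. g \<in> carrier G \<Longrightarrow> \<rho> g * A = A * \<sigma> g"
  shows "n = m \<and> (\<exists>B\<in>carrier_mat n n. A * B = 1\<^sub>m n \<and> B * A = 1\<^sub>m n)"
proof -
  note rc = irreducible_rep_carrier[OF r] and sc = irreducible_rep_carrier[OF s]
  have tw': "\<rho> g *\<^sub>v (A *\<^sub>v v) = A *\<^sub>v (\<sigma> g *\<^sub>v v)" if "g \<in> carrier G" "v \<in> carrier_vec m" for g v
    using assoc_mult_mat_vec[OF rc A, of g v] assoc_mult_mat_vec[OF A sc, of g v] that tw by simp
  have nz': "\<not> (\<forall>v\<in>carrier_vec m. A *\<^sub>v v = 0\<^sub>v n)"
  proof
    assume "\<forall>v\<in>carrier_vec m. A *\<^sub>v v = 0\<^sub>v n"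
    then have "A = 0\<^sub>m n m"
      by (intro eq_mat_on_vec[OF A]) auto
    with nz show False ..
  qed
  define K where "K = {v \<in> carrier_vec m. A *\<^sub>v v = 0\<^sub>v n}"
  have "K = {0\<^sub>v m} \<or> K = carrier_vec m"
  proof (rule irreducible_rep_subspace[OF s])
    fix g w assume "g \<in> carrier G" "w \<in> K"
    then have "A *\<^sub>v (\<sigma> g *\<^sub>v w) = \<rho> g *\<^sub>v 0\<^sub>v n" "\<sigma> g *\<^sub>v w \<in> carrier_vec m"
      using tw'[of g w] sc[of g] by (auto simp: K_def)
    moreover have "\<rho> g *\<^sub>v 0\<^sub>v n = 0\<^sub>v n" using rc[OF \<open>g \<in> carrier G\<close>] by auto
    ultimately show "\<sigma> g *\<^sub>v w \<in> K"
      by (simp add: K_def)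
  qed (use A in \<open>auto simp: K_def mult_add_distrib_mat_vec mult_mat_vec\<close>)
  with nz' have K: "\<And>v. v \<in> carrier_vec m \<Longrightarrow> A *\<^sub>v v = 0\<^sub>v n \<Longrightarrow> v = 0\<^sub>v m"
    unfolding K_def by blast
  define U where "U = (\<lambda>v. A *\<^sub>v v) ` carrier_vec m"
  have "U = {0\<^sub>v n} \<or> U = carrier_vec n"
  proof (rule irreducible_rep_subspace[OF r])
    show "U \<subseteq> carrier_vec n" using A by (auto simp: U_def)
    have "A *\<^sub>v 0\<^sub>v m \<in> U" unfolding U_def by (rule imageI) simp
    moreover have "A *\<^sub>v 0\<^sub>v m = 0\<^sub>v n" using A by auto
    ultimately show "0\<^sub>v n \<in> U" by simp
  next
    fix u v assume "u \<in> U" "v \<in> U"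
    then obtain u' v' where uv: "u' \<in> carrier_vec m" "u = A *\<^sub>v u'" "v' \<in> carrier_vec m" "v = A *\<^sub>v v'"
      unfolding U_def by (elim imageE)
    then have "u + v = A *\<^sub>v (u' + v')" using mult_add_distrib_mat_vec[OF A] by simp
    then show "u + v \<in> U" unfolding U_def using uv by (simp only: image_eqI add_carrier_vec)
  next
    fix c v assume "v \<in> U"
    then obtain v' where v: "v' \<in> carrier_vec m" "v = A *\<^sub>v v'"
      unfolding U_def by (elim imageE)
    then have "c \<cdot>\<^sub>v v = A *\<^sub>v (c \<cdot>\<^sub>v v')" using mult_mat_vec[OF A] by simp
    then show "c \<cdot>\<^sub>v v \<in> U" unfolding U_def using v by (simp only: image_eqI smult_carrier_vec)
  next
    fix g w assume g: "g \<in> carrier G" and "w \<in> U"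
    then obtain v' where v: "v' \<in> carrier_vec m" "w = A *\<^sub>v v'"
      unfolding U_def by (elim imageE)
    then have "\<rho> g *\<^sub>v w = A *\<^sub>v (\<sigma> g *\<^sub>v v')" using tw' g by simp
    moreover have "\<sigma> g *\<^sub>v v' \<in> carrier_vec m" using sc[OF g] v by simp
    ultimately show "\<rho> g *\<^sub>v w \<in> U" unfolding U_def by (simp only: image_eqI)
  qed
  moreover have "U \<noteq> {0\<^sub>v n}"
  proof
    assume "U = {0\<^sub>v n}"
    then have "A *\<^sub>v v = 0\<^sub>v n" if "v \<in> carrier_vec m" for v
      using imageI[OF that, of "\<lambda>v. A *\<^sub>v v"] unfolding U_def by simp
    with nz' show False by simp
  qed
  ultimately have U: "U = carrier_vec n" by simp
  \<comment> \<open>Preimages \<open>b k\<close> of the unit vectors exist by surjectivity; they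
    become the columns of a right inverse \<open>B\<close>.\<close>
  have "\<forall>k. \<exists>v. k < n \<longrightarrow> v \<in> carrier_vec m \<and> A *\<^sub>v v = unit_vec n k"
  proof
    fix k
    have "unit_vec n k \<in> U" using U by simp
    then show "\<exists>v. k < n \<longrightarrow> v \<in> carrier_vec m \<and> A *\<^sub>v v = unit_vec n k"
      unfolding U_def by auto
  qed
  then obtain b where b: "\<And>k. k < n \<Longrightarrow> b k \<in> carrier_vec m \<and> A *\<^sub>v b k = unit_vec n k"
    by metis
  define B where "B = mat m n (\<lambda>(i, k). b k $ i)"
  have B: "B \<in> carrier_mat m n" by (simp add: B_def)
  have AB: "A * B = 1\<^sub>m n"
  proof (rule eq_matI)
    fix i k assume "i < dim_row (1\<^sub>m n :: complex mat)" "k < dim_col (1\<^sub>m n :: complex mat)"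
    then have ik: "i < n" "k < n" by auto
    have "(A * B) $$ (i, k) = (\<Sum>l<m. A $$ (i, l) * B $$ (l, k))"
      by (rule index_mult_mat_sum[OF A B ik])
    also have "\<dots> = (\<Sum>l<m. A $$ (i, l) * b k $ l)"
      using ik by (intro sum.cong) (auto simp: B_def)
    also have "\<dots> = (A *\<^sub>v b k) $ i"
      using b[OF ik(2)] by (intro index_mult_mat_vec_sum[OF A _ ik(1), symmetric]) auto
    finally show "(A * B) $$ (i, k) = 1\<^sub>m n $$ (i, k)"
      using b[OF ik(2)] ik by auto
  qed (use A B in auto)
  \<comment> \<open>\<open>A\<close> kills the difference between \<open>v\<close> and its image
    under \<open>B * A\<close>, so injectivity makes the right inverse a left inverse too.\<close>
  have BA: "B * A = 1\<^sub>m m"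
  proof (rule eq_mat_on_vec)
    fix v :: "complex vec" assume v: "v \<in> carrier_vec m"
    have c: "(B * A) *\<^sub>v v \<in> carrier_vec m" using A B v by auto
    have "A *\<^sub>v ((B * A) *\<^sub>v v) = (A * B) *\<^sub>v (A *\<^sub>v v)"
      using A B v by (simp add: assoc_mult_mat_vec[of _ n m _ n] assoc_mult_mat_vec[of _ m n _ m])
    also have "\<dots> = A *\<^sub>v v" using A v AB by simp
    finally have "A *\<^sub>v ((B * A) *\<^sub>v v - v) = 0\<^sub>v n"
      using A v c by (simp add: mult_minus_distrib_mat_vec)
    from K[OF _ this] have d: "(B * A) *\<^sub>v v - v = 0\<^sub>v m" using c v by auto
    have "(B * A) *\<^sub>v v = ((B * A) *\<^sub>v v - v) + v"
      using c v A B by (intro eq_vecI) auto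
    also have "\<dots> = v" using d v by simp
    finally show "(B * A) *\<^sub>v v = 1\<^sub>m m *\<^sub>v v" using v by simp
  qed (use A B in auto)
  \<comment> \<open>The traces of \<open>A * B\<close> and \<open>B * A\<close> agree, and in
    characteristic zero the trace of an identity matrix determines its size.\<close>
  have "of_nat n = (of_nat m :: complex)"
    using mtrace_commute[OF A B] AB BA by simp
  then have "n = m" by simp
  with AB BA B show ?thesis by auto
qed

text \<open>A complex matrix has an eigenvalue \<open>k\<close>. The difference of \<open>A\<close>
  and \<open>k\<close> times the identity is an intertwiner with nonzero kernel, hence not
  invertible, hence zero.\<close>

lemma schur_scalar:
  assumes r: "irreducible_rep G n \<rho>" and A: "A \<in> carrier_mat n n"
    and tw: "\<And>g. g \<in> carrier G \<Longrightarrow> \<rho> g * A = A * \<rho> g"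
  shows "\<exists>c. A = c \<cdot>\<^sub>m 1\<^sub>m n"
proof -
  note rc = irreducible_rep_carrier[OF r]
  obtain k where "k \<in> spectrum A"
    using spectrum_non_empty[OF A irreducible_rep_pos[OF r]] by auto
  then obtain v where v: "v \<in> carrier_vec n" "v \<noteq> 0\<^sub>v n" "A *\<^sub>v v = k \<cdot>\<^sub>v v"
    using A by (auto simp: spectrum_def eigenvalue_def eigenvector_def)
  define D where "D = A - k \<cdot>\<^sub>m 1\<^sub>m n"
  have D: "D \<in> carrier_mat n n" by (simp add: D_def minus_carrier_mat)
  have Dv: "D *\<^sub>v v = 0\<^sub>v n"
  proof -
    have "(k \<cdot>\<^sub>m 1\<^sub>m n) *\<^sub>v v = k \<cdot>\<^sub>v v"
      using v by (intro eq_vecI) auto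
    then show ?thesis
      using A v by (simp add: D_def minus_mult_distrib_mat_vec[of _ n n])
  qed
  have "D = 0\<^sub>m n n"
  proof (rule ccontr)
    assume "D \<noteq> 0\<^sub>m n n"
    moreover have "\<rho> g * D = D * \<rho> g" if "g \<in> carrier G" for g
      using rc[OF that] A tw[OF that]
      by (simp add: D_def mult_minus_distrib_mat[of _ n n _ n] minus_mult_distrib_mat[of _ n n _ _ n]
          mult_smult_distrib[of _ n n _ n] mult_smult_assoc_mat[of _ n n _ n])
    ultimately obtain B where B: "B \<in> carrier_mat n n" "B * D = 1\<^sub>m n"
      using schur_invertible[OF r r D] by blast
    have "v = (B * D) *\<^sub>v v" using B v by simp
    also have "\<dots> = B *\<^sub>v (D *\<^sub>v v)" by (rule assoc_mult_mat_vec[OF B(1) D v(1)])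
    also have "\<dots> = 0\<^sub>v n" using B(1) Dv by auto
    finally show False using v by simp
  qed
  have "A = k \<cdot>\<^sub>m 1\<^sub>m n"
  proof (rule eq_matI)
    fix i l assume il: "i < dim_row (k \<cdot>\<^sub>m 1\<^sub>m n)" "l < dim_col (k \<cdot>\<^sub>m 1\<^sub>m n)"
    then have "D $$ (i, l) = A $$ (i, l) - (k \<cdot>\<^sub>m 1\<^sub>m n) $$ (i, l)"
      using A by (simp add: D_def)
    with \<open>D = 0\<^sub>m n n\<close> il show "A $$ (i, l) = (k \<cdot>\<^sub>m 1\<^sub>m n) $$ (i, l)"
      by simp
  qed (use A in auto)
  then show ?thesis ..
qed

end

section \<open>Schur orthogonality\<close>

lemma sum_product4:
  fixes a b :: "nat \<Rightarrow> nat \<Rightarrow> complex"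
  shows "(\<Sum>i\<in>I. \<Sum>j\<in>J. a i j) * (\<Sum>l\<in>L. \<Sum>k\<in>K. b l k) =
    (\<Sum>i\<in>I. \<Sum>j\<in>J. \<Sum>l\<in>L. \<Sum>k\<in>K. a i j * b l k)"
  by (simp only: sum_distrib_right) (simp only: sum_distrib_left)

context
  fixes G :: "('a, 'm) monoid_scheme" (structure)
  assumes grp: "group G"
begin

interpretation group G by (rule grp)

lemma irreducible_rep_dim: "irreducible_rep G n \<rho> \<Longrightarrow> rep_dim G \<rho> = n"
  by (simp add: rep_dim_def irreducible_rep_one[OF grp, of n])

text \<open>One common size and an explicit inverse replace \<open>rep_dim\<close> and
  \<open>GL\<close>; isomorphisms are built and taken apart in this form.\<close>

lemma rep_iso_iff:
  "(\<rho>, \<sigma>) \<in> rep_iso G \<longleftrightarrow>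
     (\<exists>n P P'. irreducible_rep G n \<rho> \<and> irreducible_rep G n \<sigma> \<and> P \<in> carrier_mat n n \<and>
        P' \<in> carrier_mat n n \<and> P * P' = 1\<^sub>m n \<and> P' * P = 1\<^sub>m n \<and> (\<forall>g \<in> carrier G. P * \<rho> g = \<sigma> g * P))"
  (is "_ = ?R")
proof
  assume "(\<rho>, \<sigma>) \<in> rep_iso G"
  then obtain n m P where *: "irreducible_rep G n \<rho>" "irreducible_rep G m \<sigma>"
    "rep_dim G \<rho> = rep_dim G \<sigma>" "P \<in> carrier (GL (rep_dim G \<rho>))"
    "\<forall>g \<in> carrier G. P * \<rho> g = \<sigma> g * P"
    unfolding rep_iso_def irreducible_reps_def by blast
  then have "m = n" "P \<in> carrier (GL n)" using irreducible_rep_dim by auto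
  then show ?R using * unfolding GL_carrier[OF grp] by blast
next
  assume ?R
  then obtain n P P' where *: "irreducible_rep G n \<rho>" "irreducible_rep G n \<sigma>"
    "P \<in> carrier_mat n n" "P' \<in> carrier_mat n n" "P * P' = 1\<^sub>m n" "P' * P = 1\<^sub>m n"
    "\<forall>g \<in> carrier G. P * \<rho> g = \<sigma> g * P"
    by blast
  then have "P \<in> carrier (GL n)" unfolding GL_carrier[OF grp] by blast
  then show "(\<rho>, \<sigma>) \<in> rep_iso G"
    using * irreducible_rep_dim[OF *(1)] irreducible_rep_dim[OF *(2)]
    unfolding rep_iso_def irreducible_reps_def by auto
qed

lemma sum_translate_left:
  assumes "h \<in> carrier G"
  shows "(\<Sum>g\<in>carrier G. f (h \<otimes> g)) = (\<Sum>g\<in>carrier G. f g)"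
  by (rule sum.reindex_bij_witness[of _ "\<lambda>g. inv h \<otimes> g" "\<lambda>g. h \<otimes> g"])
    (use assms in \<open>auto simp: m_assoc[symmetric]\<close>)

lemma sum_translate_right:
  assumes "h \<in> carrier G"
  shows "(\<Sum>g\<in>carrier G. f (g \<otimes> h)) = (\<Sum>g\<in>carrier G. f g)"
  by (rule sum.reindex_bij_witness[of _ "\<lambda>g. g \<otimes> inv h" "\<lambda>g. g \<otimes> h"])
    (use assms in \<open>auto simp: m_assoc\<close>)

text \<open>\<open>A\<close> is the sum over \<open>g\<close> of \<open>\<rho> g\<close> times the
  matrix unit at \<open>(j, k)\<close> times \<open>\<sigma> (inv g)\<close>; such an average over
  the group is an intertwiner.\<close>

lemma schur_average:
  assumes r: "irreducible_rep G n \<rho>" and s: "irreducible_rep G m \<sigma>"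
    and jk: "j < n" "k < m" and h: "h \<in> carrier G"
  defines "A \<equiv> mat n m (\<lambda>(i, l). \<Sum>g\<in>carrier G. \<rho> g $$ (i, j) * \<sigma> (inv g) $$ (k, l))"
  shows "\<rho> h * A = A * \<sigma> h"
proof (rule eq_matI)
  note rc = irreducible_rep_carrier[OF grp r] and sc = irreducible_rep_carrier[OF grp s]
  have A: "A \<in> carrier_mat n m" by (simp add: A_def)
  show "dim_row (\<rho> h * A) = dim_row (A * \<sigma> h)" "dim_col (\<rho> h * A) = dim_col (A * \<sigma> h)"
    using A rc[OF h] sc[OF h] by auto
  fix i l assume "i < dim_row (A * \<sigma> h)" "l < dim_col (A * \<sigma> h)"
  then have il: "i < n" "l < m" using A sc[OF h] by auto
  have "(\<rho> h * A) $$ (i, l) = (\<Sum>a<n. \<rho> h $$ (i, a) * A $$ (a, l))"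
    by (rule index_mult_mat_sum[OF rc[OF h] A il])
  also have "\<dots> = (\<Sum>a<n. \<Sum>g\<in>carrier G. \<rho> h $$ (i, a) * \<rho> g $$ (a, j) * \<sigma> (inv g) $$ (k, l))"
    using il by (intro sum.cong) (auto simp: A_def sum_distrib_left mult.assoc)
  also have "\<dots> = (\<Sum>g\<in>carrier G. (\<Sum>a<n. \<rho> h $$ (i, a) * \<rho> g $$ (a, j)) * \<sigma> (inv g) $$ (k, l))"
    by (subst sum.swap) (simp add: sum_distrib_right)
  \<comment> \<open>Writing \<open>inv g\<close> as \<open>inv (h \<otimes> g) \<otimes> h\<close>
    makes the summand a function of \<open>h \<otimes> g\<close>, ready for translation
    invariance.\<close>
  also have "\<dots> = (\<Sum>g\<in>carrier G. \<rho> (h \<otimes> g) $$ (i, j) * \<sigma> (inv (h \<otimes> g) \<otimes> h) $$ (k, l))"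
  proof (intro sum.cong refl)
    fix g assume g: "g \<in> carrier G"
    then have "inv (h \<otimes> g) \<otimes> h = inv g"
      using h by (simp add: inv_mult_group m_assoc)
    then show "(\<Sum>a<n. \<rho> h $$ (i, a) * \<rho> g $$ (a, j)) * \<sigma> (inv g) $$ (k, l) =
        \<rho> (h \<otimes> g) $$ (i, j) * \<sigma> (inv (h \<otimes> g) \<otimes> h) $$ (k, l)"
      using index_mult_mat_sum[OF rc[OF h] rc[OF g] il(1) jk(1)]
        irreducible_rep_mult[OF grp r h g] by simp
  qed
  also have "\<dots> = (\<Sum>g\<in>carrier G. \<rho> g $$ (i, j) * \<sigma> (inv g \<otimes> h) $$ (k, l))"
    by (rule sum_translate_left[OF h, of "\<lambda>g. \<rho> g $$ (i, j) * \<sigma> (inv g \<otimes> h) $$ (k, l)"])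
  also have "\<dots> = (\<Sum>g\<in>carrier G. \<rho> g $$ (i, j) * (\<Sum>b<m. \<sigma> (inv g) $$ (k, b) * \<sigma> h $$ (b, l)))"
  proof (intro sum.cong refl)
    fix g assume g: "g \<in> carrier G"
    show "\<rho> g $$ (i, j) * \<sigma> (inv g \<otimes> h) $$ (k, l) =
        \<rho> g $$ (i, j) * (\<Sum>b<m. \<sigma> (inv g) $$ (k, b) * \<sigma> h $$ (b, l))"
      using index_mult_mat_sum[OF sc sc[OF h] jk(2) il(2), of "inv g"]
        irreducible_rep_mult[OF grp s _ h, of "inv g"] g by simp
  qed
  also have "\<dots> = (\<Sum>b<m. (\<Sum>g\<in>carrier G. \<rho> g $$ (i, j) * \<sigma> (inv g) $$ (k, b)) * \<sigma> h $$ (b, l))"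
    by (simp add: sum_distrib_left sum_distrib_right mult.assoc) (rule sum.swap)
  also have "\<dots> = (\<Sum>b<m. A $$ (i, b) * \<sigma> h $$ (b, l))"
    using il by (intro sum.cong) (auto simp: A_def)
  also have "\<dots> = (A * \<sigma> h) $$ (i, l)"
    by (rule index_mult_mat_sum[OF A sc[OF h] il, symmetric])
  finally show "(\<rho> h * A) $$ (i, l) = (A * \<sigma> h) $$ (i, l)" .
qed

text \<open>A nonzero \<open>A\<close> would be invertible by Schur's lemma. Since \<open>A\<close>
  goes from \<open>\<sigma>\<close> to \<open>\<rho>\<close>, it is the inverse \<open>B\<close>
  that would put the pair in \<open>rep_iso G\<close>.\<close>

lemma intertwiner_zero:
  assumes r: "irreducible_rep G n \<rho>" and s: "irreducible_rep G m \<sigma>"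
    and ne: "(\<rho>, \<sigma>) \<notin> rep_iso G" and A: "A \<in> carrier_mat n m"
    and tw: "\<And>g. g \<in> carrier G \<Longrightarrow> \<rho> g * A = A * \<sigma> g"
  shows "A = 0\<^sub>m n m"
proof (rule ccontr)
  assume "A \<noteq> 0\<^sub>m n m"
  from schur_invertible[OF grp r s A this tw] obtain B where
    nm: "n = m" and B: "B \<in> carrier_mat n n" "A * B = 1\<^sub>m n" "B * A = 1\<^sub>m n"
    by blast
  have A': "A \<in> carrier_mat n n" using A nm by simp
  have "B * \<rho> g = \<sigma> g * B" if g: "g \<in> carrier G" for g
  proof -
    note c = irreducible_rep_carrier[OF grp r g] irreducible_rep_carrier[OF grp s g, folded nm] A' B(1)
    have "B * \<rho> g = B * (\<rho> g * (A * B))" using c B by simp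
    also have "\<dots> = B * ((\<rho> g * A) * B)" using c by (simp add: assoc_mult_mat[of _ n n _ n _ n])
    also have "\<dots> = (B * A) * (\<sigma> g * B)" unfolding tw[OF g]
      using c by (simp add: assoc_mult_mat[of _ n n _ n _ n] mult_carrier_mat[of _ n n])
    also have "\<dots> = \<sigma> g * B" using B c by simp
    finally show ?thesis .
  qed
  then have "(\<rho>, \<sigma>) \<in> rep_iso G"
    unfolding rep_iso_iff using r s A' B nm by blast
  with ne show False ..
qed

lemma schur_orthogonality_neq:
  assumes r: "irreducible_rep G n \<rho>" and s: "irreducible_rep G m \<sigma>"
    and ne: "(\<rho>, \<sigma>) \<notin> rep_iso G" and "i < n" "j < n" "k < m" "l < m"
  shows "(\<Sum>g\<in>carrier G. \<rho> g $$ (i, j) * \<sigma> (inv g) $$ (k, l)) = 0"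
proof -
  define A where "A = mat n m (\<lambda>(i, l). \<Sum>g\<in>carrier G. \<rho> g $$ (i, j) * \<sigma> (inv g) $$ (k, l))"
  have "A = 0\<^sub>m n m"
  proof (rule intertwiner_zero[OF r s ne])
    show "A \<in> carrier_mat n m" by (simp add: A_def)
    show "\<rho> g * A = A * \<sigma> g" if "g \<in> carrier G" for g
      unfolding A_def by (rule schur_average[OF r s assms(5,6) that])
  qed
  then have "A $$ (i, l) = 0" using assms by simp
  then show ?thesis using assms by (simp add: A_def)
qed

text \<open>The average is a scalar \<open>c\<close> by Schur's lemma, and its trace determines
  \<open>c\<close>: the sum of the diagonal entries collapses, for each \<open>g\<close>, to the
  entry \<open>(k, j)\<close> of \<open>\<rho> (inv g) * \<rho> g\<close>, which is an identity
  matrix.\<close>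

lemma schur_orthogonality_eq:
  assumes r: "irreducible_rep G n \<rho>" and ijkl: "i < n" "j < n" "k < n" "l < n"
  shows "(\<Sum>g\<in>carrier G. \<rho> g $$ (i, j) * \<rho> (inv g) $$ (k, l)) =
    (if i = l \<and> j = k then of_nat (card (carrier G)) / of_nat n else 0)"
proof -
  define A where "A = mat n n (\<lambda>(i, l). \<Sum>g\<in>carrier G. \<rho> g $$ (i, j) * \<rho> (inv g) $$ (k, l))"
  have A: "A \<in> carrier_mat n n" by (simp add: A_def)
  have "\<rho> g * A = A * \<rho> g" if "g \<in> carrier G" for g
    unfolding A_def by (rule schur_average[OF r r ijkl(2,3) that])
  from schur_scalar[OF grp r A this] obtain c where c: "A = c \<cdot>\<^sub>m 1\<^sub>m n" by blast
  have "c * of_nat n = mtrace A" unfolding c by (simp add: mtrace_smult[of _ n])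
  also have "\<dots> = (\<Sum>i<n. \<Sum>g\<in>carrier G. \<rho> g $$ (i, j) * \<rho> (inv g) $$ (k, i))"
    by (simp add: mtrace_def A_def)
  also have "\<dots> = (\<Sum>g\<in>carrier G. (\<Sum>i<n. \<rho> (inv g) $$ (k, i) * \<rho> g $$ (i, j)))"
    by (subst sum.swap) (simp add: mult.commute)
  also have "\<dots> = (\<Sum>g\<in>carrier G. if j = k then 1 else 0)"
  proof (intro sum.cong refl)
    fix g assume g: "g \<in> carrier G"
    have "(\<Sum>i<n. \<rho> (inv g) $$ (k, i) * \<rho> g $$ (i, j)) = (\<rho> (inv g) * \<rho> g) $$ (k, j)"
      using g ijkl irreducible_rep_carrier[OF grp r] by (intro index_mult_mat_sum[symmetric]) auto
    then show "(\<Sum>i<n. \<rho> (inv g) $$ (k, i) * \<rho> g $$ (i, j)) = (if j = k then 1 else 0)"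
      using irreducible_rep_inv(2)[OF grp r g] ijkl by simp
  qed
  finally have "c = (if j = k then of_nat (card (carrier G)) / of_nat n else 0)"
    using irreducible_rep_pos[OF grp r] by (auto simp: field_simps)
  moreover have "A $$ (i, l) = (if i = l then c else 0)" unfolding c using ijkl by simp
  ultimately show ?thesis using ijkl by (auto simp: A_def)
qed

text \<open>Characters alone do not suffice later: the functions on the fiber are traces of a
  representation times a fixed matrix. Expanding both traces into entries reduces this form to the
  entrywise relations.\<close>

lemma schur_orthogonality_trace_neq:
  assumes r: "irreducible_rep G n \<rho>" and s: "irreducible_rep G m \<sigma>"
    and ne: "(\<rho>, \<sigma>) \<notin> rep_iso G" and A: "A \<in> carrier_mat n n" and B: "B \<in> carrier_mat m m"
  shows "(\<Sum>g\<in>carrier G. mtrace (\<rho> g * A) * mtrace (B * \<sigma> (inv g))) = 0"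
proof -
  have "(\<Sum>g\<in>carrier G. mtrace (\<rho> g * A) * mtrace (B * \<sigma> (inv g))) =
    (\<Sum>g\<in>carrier G. \<Sum>i<n. \<Sum>j<n. \<Sum>l<m. \<Sum>k<m.
       A $$ (j, i) * B $$ (l, k) * (\<rho> g $$ (i, j) * \<sigma> (inv g) $$ (k, l)))"
    using mtrace_mult[OF irreducible_rep_carrier[OF grp r] A]
      mtrace_mult[OF B irreducible_rep_carrier[OF grp s]]
    by (intro sum.cong refl) (simp add: sum_product4 mult_ac)
  also have "\<dots> = (\<Sum>i<n. \<Sum>j<n. \<Sum>l<m. \<Sum>k<m. A $$ (j, i) * B $$ (l, k) *
      (\<Sum>g\<in>carrier G. \<rho> g $$ (i, j) * \<sigma> (inv g) $$ (k, l)))"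
    by (simp add: sum.swap[of _ _ "carrier G"] sum_distrib_left)
  also have "\<dots> = 0"
    using schur_orthogonality_neq[OF r s ne] by simp
  finally show ?thesis .
qed

lemma schur_orthogonality_trace_eq:
  assumes r: "irreducible_rep G n \<rho>" and A: "A \<in> carrier_mat n n" and B: "B \<in> carrier_mat n n"
  shows "(\<Sum>g\<in>carrier G. mtrace (\<rho> g * A) * mtrace (B * \<rho> (inv g))) =
    of_nat (card (carrier G)) / of_nat n * mtrace (B * A)"
proof -
  let ?c = "of_nat (card (carrier G)) / of_nat n :: complex"
  have "(\<Sum>g\<in>carrier G. mtrace (\<rho> g * A) * mtrace (B * \<rho> (inv g))) =
    (\<Sum>g\<in>carrier G. \<Sum>i<n. \<Sum>j<n. \<Sum>l<n. \<Sum>k<n.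
       A $$ (j, i) * B $$ (l, k) * (\<rho> g $$ (i, j) * \<rho> (inv g) $$ (k, l)))"
    using mtrace_mult[OF irreducible_rep_carrier[OF grp r] A]
      mtrace_mult[OF B irreducible_rep_carrier[OF grp r]]
    by (intro sum.cong refl) (simp add: sum_product4 mult_ac)
  also have "\<dots> = (\<Sum>i<n. \<Sum>j<n. \<Sum>l<n. \<Sum>k<n. A $$ (j, i) * B $$ (l, k) *
      (\<Sum>g\<in>carrier G. \<rho> g $$ (i, j) * \<rho> (inv g) $$ (k, l)))"
    by (simp add: sum.swap[of _ _ "carrier G"] sum_distrib_left)
  also have "\<dots> = (\<Sum>i<n. \<Sum>j<n. \<Sum>l<n. if l = i then A $$ (j, i) * B $$ (i, j) * ?c else 0)"
  proof (intro sum.cong refl)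
    fix i j l assume "i \<in> {..<n}" "j \<in> {..<n}" "l \<in> {..<n}"
    then have "(\<Sum>k<n. A $$ (j, i) * B $$ (l, k) *
        (\<Sum>g\<in>carrier G. \<rho> g $$ (i, j) * \<rho> (inv g) $$ (k, l))) =
      (\<Sum>k<n. if k = j then (if l = i then A $$ (j, i) * B $$ (i, j) * ?c else 0) else 0)"
      using schur_orthogonality_eq[OF r] by (intro sum.cong refl) auto
    then show "(\<Sum>k<n. A $$ (j, i) * B $$ (l, k) *
        (\<Sum>g\<in>carrier G. \<rho> g $$ (i, j) * \<rho> (inv g) $$ (k, l))) =
      (if l = i then A $$ (j, i) * B $$ (i, j) * ?c else 0)"
      using \<open>j \<in> {..<n}\<close> by simp
  qed
  also have "\<dots> = ?c * (\<Sum>i<n. \<Sum>j<n. B $$ (i, j) * A $$ (j, i))"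
    by (simp add: sum_distrib_left mult_ac)
  finally show ?thesis unfolding mtrace_mult[OF B A] .
qed

end

section \<open>Completeness of matrix coefficients\<close>

lemma in_span_indicators:
  assumes X: "finite X" and f: "\<And>x. x \<notin> X \<Longrightarrow> f x = 0"
  shows "f \<in> fs.span ((\<lambda>y x. if x = y then 1 else 0) ` X)"
proof -
  let ?e = "\<lambda>y x. if x = y then 1 else (0 :: complex)"
  have "f = (\<Sum>y\<in>X. fscale (f y) (?e y))"
  proof
    fix x
    have "(\<Sum>y\<in>X. f y * (if x = y then 1 else 0)) = (\<Sum>y\<in>X. if x = y then f x else 0)"
      by (intro sum.cong) auto
    also have "\<dots> = f x"
      using X f by (simp add: sum.delta')
    finally show "f x = (\<Sum>y\<in>X. fscale (f y) (?e y)) x"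
      by (simp add: sum_fun_apply)
  qed
  also have "\<dots> \<in> fs.span (?e ` X)"
    by (intro fs.span_sum fs.span_scale fs.span_base) auto
  finally show ?thesis .
qed

text \<open>The indicators of the points of \<open>X\<close> span all functions supported on
  \<open>X\<close>, which bounds the size of \<open>B\<close>. This makes the search for a minimal
  invariant subspace possible and later gives finiteness of \<open>I\<close>.\<close>

lemma finite_independent_functions:
  assumes "finite X" and "fs.independent B" and "\<And>f x. f \<in> B \<Longrightarrow> x \<notin> X \<Longrightarrow> f x = 0"
  shows "finite B"
proof -
  have "B \<subseteq> fs.span ((\<lambda>y x. if x = y then 1 else 0) ` X)"
    using in_span_indicators[OF assms(1)] assms(3) by blast
  then show ?thesis
    using fs.independent_span_bound[of "(\<lambda>y x. if x = y then 1 else 0) ` X" B] assms(1,2) by auto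
qed

section \<open>The right regular representation and the complement of the matrix
  coefficients\<close>

context
  fixes G :: "('a, 'm) monoid_scheme" (structure)
  assumes grp: "group G" and fin: "finite (carrier G)"
begin

interpretation group G by (rule grp)

text \<open>The right regular representation, cut off so that translates stay supported on
  \<open>carrier G\<close>.\<close>

definition rtrans :: "'a \<Rightarrow> ('a \<Rightarrow> complex) \<Rightarrow> 'a \<Rightarrow> complex" where
  "rtrans h f = (\<lambda>x. if x \<in> carrier G then f (x \<otimes> h) else 0)"

lemma rtrans_linear: "rtrans h (\<Sum>i\<in>I. fscale (u i) (f i)) = (\<Sum>i\<in>I. fscale (u i) (rtrans h (f i)))"
  by (auto simp: rtrans_def fun_eq_iff sum_fun_apply)

lemma rtrans_rtrans:
  "h \<in> carrier G \<Longrightarrow> k \<in> carrier G \<Longrightarrow> rtrans h (rtrans k f) = rtrans (h \<otimes> k) f"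
  by (auto simp: rtrans_def fun_eq_iff m_assoc)

text \<open>The orthogonal complement of all matrix coefficients. The conjugate sits on
  \<open>f\<close>, so an element that is itself a combination of coefficients has vanishing sum of
  squared absolute values.\<close>

definition coef_perp :: "('a \<Rightarrow> complex) set" where
  "coef_perp = {f. (\<forall>x. x \<notin> carrier G \<longrightarrow> f x = 0) \<and>
     (\<forall>n \<rho>. irreducible_rep G n \<rho> \<longrightarrow>
        (\<forall>k<n. \<forall>l<n. (\<Sum>g\<in>carrier G. cnj (f g) * \<rho> g $$ (k, l)) = 0))}"

lemma coef_perp_outside: "f \<in> coef_perp \<Longrightarrow> x \<notin> carrier G \<Longrightarrow> f x = 0"
  by (simp add: coef_perp_def)

lemma subspace_coef_perp: "fs.subspace coef_perp"
  unfolding fs.subspace_def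
proof (intro conjI ballI allI)
  show "0 \<in> coef_perp" by (simp add: coef_perp_def)
next
  fix f g assume "f \<in> coef_perp" "g \<in> coef_perp"
  then show "f + g \<in> coef_perp"
    by (simp add: coef_perp_def distrib_right sum.distrib)
next
  fix c f assume "f \<in> coef_perp"
  then show "fscale c f \<in> coef_perp"
    by (simp add: coef_perp_def mult.assoc flip: sum_distrib_left)
qed

text \<open>A change of variable moves the translation onto \<open>\<rho>\<close>, and a coefficient
  of \<open>\<rho> (g \<otimes> inv h)\<close> is a combination of coefficients of
  \<open>\<rho> g\<close> with factors independent of \<open>g\<close>.\<close>

lemma rtrans_coef_perp:
  assumes f: "f \<in> coef_perp" and h: "h \<in> carrier G"
  shows "rtrans h f \<in> coef_perp"
  unfolding coef_perp_def
proof (intro CollectI conjI allI impI)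
  show "x \<notin> carrier G \<Longrightarrow> rtrans h f x = 0" for x by (simp add: rtrans_def)
  fix n \<rho> k l assume r: "irreducible_rep G n \<rho>" and kl: "k < n" "l < n"
  note rc = irreducible_rep_carrier[OF grp r]
  have "(\<Sum>g\<in>carrier G. cnj (rtrans h f g) * \<rho> g $$ (k, l)) =
    (\<Sum>g\<in>carrier G. cnj (f (g \<otimes> h)) * \<rho> ((g \<otimes> h) \<otimes> inv h) $$ (k, l))"
    using h by (intro sum.cong refl) (simp add: rtrans_def m_assoc)
  also have "\<dots> = (\<Sum>g\<in>carrier G. cnj (f g) * \<rho> (g \<otimes> inv h) $$ (k, l))"
    by (rule sum_translate_right[OF grp h, of "\<lambda>g. cnj (f g) * \<rho> (g \<otimes> inv h) $$ (k, l)"])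
  also have "\<dots> = (\<Sum>g\<in>carrier G. cnj (f g) * (\<Sum>m<n. \<rho> g $$ (k, m) * \<rho> (inv h) $$ (m, l)))"
    using h kl irreducible_rep_mult[OF grp r] index_mult_mat_sum[OF rc rc kl]
    by (intro sum.cong refl) simp
  also have "\<dots> = (\<Sum>m<n. (\<Sum>g\<in>carrier G. cnj (f g) * \<rho> g $$ (k, m)) * \<rho> (inv h) $$ (m, l))"
    by (simp add: sum_distrib_left sum_distrib_right mult.assoc) (rule sum.swap)
  also have "\<dots> = 0"
    using f r kl by (simp add: coef_perp_def)
  finally show "(\<Sum>g\<in>carrier G. cnj (rtrans h f g) * \<rho> g $$ (k, l)) = 0" .
qed

text \<open>A nonzero invariant subspace of \<open>coef_perp\<close> is represented by a basis, so
  that minimal dimension becomes least cardinality. For independent \<open>B\<close>, the condition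
  \<open>B \<noteq> {}\<close> says that the span is nonzero.\<close>

definition invariant_basis :: "('a \<Rightarrow> complex) set \<Rightarrow> bool" where
  "invariant_basis B \<longleftrightarrow> B \<noteq> {} \<and> finite B \<and> fs.independent B \<and> B \<subseteq> coef_perp \<and>
     (\<forall>h\<in>carrier G. \<forall>f\<in>fs.span B. rtrans h f \<in> fs.span B)"

lemma invariant_basisI:
  assumes S: "fs.subspace S" "S \<subseteq> coef_perp" "f \<in> S" "f \<noteq> 0"
    and inv: "\<And>h f. h \<in> carrier G \<Longrightarrow> f \<in> S \<Longrightarrow> rtrans h f \<in> S"
  shows "\<exists>B. invariant_basis B \<and> fs.span B = S"
proof -
  obtain B where B: "B \<subseteq> S" "fs.independent B" "S \<subseteq> fs.span B"
    using fs.maximal_independent_subset by blast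
  have sp: "fs.span B = S"
    using B fs.span_minimal[OF B(1) S(1)] by blast
  have "finite B"
    by (rule finite_independent_functions[OF fin B(2)]) (use B(1) S(2) coef_perp_outside in blast)
  moreover have "B \<noteq> {}"
    using sp S(3,4) by auto
  moreover have "B \<subseteq> coef_perp" using B(1) S(2) by (rule order_trans)
  ultimately have "invariant_basis B"
    using B(2) inv by (simp add: invariant_basis_def sp)
  with sp show ?thesis by blast
qed

lemma minimal_invariant_basis:
  assumes "f \<in> coef_perp" "f \<noteq> 0"
  shows "\<exists>B. invariant_basis B \<and> (\<forall>B'. invariant_basis B' \<longrightarrow> card B \<le> card B')"
proof -
  have "\<exists>B. invariant_basis B \<and> fs.span B = coef_perp"
    by (rule invariant_basisI[OF subspace_coef_perp subset_refl assms]) (rule rtrans_coef_perp)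
  then obtain B where "invariant_basis B" by blast
  from ex_has_least_nat[of invariant_basis, OF this, of card] show ?thesis .
qed

text \<open>Otherwise some \<open>b\<close> in \<open>B\<close> lies outside
  \<open>fs.span B'\<close>, and \<open>insert b B'\<close> is an independent subset of
  \<open>fs.span B\<close> with more than \<open>card B\<close> elements, because
  \<open>card B'\<close> is already at least \<open>card B\<close>.\<close>

lemma invariant_basis_minimal_span:
  assumes B: "invariant_basis B" and min: "\<And>B'. invariant_basis B' \<Longrightarrow> card B \<le> card B'"
    and B': "invariant_basis B'" "fs.span B' \<subseteq> fs.span B"
  shows "fs.span B' = fs.span B"
proof -
  have "B \<subseteq> fs.span B'"
  proof
    fix b assume b: "b \<in> B"
    show "b \<in> fs.span B'"
    proof (rule ccontr)
      assume n: "b \<notin> fs.span B'"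
      then have "fs.independent (insert b B')"
        using B'(1) by (intro fs.independent_insertI) (auto simp: invariant_basis_def)
      moreover have "insert b B' \<subseteq> fs.span B"
        using b B'(2) fs.span_superset by blast
      moreover have "finite B" using B by (simp add: invariant_basis_def)
      ultimately have "card (insert b B') \<le> card B"
        using fs.independent_span_bound by blast
      moreover have "b \<notin> B'" using n fs.span_base by blast
      moreover have "finite B'" using B'(1) by (simp add: invariant_basis_def)
      ultimately show False using min[OF B'(1)] by simp
    qed
  qed
  then show ?thesis
    using B'(2) fs.span_minimal[OF _ fs.subspace_span] by blast
qed

text \<open>
  A minimal right-translation-invariant subspace of \<open>coef_perp\<close> carries an irreducible representation,
  and its elements are matrix coefficients of that representation, so they are orthogonal to themselves.
\<close>

lemma coef_perp_trivial:
  assumes f: "f \<in> coef_perp"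
  shows "f = 0"
proof (rule ccontr)
  assume "f \<noteq> 0"
  from minimal_invariant_basis[OF f this] obtain B where B: "invariant_basis B"
    and min: "\<And>B'. invariant_basis B' \<Longrightarrow> card B \<le> card B'" by blast
  have Bf: "finite B" "B \<noteq> {}" "fs.independent B" "B \<subseteq> coef_perp"
    and Binv: "\<And>h f. h \<in> carrier G \<Longrightarrow> f \<in> fs.span B \<Longrightarrow> rtrans h f \<in> fs.span B"
    using B by (auto simp: invariant_basis_def)
  define n where "n = card B"
  obtain b where b: "bij_betw b {..<n} B"
    using ex_bij_betw_nat_finite[OF Bf(1)] unfolding n_def atLeast0LessThan by blast
  have n: "0 < n" using Bf by (simp add: n_def card_gt_0_iff)
  have bB: "b i \<in> B" if "i < n" for i using bij_betwE[OF b] that by blast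
  have spanB: "fs.span B \<subseteq> coef_perp"
    by (rule fs.span_minimal[OF Bf(4) subspace_coef_perp])
  \<comment> \<open>\<open>comb\<close> is the coordinate isomorphism from vectors of length
    \<open>n\<close> onto \<open>fs.span B\<close>; the next facts establish linearity, injectivity
    and surjectivity.\<close>
  define comb where "comb u = (\<Sum>i<n. fscale (u $ i) (b i))" for u :: "complex vec"
  have comb_span: "comb u \<in> fs.span B" for u
    unfolding comb_def by (intro fs.span_sum fs.span_scale fs.span_base) (use bB in auto)
  have comb_add: "comb (u + v) = comb u + comb v"
    if "u \<in> carrier_vec n" "v \<in> carrier_vec n" for u v
  proof
    fix x
    have "comb (u + v) x = (\<Sum>i<n. u $ i * b i x + v $ i * b i x)"
      unfolding comb_def sum_fun_apply using that by (intro sum.cong refl) (simp add: distrib_right)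
    then show "comb (u + v) x = (comb u + comb v) x"
      by (simp add: comb_def sum_fun_apply sum.distrib)
  qed
  have comb_smult: "comb (c \<cdot>\<^sub>v u) = fscale c (comb u)" if "u \<in> carrier_vec n" for c u
  proof
    fix x
    have "comb (c \<cdot>\<^sub>v u) x = (\<Sum>i<n. c * (u $ i * b i x))"
      unfolding comb_def sum_fun_apply using that by (intro sum.cong refl) (simp add: mult.assoc)
    then show "comb (c \<cdot>\<^sub>v u) x = fscale c (comb u) x"
      by (simp add: comb_def sum_fun_apply sum_distrib_left)
  qed
  have comb_zero: "comb (0\<^sub>v n) = 0"
    by (auto simp: comb_def fun_eq_iff sum_fun_apply)
  have comb_ker: "u = 0\<^sub>v n" if u: "u \<in> carrier_vec n" and z: "comb u = 0" for u
  proof (rule eq_vecI)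
    fix i assume "i < dim_vec (0\<^sub>v n)"
    then have i: "i < n" by simp
    \<comment> \<open>Independence speaks of sums over the set \<open>B\<close>, so the coordinates
      are reindexed along the bijection \<open>b\<close>.\<close>
    have "(\<Sum>w\<in>B. fscale (u $ the_inv_into {..<n} b w) w) =
      (\<Sum>i<n. fscale (u $ the_inv_into {..<n} b (b i)) (b i))"
      by (rule sum.reindex_bij_betw[OF b, symmetric])
    also have "\<dots> = comb u"
      unfolding comb_def using b by (intro sum.cong) (auto simp: bij_betw_def the_inv_into_f_f)
    finally have "(\<Sum>w\<in>B. fscale (u $ the_inv_into {..<n} b w) w) = 0" using z by simp
    from fs.independentD[OF Bf(3,1) subset_refl this bB[OF i]]
    have "u $ the_inv_into {..<n} b (b i) = 0" .
    then show "u $ i = 0\<^sub>v n $ i"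
      using b i by (simp add: bij_betw_def the_inv_into_f_f)
  qed (use u in auto)
  have comb_inj: "u = v" if uv: "u \<in> carrier_vec n" "v \<in> carrier_vec n" "comb u = comb v" for u v
  proof -
    have "comb (u + (-1) \<cdot>\<^sub>v v) = comb u + fscale (-1) (comb v)"
      using uv comb_add comb_smult by simp
    also have "\<dots> = 0" unfolding uv(3) by (simp add: fun_eq_iff)
    finally have z: "u + (-1) \<cdot>\<^sub>v v = 0\<^sub>v n" using uv comb_ker by simp
    show "u = v"
    proof (rule eq_vecI)
      fix i assume "i < dim_vec v"
      then show "u $ i = v $ i" using uv arg_cong[OF z, of "\<lambda>w. w $ i"] by simp
    qed (use uv in auto)
  qed
  have comb_surj: "\<exists>u\<in>carrier_vec n. comb u = f" if "f \<in> fs.span B" for f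
  proof -
    from that obtain a where "f = (\<Sum>w\<in>B. fscale (a w) w)"
      unfolding fs.span_finite[OF Bf(1)] by blast
    also have "\<dots> = (\<Sum>i<n. fscale (a (b i)) (b i))"
      by (rule sum.reindex_bij_betw[OF b, symmetric])
    also have "\<dots> = comb (vec n (\<lambda>i. a (b i)))"
      unfolding comb_def by (intro sum.cong) auto
    finally show ?thesis by (intro bexI[of _ "vec n (\<lambda>i. a (b i))"]) auto
  qed
  \<comment> \<open>\<open>r h j\<close> holds the coordinates of the translate of
    \<open>b j\<close> and becomes column \<open>j\<close> of the matrix of translation by
    \<open>h\<close>.\<close>
  define r where "r h j = (SOME u. u \<in> carrier_vec n \<and> comb u = rtrans h (b j))" for h j
  have r: "r h j \<in> carrier_vec n \<and> comb (r h j) = rtrans h (b j)" if "h \<in> carrier G" "j < n" for h j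
  proof -
    have "\<exists>u. u \<in> carrier_vec n \<and> comb u = rtrans h (b j)"
      using comb_surj[OF Binv[OF that(1) fs.span_base[OF bB[OF that(2)]]]] by (simp only: Bex_def)
    from someI_ex[OF this] show ?thesis unfolding r_def .
  qed
  define \<rho> where "\<rho> h = mat n n (\<lambda>(i, j). r h j $ i)" for h
  have \<rho>c: "\<rho> h \<in> carrier_mat n n" for h by (simp add: \<rho>_def)
  have comb_\<rho>: "comb (\<rho> h *\<^sub>v u) = rtrans h (comb u)"
    if h: "h \<in> carrier G" and u: "u \<in> carrier_vec n" for h u
  proof -
    have "comb (\<rho> h *\<^sub>v u) = (\<Sum>i<n. fscale (\<Sum>j<n. r h j $ i * u $ j) (b i))"
      unfolding comb_def using index_mult_mat_vec_sum[OF \<rho>c u]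
      by (intro sum.cong refl) (simp add: \<rho>_def)
    also have "\<dots> = (\<Sum>j<n. fscale (u $ j) (comb (r h j)))"
    proof
      fix x
      have "(\<Sum>i<n. fscale (\<Sum>j<n. r h j $ i * u $ j) (b i)) x =
        (\<Sum>i<n. \<Sum>j<n. u $ j * (r h j $ i * b i x))"
        by (simp add: sum_fun_apply sum_distrib_left sum_distrib_right mult_ac)
      also have "\<dots> = (\<Sum>j<n. \<Sum>i<n. u $ j * (r h j $ i * b i x))"
        by (rule sum.swap)
      also have "\<dots> = (\<Sum>j<n. fscale (u $ j) (comb (r h j))) x"
        by (simp add: sum_fun_apply comb_def sum_distrib_left)
      finally show "(\<Sum>i<n. fscale (\<Sum>j<n. r h j $ i * u $ j) (b i)) x =
        (\<Sum>j<n. fscale (u $ j) (comb (r h j))) x" .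
    qed
    also have "\<dots> = (\<Sum>j<n. fscale (u $ j) (rtrans h (b j)))"
      using r[OF h] by (intro sum.cong) auto
    also have "\<dots> = rtrans h (comb u)"
      unfolding comb_def rtrans_linear ..
    finally show ?thesis .
  qed
  have \<rho>_mult: "\<rho> (h \<otimes> k) = \<rho> h * \<rho> k" if hk: "h \<in> carrier G" "k \<in> carrier G" for h k
  proof (rule eq_mat_on_vec[of _ n n])
    fix v :: "complex vec" assume v: "v \<in> carrier_vec n"
    have kv: "\<rho> k *\<^sub>v v \<in> carrier_vec n" using \<rho>c v by (rule mult_mat_vec_carrier)
    have "comb (\<rho> (h \<otimes> k) *\<^sub>v v) = comb (\<rho> h *\<^sub>v (\<rho> k *\<^sub>v v))"
      using hk v kv by (simp add: comb_\<rho> rtrans_rtrans)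
    then have "\<rho> (h \<otimes> k) *\<^sub>v v = \<rho> h *\<^sub>v (\<rho> k *\<^sub>v v)"
      by (intro comb_inj mult_mat_vec_carrier[OF \<rho>c] v kv)
    then show "\<rho> (h \<otimes> k) *\<^sub>v v = (\<rho> h * \<rho> k) *\<^sub>v v"
      using assoc_mult_mat_vec[OF \<rho>c \<rho>c v] by simp
  qed (use \<rho>c mult_carrier_mat[OF \<rho>c \<rho>c] in auto)
  have \<rho>_one: "\<rho> \<one> = 1\<^sub>m n"
  proof (rule eq_mat_on_vec[of _ n n])
    fix v :: "complex vec" assume v: "v \<in> carrier_vec n"
    have "comb v \<in> coef_perp" using comb_span spanB by blast
    then have "rtrans \<one> (comb v) = comb v"
      by (auto simp: rtrans_def fun_eq_iff coef_perp_outside)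
    then have "comb (\<rho> \<one> *\<^sub>v v) = comb v" using v by (simp add: comb_\<rho>)
    then have "\<rho> \<one> *\<^sub>v v = v"
      by (intro comb_inj mult_mat_vec_carrier[OF \<rho>c] v)
    then show "\<rho> \<one> *\<^sub>v v = 1\<^sub>m n *\<^sub>v v" using v by simp
  qed (use \<rho>c mult_carrier_mat[OF \<rho>c \<rho>c] in auto)
  have hom: "\<rho> \<in> hom G (GL n)"
  proof (rule homI)
    fix h assume h: "h \<in> carrier G"
    have "\<rho> (inv h) * \<rho> h = 1\<^sub>m n" "\<rho> h * \<rho> (inv h) = 1\<^sub>m n"
      using h \<rho>_mult[of "inv h" h] \<rho>_mult[of h "inv h"] \<rho>_one by auto
    then show "\<rho> h \<in> carrier (GL n)" unfolding GL_carrier[OF grp] using \<rho>c by blast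
  next
    fix h k assume "h \<in> carrier G" "k \<in> carrier G"
    then show "\<rho> (h \<otimes> k) = \<rho> h \<otimes>\<^bsub>GL n\<^esub> \<rho> k"
      by (simp add: \<rho>_mult units_of_mult ring_mat_simps)
  qed
  have irr: "irreducible_rep G n \<rho>"
    unfolding irreducible_rep_def
  proof (intro conjI hom allI impI)
    show "n \<noteq> 0" using n by simp
    fix U assume "VectorSpace.subspace class_ring U (module_vec TYPE(complex) n)"
      and inv: "\<forall>g\<in>carrier G. \<forall>w\<in>U. \<rho> g *\<^sub>v w \<in> U"
    then have U: "U \<subseteq> carrier_vec n" "0\<^sub>v n \<in> U" "\<And>u v. u \<in> U \<Longrightarrow> v \<in> U \<Longrightarrow> u + v \<in> U"
      "\<And>c v. v \<in> U \<Longrightarrow> c \<cdot>\<^sub>v v \<in> U"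
      unfolding subspace_module_vec_iff by blast+
    show "U = {0\<^sub>v n} \<or> U = carrier_vec n"
    proof (rule disjCI)
      assume "U \<noteq> carrier_vec n"
      show "U = {0\<^sub>v n}"
      proof (rule ccontr)
        assume "U \<noteq> {0\<^sub>v n}"
        then obtain u where u: "u \<in> U" "u \<noteq> 0\<^sub>v n" using U(2) by blast
        \<comment> \<open>A nonzero invariant \<open>U\<close> is carried by \<open>comb\<close> to
          a nonzero translation-invariant subspace of \<open>fs.span B\<close>. Minimality makes it
          all of \<open>fs.span B\<close>, and injectivity of \<open>comb\<close> then makes
          \<open>U\<close> everything.\<close>
        define S where "S = comb ` U"
        have S: "fs.subspace S"
          unfolding fs.subspace_def
        proof (intro conjI ballI allI)
          show "0 \<in> S" using imageI[OF U(2), of comb] unfolding S_def comb_zero .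
        next
          fix f g assume "f \<in> S" "g \<in> S"
          then obtain u v where uv: "u \<in> U" "f = comb u" "v \<in> U" "g = comb v"
            unfolding S_def by (elim imageE)
          then have "f + g = comb (u + v)" using comb_add U(1) by (simp add: subset_iff)
          then show "f + g \<in> S" unfolding S_def using U(3) uv by (simp only: imageI)
        next
          fix c f assume "f \<in> S"
          then obtain u where u: "u \<in> U" "f = comb u"
            unfolding S_def by (elim imageE)
          then have "fscale c f = comb (c \<cdot>\<^sub>v u)" using comb_smult U(1) by (simp add: subset_iff)
          then show "fscale c f \<in> S" unfolding S_def using U(4) u by (simp only: imageI)
        qed
        have "S \<subseteq> fs.span B" unfolding S_def using comb_span by (simp add: image_subset_iff)
        have "comb u \<in> S" unfolding S_def using u(1) by (rule imageI)
        have "comb u \<noteq> 0" using comb_ker[of u] u U(1) by auto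
        have S_inv: "rtrans h f \<in> S" if h: "h \<in> carrier G" and f: "f \<in> S" for h f
        proof -
          from f obtain u where u: "u \<in> U" "f = comb u"
            unfolding S_def by (elim imageE)
          then have "rtrans h f = comb (\<rho> h *\<^sub>v u)" using comb_\<rho>[OF h] U(1) by (simp add: subset_iff)
          moreover have "\<rho> h *\<^sub>v u \<in> U" using inv h u by blast
          ultimately show ?thesis unfolding S_def by (simp only: imageI)
        qed
        have "\<exists>B'. invariant_basis B' \<and> fs.span B' = S"
          by (rule invariant_basisI[OF S _ \<open>comb u \<in> S\<close> \<open>comb u \<noteq> 0\<close> S_inv])
            (use \<open>S \<subseteq> fs.span B\<close> spanB in auto)
        then obtain B' where B': "invariant_basis B'" "fs.span B' = S" by blast
        have "S = fs.span B"
          using invariant_basis_minimal_span[OF B min B'(1)] B'(2) \<open>S \<subseteq> fs.span B\<close> by simp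
        have "carrier_vec n \<subseteq> U"
        proof
          fix v :: "complex vec" assume v: "v \<in> carrier_vec n"
          have "comb v \<in> S" using comb_span \<open>S = fs.span B\<close> by simp
          then obtain w where "w \<in> U" "comb v = comb w" unfolding S_def by (elim imageE)
          then show "v \<in> U" using comb_inj[OF v, of w] U(1) by auto
        qed
        with U(1) \<open>U \<noteq> carrier_vec n\<close> show False by blast
      qed
    qed
  qed
  have b0: "b 0 \<in> coef_perp" using bB[OF n] Bf(4) by blast
  \<comment> \<open>The translate of \<open>b 0\<close> by \<open>h\<close>, evaluated at the
    identity, is \<open>b 0 h\<close>; its coordinates are column 0 of
    \<open>\<rho> h\<close>.\<close>
  have coef: "b 0 h = (\<Sum>i<n. \<rho> h $$ (i, 0) * b i \<one>)" if h: "h \<in> carrier G" for h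
  proof -
    have "b 0 h = rtrans h (b 0) \<one>" using h by (simp add: rtrans_def)
    also have "\<dots> = comb (r h 0) \<one>" using r[OF h n] by simp
    also have "\<dots> = (\<Sum>i<n. \<rho> h $$ (i, 0) * b i \<one>)"
      using n by (simp add: comb_def sum_fun_apply \<rho>_def)
    finally show ?thesis .
  qed
  have "(\<Sum>h\<in>carrier G. cnj (b 0 h) * b 0 h) =
    (\<Sum>h\<in>carrier G. \<Sum>i<n. b i \<one> * (cnj (b 0 h) * \<rho> h $$ (i, 0)))"
  proof (intro sum.cong refl)
    fix h assume "h \<in> carrier G"
    show "cnj (b 0 h) * b 0 h = (\<Sum>i<n. b i \<one> * (cnj (b 0 h) * \<rho> h $$ (i, 0)))"
      by (subst (2) coef[OF \<open>h \<in> carrier G\<close>]) (simp add: sum_distrib_left mult_ac)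
  qed
  also have "\<dots> = (\<Sum>i<n. b i \<one> * (\<Sum>h\<in>carrier G. cnj (b 0 h) * \<rho> h $$ (i, 0)))"
    by (subst sum.swap) (simp add: sum_distrib_left)
  also have "\<dots> = 0"
    using b0 irr n by (simp add: coef_perp_def)
  finally have "(\<Sum>h\<in>carrier G. cnj (b 0 h) * b 0 h) = 0" .
  then have "(\<Sum>h\<in>carrier G. complex_of_real ((cmod (b 0 h))\<^sup>2)) = 0"
    by (simp only: complex_norm_square mult.commute)
  then have "(\<Sum>h\<in>carrier G. (cmod (b 0 h))\<^sup>2) = 0"
    by (simp only: of_real_sum[symmetric] of_real_eq_0_iff)
  then have "\<forall>h\<in>carrier G. b 0 h = 0"
    using fin by (simp add: sum_nonneg_eq_0_iff)
  then have "b 0 = 0"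
    using coef_perp_outside[OF b0] by (auto simp: fun_eq_iff)
  then show False
    using bB[OF n] Bf(3) fs.dependent_zero[of B] by simp
qed

text \<open>\<open>coef_perp\<close> conjugates its functions and demands support in
  \<open>carrier G\<close>, so \<open>f\<close> enters it conjugated and cut off.\<close>

lemma matrix_coefficients_complete:
  assumes "\<And>n \<rho> k l. irreducible_rep G n \<rho> \<Longrightarrow> k < n \<Longrightarrow> l < n \<Longrightarrow>
      (\<Sum>g\<in>carrier G. f g * \<rho> g $$ (k, l)) = 0"
    and "g \<in> carrier G"
  shows "f g = 0"
proof -
  let ?f = "\<lambda>x. if x \<in> carrier G then cnj (f x) else 0"
  have "(\<Sum>g\<in>carrier G. cnj (?f g) * \<rho> g $$ (k, l)) = (\<Sum>g\<in>carrier G. f g * \<rho> g $$ (k, l))"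
    for \<rho> :: "'a mat_rep" and k l
    by (intro sum.cong) auto
  then have "?f \<in> coef_perp"
    using assms(1) by (simp add: coef_perp_def)
  from coef_perp_trivial[OF this] have "?f g = 0" by (simp add: fun_eq_iff)
  with assms(2) show ?thesis by simp
qed

end

section \<open>Unitary matrices and isomorphism of representations\<close>

lemma dim_mat_adjoint [simp]: "dim_row (mat_adjoint A) = dim_col A" "dim_col (mat_adjoint A) = dim_row A"
  by (simp_all add: mat_adjoint_def)

lemma mat_adjoint_carrier [simp]: "A \<in> carrier_mat n m \<Longrightarrow> mat_adjoint A \<in> carrier_mat m n"
  by auto

lemma mat_adjoint_index [simp]:
  fixes A :: "complex mat"
  assumes "i < dim_col A" "k < dim_row A"
  shows "mat_adjoint A $$ (i, k) = cnj (A $$ (k, i))"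
  using assms by (simp add: mat_adjoint_def mat_of_rows_index)

lemma cnj_mtrace_mult_adjoint:
  assumes A: "A \<in> carrier_mat n n" and B: "B \<in> carrier_mat n n"
  shows "cnj (mtrace (A * mat_adjoint B)) = mtrace (B * mat_adjoint A)"
  unfolding mtrace_mult[OF A mat_adjoint_carrier[OF B]] mtrace_mult[OF B mat_adjoint_carrier[OF A]]
  using A B by (simp add: mult.commute)

lemma mat_mon_inv:
  assumes "A \<in> carrier_mat n n" "B \<in> carrier_mat n n" "A * B = 1\<^sub>m n" "B * A = 1\<^sub>m n"
  shows "inv\<^bsub>mat_mon n\<^esub> A = B"
  using monoid.inv_char[OF ring.is_monoid[OF ring_mat], of A n "()" B] assms
  by (simp add: ring_mat_simps)

lemma mat_left_inverse_unique:
  fixes A B C :: "complex mat"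
  assumes "A \<in> carrier_mat n n" "B \<in> carrier_mat n n" "C \<in> carrier_mat n n"
    "B * A = 1\<^sub>m n" "A * C = 1\<^sub>m n"
  shows "B = C"
proof -
  have "B = B * (A * C)" using assms by simp
  also have "\<dots> = (B * A) * C" using assms(1-3) by (simp add: assoc_mult_mat[of _ n n _ n _ n])
  finally show ?thesis using assms by simp
qed

lemma unitary_mat_mult:
  assumes A: "unitary_mat n A" and B: "unitary_mat n B"
  shows "unitary_mat n (A * B)"
proof -
  have c: "A \<in> carrier_mat n n" "B \<in> carrier_mat n n" using A B by (auto simp: unitary_mat_def)
  have adj: "mat_adjoint (A * B) = mat_adjoint B * mat_adjoint A"
  proof (rule eq_matI)
    fix i k assume "i < dim_row (mat_adjoint B * mat_adjoint A)" "k < dim_col (mat_adjoint B * mat_adjoint A)"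
    then have ik: "i < n" "k < n"
      using c by auto
    have "mat_adjoint (A * B) $$ (i, k) = cnj ((A * B) $$ (k, i))"
      using c ik by simp
    also have "\<dots> = (\<Sum>l<n. cnj (A $$ (k, l)) * cnj (B $$ (l, i)))"
      unfolding index_mult_mat_sum[OF c ik(2,1)] by simp
    also have "\<dots> = (\<Sum>l<n. mat_adjoint B $$ (i, l) * mat_adjoint A $$ (l, k))"
      using c ik by (intro sum.cong refl) simp
    also have "\<dots> = (mat_adjoint B * mat_adjoint A) $$ (i, k)"
      by (rule index_mult_mat_sum[OF mat_adjoint_carrier[OF c(2)] mat_adjoint_carrier[OF c(1)] ik, symmetric])
    finally show "mat_adjoint (A * B) $$ (i, k) = (mat_adjoint B * mat_adjoint A) $$ (i, k)" .
  qed (use c in auto)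
  let ?A = "mat_adjoint A" and ?B = "mat_adjoint B"
  have ac: "?A \<in> carrier_mat n n" "?B \<in> carrier_mat n n" using c by auto
  note asc = assoc_mult_mat[of _ n n _ n _ n] and mc = mult_carrier_mat[of _ n n _ n]
  have "(A * B) * (?B * ?A) = A * ((B * ?B) * ?A)" using c ac by (simp add: asc mc)
  also have "\<dots> = 1\<^sub>m n" using A B left_mult_one_mat[OF ac(1)] by (simp add: unitary_mat_def)
  finally have 1: "(A * B) * (?B * ?A) = 1\<^sub>m n" .
  have "(?B * ?A) * (A * B) = ?B * ((?A * A) * B)" using c ac by (simp add: asc mc)
  also have "\<dots> = 1\<^sub>m n" using A B left_mult_one_mat[OF c(2)] by (simp add: unitary_mat_def)
  finally show ?thesis unfolding unitary_mat_def adj using 1 c by (auto intro: mc)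
qed

text \<open>Comparing a diagonal entry of the product with the adjoint gives the squared absolute
  value of \<open>z\<close>. This supplies the condition \<open>cmod z = 1\<close> in
  \<open>cocycle\<close>.\<close>

lemma unitary_smult_cmod:
  assumes A: "unitary_mat n A" and z: "unitary_mat n (z \<cdot>\<^sub>m A)" and n: "0 < n"
  shows "cmod z = 1"
proof -
  have c: "A \<in> carrier_mat n n" using A by (auto simp: unitary_mat_def)
  have adj: "mat_adjoint (z \<cdot>\<^sub>m A) = cnj z \<cdot>\<^sub>m mat_adjoint A"
    using c by (intro eq_matI) auto
  have "1\<^sub>m n = (z \<cdot>\<^sub>m A) * (cnj z \<cdot>\<^sub>m mat_adjoint A)"
    using z unfolding unitary_mat_def adj by simp
  also have "\<dots> = (z * cnj z) \<cdot>\<^sub>m (A * mat_adjoint A)"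
    unfolding mult_smult_distrib[OF smult_carrier_mat[OF c] mat_adjoint_carrier[OF c]]
      mult_smult_assoc_mat[OF c mat_adjoint_carrier[OF c]]
    by (intro eq_matI) auto
  also have "\<dots> = (z * cnj z) \<cdot>\<^sub>m 1\<^sub>m n" using A by (simp add: unitary_mat_def)
  finally have "(1\<^sub>m n :: complex mat) $$ (0, 0) = ((z * cnj z) \<cdot>\<^sub>m 1\<^sub>m n) $$ (0, 0)" by simp
  then have "z * cnj z = 1" using n by simp
  then have "complex_of_real ((cmod z)\<^sup>2) = 1" by (simp only: complex_norm_square)
  then have "(cmod z)\<^sup>2 = 1" by (simp only: of_real_eq_1_iff)
  then have "\<bar>cmod z\<bar> = 1" by (simp only: abs_square_eq_1)
  then show ?thesis by simp
qed

lemma rep_iso_equiv: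
  assumes grp: "group G"
  shows "equiv (irreducible_reps G) (rep_iso G)"
proof (rule equivI)
  show "rep_iso G \<subseteq> irreducible_reps G \<times> irreducible_reps G"
    by (auto simp: rep_iso_def)
  show "refl_on (irreducible_reps G) (rep_iso G)"
  proof (rule refl_onI)
    fix \<rho> assume "\<rho> \<in> irreducible_reps G"
    then obtain n where n: "irreducible_rep G n \<rho>" by (auto simp: irreducible_reps_def)
    have "1\<^sub>m n * \<rho> g = \<rho> g * 1\<^sub>m n" if "g \<in> carrier G" for g
      using irreducible_rep_carrier[OF grp n that] by simp
    then show "(\<rho>, \<rho>) \<in> rep_iso G"
      unfolding rep_iso_iff[OF grp] using n by (intro exI[of _ n] exI[of _ "1\<^sub>m n"]) auto
  qed
  show "sym (rep_iso G)"
  proof (rule symI)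
    fix \<rho> \<sigma> assume "(\<rho>, \<sigma>) \<in> rep_iso G"
    then obtain n P P' where *: "irreducible_rep G n \<rho>" "irreducible_rep G n \<sigma>" "P \<in> carrier_mat n n"
      "P' \<in> carrier_mat n n" "P * P' = 1\<^sub>m n" "P' * P = 1\<^sub>m n" "\<forall>g \<in> carrier G. P * \<rho> g = \<sigma> g * P"
      unfolding rep_iso_iff[OF grp] by blast
    have "P' * \<sigma> g = \<rho> g * P'" if g: "g \<in> carrier G" for g
    proof -
      note c = irreducible_rep_carrier[OF grp *(1) g] irreducible_rep_carrier[OF grp *(2) g] *(3,4)
      have "P' * \<sigma> g = P' * (\<sigma> g * (P * P'))" using * c by simp
      also have "\<dots> = P' * ((\<sigma> g * P) * P')" using c by (simp add: assoc_mult_mat[of _ n n _ n _ n])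
      also have "\<dots> = (P' * P) * (\<rho> g * P')" unfolding *(7)[rule_format, OF g, symmetric]
        using c by (simp add: assoc_mult_mat[of _ n n _ n _ n] mult_carrier_mat[of _ n n])
      also have "\<dots> = \<rho> g * P'" using * c by simp
      finally show ?thesis .
    qed
    then show "(\<sigma>, \<rho>) \<in> rep_iso G"
      unfolding rep_iso_iff[OF grp] using * by (intro exI[of _ n] exI[of _ P'] exI[of _ P]) auto
  qed
  show "trans (rep_iso G)"
  proof (rule transI)
    fix \<rho> \<sigma> \<pi> assume "(\<rho>, \<sigma>) \<in> rep_iso G" "(\<sigma>, \<pi>) \<in> rep_iso G"
    then obtain n P P' m S S' where *: "irreducible_rep G n \<rho>" "irreducible_rep G n \<sigma>" "P \<in> carrier_mat n n"
      "P' \<in> carrier_mat n n" "P * P' = 1\<^sub>m n" "P' * P = 1\<^sub>m n" "\<forall>g \<in> carrier G. P * \<rho> g = \<sigma> g * P"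
      and s: "irreducible_rep G m \<sigma>" "irreducible_rep G m \<pi>" "S \<in> carrier_mat m m"
      "S' \<in> carrier_mat m m" "S * S' = 1\<^sub>m m" "S' * S = 1\<^sub>m m" "\<forall>g \<in> carrier G. S * \<sigma> g = \<pi> g * S"
      unfolding rep_iso_iff[OF grp] by blast
    have m: "m = n" using irreducible_rep_dim[OF grp *(2)] irreducible_rep_dim[OF grp s(1)] by simp
    note s = s[unfolded m]
    note asc = assoc_mult_mat[of _ n n _ n _ n] and mc = mult_carrier_mat[of _ n n _ n]
    have 1: "(S * P) * (P' * S') = 1\<^sub>m n"
    proof -
      have "(S * P) * (P' * S') = S * ((P * P') * S')"
        unfolding asc[OF s(3) *(3) mc[OF *(4) s(4)]] asc[OF *(3,4) s(4)] ..
      then show ?thesis using * s left_mult_one_mat[OF s(4)] by simp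
    qed
    have 2: "(P' * S') * (S * P) = 1\<^sub>m n"
    proof -
      have "(P' * S') * (S * P) = P' * ((S' * S) * P)"
        unfolding asc[OF *(4) s(4) mc[OF s(3) *(3)]] asc[OF s(4,3) *(3)] ..
      then show ?thesis using * s left_mult_one_mat[OF *(3)] by simp
    qed
    have 3: "(S * P) * \<rho> g = \<pi> g * (S * P)" if g: "g \<in> carrier G" for g
    proof -
      note c = irreducible_rep_carrier[OF grp *(1) g] irreducible_rep_carrier[OF grp *(2) g]
        irreducible_rep_carrier[OF grp s(2) g] *(3) s(3)
      have "(S * P) * \<rho> g = S * (P * \<rho> g)" using c by (simp only: asc)
      also have "\<dots> = (S * \<sigma> g) * P" using *(7) g c by (simp add: asc)
      also have "\<dots> = \<pi> g * (S * P)" using s(7) g c by (simp add: asc)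
      finally show ?thesis .
    qed
    from 1 2 3 show "(\<rho>, \<pi>) \<in> rep_iso G"
      unfolding rep_iso_iff[OF grp] using * s mc
      by (intro exI[of _ n] exI[of _ "S * P"] exI[of _ "P' * S'"]) auto
  qed
qed

text \<open>The identity matrix is the isomorphism. Representations are functions on the whole type,
  and a composite of twists matches a single twist only on \<open>carrier G\<close>; passing to
  classes removes the difference.\<close>

lemma rep_iso_agree:
  assumes grp: "group G" and r: "irreducible_rep G n \<rho>" and eq: "\<And>g. g \<in> carrier G \<Longrightarrow> \<sigma> g = \<rho> g"
  shows "(\<rho>, \<sigma>) \<in> rep_iso G"
proof -
  have "\<sigma> \<in> hom G (GL n)"
    using r eq group.is_monoid[OF grp]
    by (auto simp: irreducible_rep_def hom_def monoid.m_closed)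
  then have "irreducible_rep G n \<sigma>"
    using r eq by (auto simp: irreducible_rep_def)
  moreover have "1\<^sub>m n * \<rho> g = \<sigma> g * 1\<^sub>m n" if "g \<in> carrier G" for g
    using irreducible_rep_carrier[OF grp r that] eq[OF that] by simp
  ultimately show ?thesis
    unfolding rep_iso_iff[OF grp] using r by (intro exI[of _ n] exI[of _ "1\<^sub>m n"]) auto
qed

section \<open>The action on the dual and the cocycle\<close>

lemma smult_unitary_cancel:
  assumes N: "unitary_mat n N" and n: "0 < n" and eq: "z \<cdot>\<^sub>m N = w \<cdot>\<^sub>m N"
  shows "z = w"
proof -
  have c: "N \<in> carrier_mat n n" using N by (simp add: unitary_mat_def)
  have "(z \<cdot>\<^sub>m N) * mat_adjoint N = (w \<cdot>\<^sub>m N) * mat_adjoint N" using eq by simp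
  then have "z \<cdot>\<^sub>m 1\<^sub>m n = w \<cdot>\<^sub>m (1\<^sub>m n :: complex mat)"
    using N unfolding mult_smult_assoc_mat[OF c mat_adjoint_carrier[OF c]] by (simp add: unitary_mat_def)
  then have "(z \<cdot>\<^sub>m 1\<^sub>m n) $$ (0, 0) = (w \<cdot>\<^sub>m (1\<^sub>m n :: complex mat)) $$ (0, 0)" by simp
  then show ?thesis using n by simp
qed

lemma (in group) inv_cancel:
  assumes "x \<in> carrier G" "y \<in> carrier G"
  shows "inv x \<otimes> (x \<otimes> y) = y" "x \<otimes> (inv x \<otimes> y) = y"
  using assms by (simp_all flip: m_assoc)

locale extension_data =
  fixes H :: "('a, 'm) monoid_scheme" (structure)
    and G :: "('a, 'm) monoid_scheme"
    and Q :: "('b, 'n) monoid_scheme"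
    and j :: "'a \<Rightarrow> 'b"
    and s :: "'b \<Rightarrow> 'a"
    and R :: "'a mat_rep set \<Rightarrow> 'a mat_rep"
    and T :: "'b \<Rightarrow> 'a mat_rep set \<Rightarrow> complex mat"
  assumes group_H: "group H" and group_Q: "group Q"
    and j_epi: "j \<in> epi H Q"
    and G_eq: "G = H\<lparr>carrier := kernel H Q j\<rparr>"
    and finite_G: "finite (carrier G)" and finite_Q: "finite (carrier Q)"
    and s_funcset: "s \<in> carrier Q \<rightarrow> carrier H"
    and j_s: "\<And>r. r \<in> carrier Q \<Longrightarrow> j (s r) = r"
    and s_one: "s \<one>\<^bsub>Q\<^esub> = \<one>"
    and R_unitary: "unitary_representatives G R"
    and T_unitary_intertwiners: "unitary_intertwiners G H Q s R T"
begin

sublocale H: group H by (rule group_H)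
sublocale Q: group Q by (rule group_Q)
sublocale j: group_hom H Q j
  using group_H group_Q j_epi by (simp add: group_hom_def group_hom_axioms_def epi_def)

lemma G_iff: "x \<in> carrier G \<longleftrightarrow> x \<in> carrier H \<and> j x = \<one>\<^bsub>Q\<^esub>"
  by (simp add: G_eq kernel_def)

lemma G_H: "x \<in> carrier G \<Longrightarrow> x \<in> carrier H"
  by (simp add: G_iff)

lemma G_mult [simp]: "x \<otimes>\<^bsub>G\<^esub> y = x \<otimes> y" and G_one [simp]: "\<one>\<^bsub>G\<^esub> = \<one>"
  by (simp_all add: G_eq)

lemma group_G: "group G"
  unfolding G_eq by (rule subgroup.subgroup_is_group[OF j.subgroup_kernel group_H])

sublocale G: group G by (rule group_G)

lemma G_inv: "x \<in> carrier G \<Longrightarrow> inv\<^bsub>G\<^esub> x = inv x"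
  using H.m_inv_consistent[OF j.subgroup_kernel] by (simp add: G_eq)

lemma s_H [simp]: "r \<in> carrier Q \<Longrightarrow> s r \<in> carrier H"
  using s_funcset by blast

section \<open>Conjugation in \<open>H\<close> and twisted representations\<close>

abbreviation cj :: "'a \<Rightarrow> 'a \<Rightarrow> 'a" where
  "cj h g \<equiv> h \<otimes> g \<otimes> inv h"

lemma conj_act_cj: "g \<in> carrier H \<Longrightarrow> conj_act H h g = cj h g"
  by (simp add: conj_act_def)

lemma cj_G: "h \<in> carrier H \<Longrightarrow> g \<in> carrier G \<Longrightarrow> cj h g \<in> carrier G"
  by (simp add: G_iff)

lemma cj_cj:
  "h \<in> carrier H \<Longrightarrow> k \<in> carrier H \<Longrightarrow> g \<in> carrier H \<Longrightarrow> cj k (cj h g) = cj (k \<otimes> h) g"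
  by (simp add: H.m_assoc H.inv_mult_group)

text \<open>Defined for every \<open>h\<close> of \<open>H\<close> and not just for values of the
  section, because the action law passes through a twist by a value of \<open>tau\<close>.\<close>

definition twist :: "'a \<Rightarrow> 'a mat_rep \<Rightarrow> 'a mat_rep" where
  "twist h \<rho> = (\<lambda>g. \<rho> (conj_act H h g))"

lemma twist_apply: "g \<in> carrier G \<Longrightarrow> twist h \<rho> g = \<rho> (cj h g)"
  by (simp add: twist_def conj_act_cj G_H)

text \<open>Conjugation by \<open>h\<close> permutes \<open>carrier G\<close>, so
  \<open>\<rho>\<close> and its twist have the same invariant subspaces.\<close>

lemma irreducible_rep_twist:
  assumes r: "irreducible_rep G n \<rho>" and h: "h \<in> carrier H"
  shows "irreducible_rep G n (twist h \<rho>)"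
  unfolding irreducible_rep_def
proof (intro conjI allI impI)
  have hom: "\<rho> \<in> hom G (GL n)" using r by (simp add: irreducible_rep_def)
  show "twist h \<rho> \<in> hom G (GL n)"
  proof (rule homI)
    fix g assume "g \<in> carrier G"
    then show "twist h \<rho> g \<in> carrier (GL n)"
      using hom_in_carrier[OF hom] cj_G[OF h] by (simp add: twist_apply)
  next
    fix g k assume gk: "g \<in> carrier G" "k \<in> carrier G"
    have gk': "g \<otimes> k \<in> carrier G" using G.m_closed[OF gk] by simp
    have "cj h (g \<otimes> k) = cj h g \<otimes> cj h k"
      using h gk[THEN G_H] by (simp add: H.m_assoc H.inv_cancel)
    then show "twist h \<rho> (g \<otimes>\<^bsub>G\<^esub> k) = twist h \<rho> g \<otimes>\<^bsub>GL n\<^esub> twist h \<rho> k"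
      using hom_mult[OF hom cj_G[OF h gk(1)] cj_G[OF h gk(2)]] gk gk' by (simp add: twist_apply)
  qed
  show "n \<noteq> 0" using r by (simp add: irreducible_rep_def)
  fix W assume W: "VectorSpace.subspace class_ring W (module_vec TYPE(complex) n)"
    and inv: "\<forall>g\<in>carrier G. \<forall>w\<in>W. twist h \<rho> g *\<^sub>v w \<in> W"
  have "\<rho> g *\<^sub>v w \<in> W" if g: "g \<in> carrier G" and w: "w \<in> W" for g w
  proof -
    have k: "cj (inv h) g \<in> carrier G" using cj_G[of "inv h" g] h g by simp
    have "cj h (cj (inv h) g) = g"
      using h g[THEN G_H] by (simp add: H.m_assoc H.inv_cancel)
    then have "twist h \<rho> (cj (inv h) g) = \<rho> g" using twist_apply[OF k] by simp
    with inv k w show ?thesis by metis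
  qed
  with r W show "W = {0\<^sub>v n} \<or> W = carrier_vec n"
    unfolding irreducible_rep_def by blast
qed

lemma twist_irreducible_reps:
  "\<rho> \<in> irreducible_reps G \<Longrightarrow> h \<in> carrier H \<Longrightarrow> twist h \<rho> \<in> irreducible_reps G"
  by (auto simp: irreducible_reps_def intro: irreducible_rep_twist)

lemma twist_iso:
  assumes "(\<rho>, \<sigma>) \<in> rep_iso G" and h: "h \<in> carrier H"
  shows "(twist h \<rho>, twist h \<sigma>) \<in> rep_iso G"
proof -
  from assms(1) obtain n P P' where *: "irreducible_rep G n \<rho>" "irreducible_rep G n \<sigma>" "P \<in> carrier_mat n n"
    "P' \<in> carrier_mat n n" "P * P' = 1\<^sub>m n" "P' * P = 1\<^sub>m n" "\<forall>g \<in> carrier G. P * \<rho> g = \<sigma> g * P"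
    unfolding rep_iso_iff[OF group_G] by blast
  have "\<forall>g\<in>carrier G. P * twist h \<rho> g = twist h \<sigma> g * P"
    using *(7) cj_G[OF h] by (simp add: twist_apply)
  then show ?thesis
    unfolding rep_iso_iff[OF group_G]
    using * irreducible_rep_twist[OF *(1) h] irreducible_rep_twist[OF *(2) h]
    by (intro exI[of _ n] exI[of _ P] exI[of _ P'] conjI)
qed

lemma twist_twist:
  assumes r: "\<rho> \<in> irreducible_reps G" and h: "h \<in> carrier H" and k: "k \<in> carrier H"
  shows "(twist h (twist k \<rho>), twist (k \<otimes> h) \<rho>) \<in> rep_iso G"
proof -
  obtain n where n: "irreducible_rep G n \<rho>" using r by (auto simp: irreducible_reps_def)
  show ?thesis
  proof (rule rep_iso_agree[OF group_G irreducible_rep_twist[OF irreducible_rep_twist[OF n k] h]])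
    fix g assume g: "g \<in> carrier G"
    then show "twist (k \<otimes> h) \<rho> g = twist h (twist k \<rho>) g"
      using cj_G[OF h g] cj_cj[OF h k G_H[OF g]] by (simp add: twist_apply)
  qed
qed

text \<open>\<open>\<rho> (inv x)\<close> is the isomorphism. Hence \<open>G\<close> acts trivially
  on its dual, which is why the failure of \<open>s\<close> to be a homomorphism is invisible on
  classes.\<close>

lemma twist_inner:
  assumes r: "\<rho> \<in> irreducible_reps G" and x: "x \<in> carrier G"
  shows "(twist x \<rho>, \<rho>) \<in> rep_iso G"
proof -
  obtain n where n: "irreducible_rep G n \<rho>" using r by (auto simp: irreducible_reps_def)
  have ix: "inv\<^bsub>G\<^esub> x \<in> carrier G" using x by simp
  have "\<rho> (inv\<^bsub>G\<^esub> x) * twist x \<rho> g = \<rho> g * \<rho> (inv\<^bsub>G\<^esub> x)" if g: "g \<in> carrier G" for g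
  proof -
    have "inv x \<otimes> cj x g = g \<otimes> inv x"
      using x g G_H by (simp add: H.m_assoc H.inv_cancel)
    then show ?thesis
      using irreducible_rep_mult[OF group_G n ix cj_G[OF G_H[OF x] g]]
        irreducible_rep_mult[OF group_G n g ix] g x by (simp add: twist_apply G_inv)
  qed
  then show ?thesis
    unfolding rep_iso_iff[OF group_G]
    using n irreducible_rep_twist[OF n G_H[OF x]] irreducible_rep_carrier[OF group_G n]
      irreducible_rep_inv[OF group_G n x] x ix
    by (intro exI[of _ n] exI[of _ "\<rho> (inv\<^bsub>G\<^esub> x)"] exI[of _ "\<rho> x"]) auto
qed

section \<open>The right action of \<open>Q\<close> on isomorphism classes\<close>

lemma rep_iso_equiv_G: "equiv (irreducible_reps G) (rep_iso G)"
  by (rule rep_iso_equiv[OF group_G])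

abbreviation cls :: "'a mat_rep \<Rightarrow> 'a mat_rep set" where
  "cls \<rho> \<equiv> rep_iso G `` {\<rho>}"

lemma cls_eqI: "(\<rho>, \<sigma>) \<in> rep_iso G \<Longrightarrow> cls \<rho> = cls \<sigma>"
  using equiv_class_eq[OF rep_iso_equiv_G] .

lemma rep_iso_refl: "\<rho> \<in> irreducible_reps G \<Longrightarrow> (\<rho>, \<rho>) \<in> rep_iso G"
  using rep_iso_equiv_G by (simp add: equiv_def refl_on_def)

lemma rep_iso_irreducible: "(\<rho>, \<sigma>) \<in> rep_iso G \<Longrightarrow> \<rho> \<in> irreducible_reps G \<and> \<sigma> \<in> irreducible_reps G"
  by (simp add: rep_iso_def)

abbreviation act :: "'b \<Rightarrow> 'a mat_rep set \<Rightarrow> 'a mat_rep set" where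
  "act \<equiv> dual_act G H s"

text \<open>Twisting respects isomorphism, so all members of the union that defines
  \<open>dual_act\<close> coincide.\<close>

lemma act_cls:
  assumes "\<rho> \<in> irreducible_reps G" "r \<in> carrier Q"
  shows "act r (cls \<rho>) = cls (twist (s r) \<rho>)"
proof -
  have "act r (cls \<rho>) = (\<Union>\<sigma>\<in>cls \<rho>. cls (twist (s r) \<sigma>))"
    by (simp add: dual_act_def twist_def)
  also have "\<dots> = (\<Union>\<sigma>\<in>cls \<rho>. cls (twist (s r) \<rho>))"
  proof (intro SUP_cong refl)
    fix \<sigma> assume "\<sigma> \<in> cls \<rho>"
    then have "(\<rho>, \<sigma>) \<in> rep_iso G" by simp
    from cls_eqI[OF twist_iso[OF this s_H[OF assms(2)]]]
    show "cls (twist (s r) \<sigma>) = cls (twist (s r) \<rho>)" ..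
  qed
  also have "\<dots> = cls (twist (s r) \<rho>)"
    using rep_iso_refl[OF assms(1)] by blast
  finally show ?thesis .
qed

lemma dual_cases:
  assumes "C \<in> dual G"
  obtains \<rho> where "\<rho> \<in> irreducible_reps G" "C = cls \<rho>"
  using assms unfolding dual_def by (rule quotientE)

lemma cls_dual: "\<rho> \<in> irreducible_reps G \<Longrightarrow> cls \<rho> \<in> dual G"
  unfolding dual_def by (rule quotientI)

lemma act_dual: "C \<in> dual G \<Longrightarrow> r \<in> carrier Q \<Longrightarrow> act r C \<in> dual G"
  by (erule dual_cases) (simp add: act_cls cls_dual twist_irreducible_reps)

lemma act_one: assumes "C \<in> dual G" shows "act \<one>\<^bsub>Q\<^esub> C = C"
proof -
  obtain \<rho> where r: "\<rho> \<in> irreducible_reps G" "C = cls \<rho>" using assms by (rule dual_cases)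
  then show ?thesis
    using cls_eqI[OF twist_inner[OF r(1) G.one_closed]] by (simp add: act_cls s_one)
qed

abbreviation t :: "'b \<Rightarrow> 'b \<Rightarrow> 'a" where "t \<equiv> tau H Q s"

lemma t_G: "q1 \<in> carrier Q \<Longrightarrow> q2 \<in> carrier Q \<Longrightarrow> t q1 q2 \<in> carrier G"
  by (simp add: tau_def G_iff j_s)

lemma t_s:
  "q1 \<in> carrier Q \<Longrightarrow> q2 \<in> carrier Q \<Longrightarrow> t q1 q2 \<otimes> s (q1 \<otimes>\<^bsub>Q\<^esub> q2) = s q1 \<otimes> s q2"
  by (simp add: tau_def H.m_assoc)

text \<open>\<open>s q1 \<otimes> s q2\<close> differs from the value of \<open>s\<close> at the
  product by the factor \<open>t q1 q2\<close> in \<open>G\<close>, whose twist is inner. The order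
  reverses because precomposition is contravariant.\<close>

lemma act_act:
  assumes C: "C \<in> dual G" and q: "q1 \<in> carrier Q" "q2 \<in> carrier Q"
  shows "act q2 (act q1 C) = act (q1 \<otimes>\<^bsub>Q\<^esub> q2) C"
proof -
  obtain \<rho> where r: "\<rho> \<in> irreducible_reps G" "C = cls \<rho>" using C by (rule dual_cases)
  have q12: "q1 \<otimes>\<^bsub>Q\<^esub> q2 \<in> carrier Q" using q by simp
  have tH: "t q1 q2 \<in> carrier H" using t_G[OF q] by (rule G_H)
  have "act q2 (act q1 C) = cls (twist (s q2) (twist (s q1) \<rho>))"
    using r q twist_irreducible_reps by (simp add: act_cls)
  also have "\<dots> = cls (twist (t q1 q2 \<otimes> s (q1 \<otimes>\<^bsub>Q\<^esub> q2)) \<rho>)"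
    using cls_eqI[OF twist_twist[OF r(1) s_H[OF q(2)] s_H[OF q(1)]]] by (simp add: t_s q)
  also have "\<dots> = cls (twist (s (q1 \<otimes>\<^bsub>Q\<^esub> q2)) (twist (t q1 q2) \<rho>))"
    using cls_eqI[OF twist_twist[OF r(1) s_H[OF q12] tH]] by simp
  also have "\<dots> = cls (twist (s (q1 \<otimes>\<^bsub>Q\<^esub> q2)) \<rho>)"
    using cls_eqI[OF twist_iso[OF twist_inner[OF r(1) t_G[OF q]] s_H[OF q12]]] .
  also have "\<dots> = act (q1 \<otimes>\<^bsub>Q\<^esub> q2) C" using r q12 by (simp add: act_cls)
  finally show ?thesis .
qed

section \<open>The chosen representatives and intertwiners\<close>

abbreviation d :: "'a mat_rep set \<Rightarrow> nat" where "d C \<equiv> rep_dim G (R C)"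

lemma R_in: "C \<in> dual G \<Longrightarrow> R C \<in> C"
  using R_unitary by (simp add: unitary_representatives_def)

lemma cls_R: assumes "C \<in> dual G" shows "cls (R C) = C"
proof -
  obtain \<rho> where r: "\<rho> \<in> irreducible_reps G" "C = cls \<rho>" using assms by (rule dual_cases)
  then show ?thesis using R_in[OF assms] cls_eqI[of \<rho> "R C"] by simp
qed

lemma R_irr: assumes "C \<in> dual G" shows "irreducible_rep G (d C) (R C)"
proof -
  have "(R C, R C) \<in> rep_iso G" using R_in[OF assms] cls_R[OF assms] by blast
  then obtain n where "irreducible_rep G n (R C)"
    using rep_iso_irreducible unfolding irreducible_reps_def by blast
  then show ?thesis using irreducible_rep_dim[OF group_G] by metis
qed

lemma R_irreducible_reps: "C \<in> dual G \<Longrightarrow> R C \<in> irreducible_reps G"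
  by (auto simp: irreducible_reps_def intro: R_irr)

lemma R_eqI: "C \<in> dual G \<Longrightarrow> D \<in> dual G \<Longrightarrow> (R C, R D) \<in> rep_iso G \<Longrightarrow> C = D"
  using cls_eqI[of "R C" "R D"] by (simp add: cls_R)

lemma R_carrier: "C \<in> dual G \<Longrightarrow> g \<in> carrier G \<Longrightarrow> R C g \<in> carrier_mat (d C) (d C)"
  by (rule irreducible_rep_carrier[OF group_G R_irr])

lemma R_mult: "C \<in> dual G \<Longrightarrow> g \<in> carrier G \<Longrightarrow> h \<in> carrier G \<Longrightarrow> R C (g \<otimes> h) = R C g * R C h"
  using irreducible_rep_mult[OF group_G R_irr] by simp

lemma G_inv_closed: "g \<in> carrier G \<Longrightarrow> inv g \<in> carrier G"
  using G.inv_closed[of g] by (simp add: G_inv)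

lemma R_inv:
  assumes "C \<in> dual G" "g \<in> carrier G"
  shows "R C g * R C (inv g) = 1\<^sub>m (d C)" "R C (inv g) * R C g = 1\<^sub>m (d C)"
  using irreducible_rep_inv[OF group_G R_irr[OF assms(1)] assms(2)] assms(2) by (simp_all add: G_inv)

lemma R_unitary_mat: "C \<in> dual G \<Longrightarrow> g \<in> carrier G \<Longrightarrow> unitary_mat (d C) (R C g)"
  using R_unitary by (simp add: unitary_representatives_def)

lemma R_adjoint:
  assumes "C \<in> dual G" "g \<in> carrier G"
  shows "mat_adjoint (R C g) = R C (inv g)"
proof -
  have "mat_adjoint (R C g) * R C g = 1\<^sub>m (d C)"
    using R_unitary_mat[OF assms] by (simp add: unitary_mat_def)
  with R_carrier[OF assms] mat_adjoint_carrier[OF R_carrier[OF assms]]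
    R_carrier[OF assms(1) G_inv_closed[OF assms(2)]]
  show ?thesis
    using R_inv(1)[OF assms] by (rule mat_left_inverse_unique)
qed

lemma d_pos: "C \<in> dual G \<Longrightarrow> 0 < d C"
  by (rule irreducible_rep_pos[OF group_G R_irr])

text \<open>Isomorphic representations have equal dimension, so all matrices attached to one orbit
  share a size and can be multiplied.\<close>

lemma d_act: assumes "C \<in> dual G" "r \<in> carrier Q" shows "d (act r C) = d C"
proof -
  have "act r C = cls (twist (s r) (R C))"
    using act_cls[OF R_irreducible_reps[OF assms(1)] assms(2)] cls_R[OF assms(1)] by simp
  then have "(twist (s r) (R C), R (act r C)) \<in> rep_iso G"
    using R_in[OF act_dual[OF assms]] by simp
  then have "rep_dim G (twist (s r) (R C)) = d (act r C)"
    by (simp add: rep_iso_def)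
  then show ?thesis
    using irreducible_rep_dim[OF group_G irreducible_rep_twist[OF R_irr[OF assms(1)] s_H[OF assms(2)]]]
    by simp
qed

lemma T_unitary: "C \<in> dual G \<Longrightarrow> r \<in> carrier Q \<Longrightarrow> unitary_mat (d C) (T r C)"
  using T_unitary_intertwiners by (simp add: unitary_intertwiners_def)

lemma T_carrier: "C \<in> dual G \<Longrightarrow> r \<in> carrier Q \<Longrightarrow> T r C \<in> carrier_mat (d C) (d C)"
  using T_unitary by (simp add: unitary_mat_def)

lemma T_adjoint:
  assumes "C \<in> dual G" "r \<in> carrier Q"
  shows "T r C * mat_adjoint (T r C) = 1\<^sub>m (d C)" "mat_adjoint (T r C) * T r C = 1\<^sub>m (d C)"
  using T_unitary[OF assms] by (simp_all add: unitary_mat_def)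

lemma R_act_carrier:
  "C \<in> dual G \<Longrightarrow> r \<in> carrier Q \<Longrightarrow> g \<in> carrier G \<Longrightarrow> R (act r C) g \<in> carrier_mat (d C) (d C)"
  using R_carrier[OF act_dual, of C r g] by (simp add: d_act)

lemma T_conj:
  assumes "C \<in> dual G" "r \<in> carrier Q" "g \<in> carrier G"
  shows "R C (cj (s r) g) = mat_adjoint (T r C) * R (act r C) g * T r C"
proof -
  have "R C (conj_act H (s r) g) = inv\<^bsub>mat_mon (d C)\<^esub> (T r C) * R (act r C) g * T r C"
    using T_unitary_intertwiners assms by (simp add: unitary_intertwiners_def)
  moreover have "inv\<^bsub>mat_mon (d C)\<^esub> (T r C) = mat_adjoint (T r C)"
    using T_carrier T_adjoint assms by (intro mat_mon_inv) auto
  ultimately show ?thesis using assms by (simp add: conj_act_cj G_H)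
qed

lemma T_intertwines:
  assumes "C \<in> dual G" "r \<in> carrier Q" "g \<in> carrier G"
  shows "T r C * R C (cj (s r) g) = R (act r C) g * T r C"
proof -
  let ?n = "d C"
  note c = T_carrier[OF assms(1,2)] R_act_carrier[OF assms] mat_adjoint_carrier[OF T_carrier[OF assms(1,2)]]
  have "T r C * R C (cj (s r) g) = (T r C * mat_adjoint (T r C)) * (R (act r C) g * T r C)"
    using c unfolding T_conj[OF assms] by (simp add: assoc_mult_mat[of _ ?n ?n _ ?n _ ?n])
  also have "\<dots> = R (act r C) g * T r C"
    unfolding T_adjoint[OF assms(1,2)] by (rule left_mult_one_mat[OF mult_carrier_mat[OF c(2,1)]])
  finally show ?thesis .
qed

text \<open>
  Both products of matrices intertwine the same two irreducible representations, so that Schur's lemma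
  gives the constant that the definition of \<open>cocycle\<close> asks for.
\<close>

lemma cocycle_spec:
  assumes C: "C \<in> dual G" and q: "q1 \<in> carrier Q" "q2 \<in> carrier Q"
  shows "cmod (cocycle G H Q s R T C q1 q2) = 1 \<and>
    T q2 (act q1 C) * T q1 C =
      cocycle G H Q s R T C q1 q2 \<cdot>\<^sub>m (T (q1 \<otimes>\<^bsub>Q\<^esub> q2) C * R C (inv (t q1 q2)))"
proof -
  let ?n = "d C" and ?q = "q1 \<otimes>\<^bsub>Q\<^esub> q2"
  have q12: "?q \<in> carrier Q" using q by simp
  have C1: "act q1 C \<in> dual G" using act_dual[OF C q(1)] .
  have d1: "d (act q1 C) = ?n" using d_act[OF C q(1)] .
  have C12: "act ?q C \<in> dual G" using act_dual[OF C q12] .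
  have d12: "d (act ?q C) = ?n" using d_act[OF C q12] .
  have tG: "t q1 q2 \<in> carrier G" "inv (t q1 q2) \<in> carrier G" using t_G[OF q] G_inv_closed by auto
  define M where "M = T q2 (act q1 C) * T q1 C"
  define N where "N = T ?q C * R C (inv (t q1 q2))"
  have T2: "T q2 (act q1 C) \<in> carrier_mat ?n ?n" using T_carrier[OF C1 q(2)] d1 by simp
  note T1 = T_carrier[OF C q(1)] and T12 = T_carrier[OF C q12] and Rt = R_carrier[OF C tG(2)]
  have M: "unitary_mat ?n M"
    unfolding M_def using T_unitary[OF C1 q(2)] d1 T_unitary[OF C q(1)] by (intro unitary_mat_mult) auto
  have N: "unitary_mat ?n N"
    unfolding N_def using T_unitary[OF C q12] R_unitary_mat[OF C tG(2)] by (rule unitary_mat_mult)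
  have Mc: "M \<in> carrier_mat ?n ?n" and Nc: "N \<in> carrier_mat ?n ?n"
    using M N by (auto simp: unitary_mat_def)
  have Nac: "mat_adjoint N \<in> carrier_mat ?n ?n" using Nc by simp
  note asc = assoc_mult_mat[of _ ?n ?n _ ?n _ ?n] and mc = mult_carrier_mat[of _ ?n ?n _ ?n]
  have cjG: "cj (s q1) (cj (s q2) g) \<in> carrier G" if "g \<in> carrier G" for g
    using that q by (intro cj_G s_H)
  have Mi: "M * R C (cj (s q1) (cj (s q2) g)) = R (act ?q C) g * M" if g: "g \<in> carrier G" for g
  proof -
    have g2: "cj (s q2) g \<in> carrier G" using g q by (intro cj_G s_H)
    have Rg: "R (act q1 C) (cj (s q2) g) \<in> carrier_mat ?n ?n" using R_act_carrier[OF C q(1) g2] .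
    have "M * R C (cj (s q1) (cj (s q2) g)) = T q2 (act q1 C) * (T q1 C * R C (cj (s q1) (cj (s q2) g)))"
      unfolding M_def using T2 T1 R_carrier[OF C cjG[OF g]] by (rule asc)
    also have "\<dots> = T q2 (act q1 C) * R (act q1 C) (cj (s q2) g) * T q1 C"
      unfolding T_intertwines[OF C q(1) g2] using T2 Rg T1 by (rule asc[symmetric])
    also have "\<dots> = R (act ?q C) g * T q2 (act q1 C) * T q1 C"
      unfolding T_intertwines[OF C1 q(2) g] act_act[OF C q] ..
    also have "\<dots> = R (act ?q C) g * M"
      unfolding M_def using R_act_carrier[OF C q12 g] T2 T1 by (rule asc)
    finally show ?thesis .
  qed
  \<comment> \<open>By \<open>t_s\<close>, the double conjugation is conjugation by
    \<open>s ?q\<close> followed by the inner one by \<open>t q1 q2\<close>; the factor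
    \<open>R C (inv (t q1 q2))\<close> in \<open>N\<close> absorbs the inner part.\<close>
  have Ni: "N * R C (cj (s q1) (cj (s q2) g)) = R (act ?q C) g * N" if g: "g \<in> carrier G" for g
  proof -
    have g2: "cj (s ?q) g \<in> carrier G" using g q12 by (intro cj_G s_H)
    note gH = G_H[OF g] and tH = G_H[OF tG(1)]
    have "cj (s q1) (cj (s q2) g) = cj (t q1 q2 \<otimes> s ?q) g"
      unfolding t_s[OF q] using q gH by (simp add: cj_cj)
    also have "\<dots> = cj (t q1 q2) (cj (s ?q) g)"
      using q12 gH tH by (simp add: cj_cj)
    finally have "inv (t q1 q2) \<otimes> cj (s q1) (cj (s q2) g) = cj (s ?q) g \<otimes> inv (t q1 q2)"
      using tH G_H[OF g2] by (simp add: H.m_assoc[of _ "cj (s ?q) g"] H.inv_cancel)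
    then have e: "R C (inv (t q1 q2)) * R C (cj (s q1) (cj (s q2) g)) = R C (cj (s ?q) g) * R C (inv (t q1 q2))"
      using R_mult[OF C tG(2) cjG[OF g]] R_mult[OF C g2 tG(2)] by simp
    have "N * R C (cj (s q1) (cj (s q2) g)) = T ?q C * (R C (inv (t q1 q2)) * R C (cj (s q1) (cj (s q2) g)))"
      unfolding N_def using T12 Rt R_carrier[OF C cjG[OF g]] by (rule asc)
    also have "\<dots> = T ?q C * R C (cj (s ?q) g) * R C (inv (t q1 q2))"
      unfolding e using T12 R_carrier[OF C g2] Rt by (rule asc[symmetric])
    also have "\<dots> = R (act ?q C) g * T ?q C * R C (inv (t q1 q2))"
      unfolding T_intertwines[OF C q12 g] ..
    also have "\<dots> = R (act ?q C) g * N"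
      unfolding N_def using R_act_carrier[OF C q12 g] T12 Rt by (rule asc)
    finally show ?thesis .
  qed
  have NaN: "mat_adjoint N * N = 1\<^sub>m ?n" "N * mat_adjoint N = 1\<^sub>m ?n" using N by (auto simp: unitary_mat_def)
  \<comment> \<open>\<open>Z\<close> is \<open>M\<close> times the inverse of \<open>N\<close>. It
    commutes with the irreducible representation at the target class, so the scalar form of Schur's
    lemma applies.\<close>
  define Z where "Z = M * mat_adjoint N"
  have Zc: "Z \<in> carrier_mat ?n ?n" unfolding Z_def using Mc Nac by (rule mc)
  have "R (act ?q C) g * Z = Z * R (act ?q C) g" if g: "g \<in> carrier G" for g
  proof -
    note A = R_act_carrier[OF C q12 g] and B = R_carrier[OF C cjG[OF g]]
    have "mat_adjoint N * R (act ?q C) g = mat_adjoint N * (R (act ?q C) g * (N * mat_adjoint N))"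
      unfolding NaN using A by simp
    also have "\<dots> = mat_adjoint N * ((R (act ?q C) g * N) * mat_adjoint N)"
      unfolding asc[OF A Nc Nac] ..
    also have "\<dots> = mat_adjoint N * (N * (R C (cj (s q1) (cj (s q2) g)) * mat_adjoint N))"
      unfolding Ni[OF g, symmetric] asc[OF Nc B Nac] ..
    also have "\<dots> = (mat_adjoint N * N) * (R C (cj (s q1) (cj (s q2) g)) * mat_adjoint N)"
      by (rule asc[OF Nac Nc mc[OF B Nac], symmetric])
    also have "\<dots> = R C (cj (s q1) (cj (s q2) g)) * mat_adjoint N"
      unfolding NaN by (rule left_mult_one_mat[OF mc[OF B Nac]])
    finally have e: "mat_adjoint N * R (act ?q C) g = R C (cj (s q1) (cj (s q2) g)) * mat_adjoint N" .
    have "R (act ?q C) g * Z = R (act ?q C) g * M * mat_adjoint N"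
      unfolding Z_def by (rule asc[OF A Mc Nac, symmetric])
    also have "\<dots> = M * (R C (cj (s q1) (cj (s q2) g)) * mat_adjoint N)"
      unfolding Mi[OF g, symmetric] by (rule asc[OF Mc B Nac])
    also have "\<dots> = Z * R (act ?q C) g"
      unfolding e[symmetric] Z_def by (rule asc[OF Mc Nac A, symmetric])
    finally show ?thesis .
  qed
  from schur_scalar[OF group_G R_irr[OF C12, unfolded d12] Zc this]
  obtain z where z: "Z = z \<cdot>\<^sub>m 1\<^sub>m ?n" by blast
  have "M = Z * N"
    unfolding Z_def asc[OF Mc Nac Nc] NaN using Mc by simp
  also have "\<dots> = z \<cdot>\<^sub>m N"
    unfolding z mult_smult_assoc_mat[OF one_carrier_mat Nc] using Nc by simp
  finally have MzN: "M = z \<cdot>\<^sub>m N" .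
  have z1: "cmod z = 1"
    using unitary_smult_cmod[OF N _ d_pos[OF C]] M MzN by simp
  have invt: "inv\<^bsub>mat_mon ?n\<^esub> (R C (t q1 q2)) = R C (inv (t q1 q2))"
    using R_carrier[OF C tG(1)] Rt R_inv[OF C tG(1)] by (rule mat_mon_inv)
  \<comment> \<open>\<open>THE\<close> also needs uniqueness, which follows by cancelling the
    unitary matrix \<open>N\<close>.\<close>
  have "cocycle G H Q s R T C q1 q2 = z"
    unfolding cocycle_def invt M_def[symmetric] N_def[symmetric]
  proof (rule the_equality)
    show "cmod z = 1 \<and> M = z \<cdot>\<^sub>m N" using z1 MzN by simp
    fix w assume "cmod w = 1 \<and> M = w \<cdot>\<^sub>m N"
    then show "w = z" using smult_unitary_cancel[OF N d_pos[OF C]] MzN by simp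
  qed
  then show ?thesis using z1 MzN unfolding M_def N_def by simp
qed

end

section \<open>Twisted characters on a fiber\<close>

text \<open>The Fourier coefficient of \<open>f\<close> at \<open>\<rho>\<close>. The size is a
  separate argument because \<open>\<rho>\<close> may be any matrix-valued function, such as a
  representation times a fixed matrix.\<close>

definition wsum :: "'x set \<Rightarrow> ('x \<Rightarrow> complex) \<Rightarrow> ('x \<Rightarrow> complex mat) \<Rightarrow> nat \<Rightarrow> complex mat" where
  "wsum S f \<rho> n = mat n n (\<lambda>(k, l). \<Sum>g\<in>S. f g * \<rho> g $$ (k, l))"

lemma wsum_carrier [simp]: "wsum S f \<rho> n \<in> carrier_mat n n"
  by (simp add: wsum_def)

lemma wsum_index: "k < n \<Longrightarrow> l < n \<Longrightarrow> wsum S f \<rho> n $$ (k, l) = (\<Sum>g\<in>S. f g * \<rho> g $$ (k, l))"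
  by (simp add: wsum_def)

lemma wsum_left:
  assumes A: "A \<in> carrier_mat n n" and r: "\<And>g. g \<in> S \<Longrightarrow> \<rho> g \<in> carrier_mat n n"
  shows "A * wsum S f \<rho> n = wsum S f (\<lambda>g. A * \<rho> g) n"
proof (rule eq_matI)
  fix k l assume "k < dim_row (wsum S f (\<lambda>g. A * \<rho> g) n)" "l < dim_col (wsum S f (\<lambda>g. A * \<rho> g) n)"
  then have kl: "k < n" "l < n" by (auto simp: wsum_def)
  have "(A * wsum S f \<rho> n) $$ (k, l) = (\<Sum>i<n. A $$ (k, i) * wsum S f \<rho> n $$ (i, l))"
    by (rule index_mult_mat_sum[OF A wsum_carrier kl])
  also have "\<dots> = (\<Sum>i<n. \<Sum>g\<in>S. f g * (A $$ (k, i) * \<rho> g $$ (i, l)))"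
    using kl by (intro sum.cong refl) (simp add: wsum_index sum_distrib_left mult_ac)
  also have "\<dots> = (\<Sum>g\<in>S. f g * (\<Sum>i<n. A $$ (k, i) * \<rho> g $$ (i, l)))"
    by (subst sum.swap) (simp add: sum_distrib_left)
  also have "\<dots> = (\<Sum>g\<in>S. f g * (A * \<rho> g) $$ (k, l))"
    using index_mult_mat_sum[OF A r kl] by (intro sum.cong refl) simp
  also have "\<dots> = wsum S f (\<lambda>g. A * \<rho> g) n $$ (k, l)"
    by (rule wsum_index[OF kl, symmetric])
  finally show "(A * wsum S f \<rho> n) $$ (k, l) = wsum S f (\<lambda>g. A * \<rho> g) n $$ (k, l)" .
qed (use A in \<open>auto simp: wsum_def\<close>)

lemma wsum_right:
  assumes A: "A \<in> carrier_mat n n" and r: "\<And>g. g \<in> S \<Longrightarrow> \<rho> g \<in> carrier_mat n n"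
  shows "wsum S f \<rho> n * A = wsum S f (\<lambda>g. \<rho> g * A) n"
proof (rule eq_matI)
  fix k l assume "k < dim_row (wsum S f (\<lambda>g. \<rho> g * A) n)" "l < dim_col (wsum S f (\<lambda>g. \<rho> g * A) n)"
  then have kl: "k < n" "l < n" by (auto simp: wsum_def)
  have "(wsum S f \<rho> n * A) $$ (k, l) = (\<Sum>i<n. wsum S f \<rho> n $$ (k, i) * A $$ (i, l))"
    by (rule index_mult_mat_sum[OF wsum_carrier A kl])
  also have "\<dots> = (\<Sum>i<n. \<Sum>g\<in>S. f g * (\<rho> g $$ (k, i) * A $$ (i, l)))"
    using kl by (intro sum.cong refl) (simp add: wsum_index sum_distrib_right mult.assoc)
  also have "\<dots> = (\<Sum>g\<in>S. f g * (\<Sum>i<n. \<rho> g $$ (k, i) * A $$ (i, l)))"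
    by (subst sum.swap) (simp add: sum_distrib_left)
  also have "\<dots> = (\<Sum>g\<in>S. f g * (\<rho> g * A) $$ (k, l))"
    using index_mult_mat_sum[OF r A kl] by (intro sum.cong refl) simp
  also have "\<dots> = wsum S f (\<lambda>g. \<rho> g * A) n $$ (k, l)"
    by (rule wsum_index[OF kl, symmetric])
  finally show "(wsum S f \<rho> n * A) $$ (k, l) = wsum S f (\<lambda>g. \<rho> g * A) n $$ (k, l)" .
qed (use A in \<open>auto simp: wsum_def\<close>)

lemma wsum_cong:
  assumes "\<And>g. g \<in> S \<Longrightarrow> \<rho> g = \<sigma> g"
  shows "wsum S f \<rho> n = wsum S f \<sigma> n"
proof -
  have "(\<Sum>g\<in>S. f g * \<rho> g $$ (k, l)) = (\<Sum>g\<in>S. f g * \<sigma> g $$ (k, l))" for k l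
    using assms by (intro sum.cong) auto
  then show ?thesis unfolding wsum_def by simp
qed

lemma mtrace_wsum:
  assumes r: "\<And>g. g \<in> S \<Longrightarrow> \<rho> g \<in> carrier_mat n n"
  shows "mtrace (wsum S f \<rho> n) = (\<Sum>g\<in>S. f g * mtrace (\<rho> g))"
proof -
  have "mtrace (wsum S f \<rho> n) = (\<Sum>i<n. \<Sum>g\<in>S. f g * \<rho> g $$ (i, i))"
    unfolding mtrace_def by (simp add: wsum_def)
  also have "\<dots> = (\<Sum>g\<in>S. f g * (\<Sum>i<n. \<rho> g $$ (i, i)))"
    by (subst sum.swap) (simp add: sum_distrib_left)
  also have "\<dots> = (\<Sum>g\<in>S. f g * mtrace (\<rho> g))"
    unfolding mtrace_def using r by (intro sum.cong refl) auto
  finally show ?thesis .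
qed

text \<open>Once \<open>W * U\<close> cancels, cyclicity of the trace brings \<open>V\<close> to the
  front, where it cancels \<open>P\<close>. In use, \<open>P\<close> and \<open>V\<close> are
  \<open>R C h\<close> and its inverse, \<open>W\<close> and \<open>U\<close> are
  \<open>T q C\<close> and its inverse.\<close>

lemma mtrace_conj_cancel:
  assumes c: "P \<in> carrier_mat n n" "S \<in> carrier_mat n n" "U \<in> carrier_mat n n" "V \<in> carrier_mat n n"
      "W \<in> carrier_mat n n"
    and 1: "V * P = 1\<^sub>m n" "W * U = 1\<^sub>m n"
  shows "mtrace ((P * (S * (U * V * W))) * U) = mtrace (S * U)"
proof -
  note asc = assoc_mult_mat[of _ n n _ n _ n] and mc = mult_carrier_mat[of _ n n _ n]
  have "(P * (S * (U * V * W))) * U = (P * (S * (U * V))) * (W * U)"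
    using c by (simp add: asc mc)
  also have "\<dots> = (P * (S * U)) * V"
    unfolding 1 using c by (simp add: asc mc)
  finally have "mtrace ((P * (S * (U * V * W))) * U) = mtrace (V * (P * (S * U)))"
    using mtrace_commute[OF mc[OF c(1) mc[OF c(2,3)]] c(4)] by simp
  also have "V * (P * (S * U)) = (V * P) * (S * U)"
    using c by (simp add: asc mc)
  also have "\<dots> = S * U" unfolding 1 by (rule left_mult_one_mat[OF mc[OF c(2,3)]])
  finally show ?thesis .
qed

text \<open>Eliminating \<open>U\<close> between the two cocycle equations gives
  \<open>Tq' * (Tr * (a * bi))\<close> as \<open>c1 * inverse c2\<close> times
  \<open>Tr * Tq\<close>; conjugation by \<open>Tr\<close> then disappears in the trace.
  \<open>Tq\<close> belongs to a class fixed by \<open>q\<close> and \<open>Tq'\<close> to its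
  translate by \<open>r\<close>; a suffix \<open>i\<close> marks inverses, and \<open>a\<close>,
  \<open>bi\<close> stem from the two values of \<open>tau\<close>.\<close>

lemma mtrace_cocycle_identity:
  assumes c: "\<rho> \<in> carrier_mat n n" "Tr \<in> carrier_mat n n" "Tri \<in> carrier_mat n n"
      "Tq \<in> carrier_mat n n" "Tqi \<in> carrier_mat n n" "Tq' \<in> carrier_mat n n" "Tqi' \<in> carrier_mat n n"
      "U \<in> carrier_mat n n" "a \<in> carrier_mat n n" "ai \<in> carrier_mat n n" "bi \<in> carrier_mat n n"
    and 1: "Tq' * Tr = c1 \<cdot>\<^sub>m (U * ai)" and 2: "Tr * Tq = c2 \<cdot>\<^sub>m (U * bi)" and c2: "c2 \<noteq> 0"
    and i: "ai * a = 1\<^sub>m n" "Tqi' * Tq' = 1\<^sub>m n" "Tq * Tqi = 1\<^sub>m n" "Tr * Tri = 1\<^sub>m n"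
  shows "mtrace ((Tri * \<rho> * Tr) * (a * bi) * Tqi) = c1 * inverse c2 * mtrace (\<rho> * Tqi')"
proof -
  let ?k = "c1 * inverse c2"
  note asc = assoc_mult_mat[of _ n n _ n _ n] and mc = mult_carrier_mat[of _ n n _ n]
  have sl: "(k \<cdot>\<^sub>m A) * B = k \<cdot>\<^sub>m (A * B)" if "A \<in> carrier_mat n n" "B \<in> carrier_mat n n"
    for k and A B :: "complex mat" using that by (rule mult_smult_assoc_mat)
  have sr: "A * (k \<cdot>\<^sub>m B) = k \<cdot>\<^sub>m (A * B)" if "A \<in> carrier_mat n n" "B \<in> carrier_mat n n"
    for k and A B :: "complex mat" using that by (rule mult_smult_distrib)
  have ss: "x \<cdot>\<^sub>m (y \<cdot>\<^sub>m A) = (x * y) \<cdot>\<^sub>m A" for x y and A :: "complex mat"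
    by (intro eq_matI) auto
  have "Tq' * (Tr * (a * bi)) = (Tq' * Tr) * (a * bi)"
    using c by (simp add: asc mc)
  also have "\<dots> = c1 \<cdot>\<^sub>m (U * ((ai * a) * bi))"
    unfolding 1 using c by (simp add: sl asc mc)
  also have "\<dots> = c1 \<cdot>\<^sub>m (U * bi)"
    unfolding i left_mult_one_mat[OF c(11)] ..
  also have "U * bi = inverse c2 \<cdot>\<^sub>m (Tr * Tq)"
    unfolding 2 ss using c2 by (intro eq_matI) auto
  finally have e: "Tq' * (Tr * (a * bi)) = ?k \<cdot>\<^sub>m (Tr * Tq)" unfolding ss .
  have "Tr * (a * bi) = (Tqi' * Tq') * (Tr * (a * bi))"
    unfolding i by (rule left_mult_one_mat[OF mc[OF c(2) mc[OF c(9,11)]], symmetric])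
  also have "\<dots> = Tqi' * (Tq' * (Tr * (a * bi)))"
    using c by (simp add: asc mc)
  also have "\<dots> = ?k \<cdot>\<^sub>m (Tqi' * (Tr * Tq))"
    unfolding e by (rule sr[OF c(7) mc[OF c(2,4)]])
  finally have "Tr * (a * bi) * Tqi = ?k \<cdot>\<^sub>m (Tqi' * (Tr * (Tq * Tqi)))"
    using c by (simp add: sl asc mc)
  also have "\<dots> = ?k \<cdot>\<^sub>m (Tqi' * Tr)"
    unfolding i using c by simp
  finally have f: "Tr * (a * bi) * Tqi = ?k \<cdot>\<^sub>m (Tqi' * Tr)" .
  have "(Tri * \<rho> * Tr) * (a * bi) * Tqi = (Tri * \<rho>) * (Tr * (a * bi) * Tqi)"
    using c by (simp add: asc mc)
  also have "\<dots> = ?k \<cdot>\<^sub>m ((Tri * \<rho>) * (Tqi' * Tr))"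
    unfolding f by (rule sr[OF mc[OF c(3,1)] mc[OF c(7,2)]])
  also have "(Tri * \<rho>) * (Tqi' * Tr) = Tri * (\<rho> * Tqi' * Tr)"
    using c by (simp add: asc mc)
  finally have "mtrace ((Tri * \<rho> * Tr) * (a * bi) * Tqi) = ?k * mtrace (Tri * (\<rho> * Tqi' * Tr))"
    using mtrace_smult[OF mc[OF c(3) mc[OF mc[OF c(1,7)] c(2)]]] by simp
  also have "mtrace (Tri * (\<rho> * Tqi' * Tr)) = mtrace (\<rho> * Tqi' * Tr * Tri)"
    by (rule mtrace_commute[OF c(3) mc[OF mc[OF c(1,7)] c(2)]])
  also have "\<rho> * Tqi' * Tr * Tri = \<rho> * Tqi' * (Tr * Tri)"
    by (rule asc[OF mc[OF c(1,7)] c(2,3)])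
  also have "\<dots> = \<rho> * Tqi'"
    unfolding i by (rule right_mult_one_mat[OF mc[OF c(1,7)]])
  finally show ?thesis .
qed

section \<open>The fiber over \<open>q\<close> and its twisted characters\<close>

locale extension_fiber = extension_data H G Q j s R T
  for H :: "('a, 'm) monoid_scheme" (structure)
    and G :: "('a, 'm) monoid_scheme"
    and Q :: "('b, 'n) monoid_scheme"
    and j s R T +
  fixes q :: 'b
  assumes q_Q: "q \<in> carrier Q"
begin

definition X :: "'a set" where "X = {x \<in> carrier H. j x = q}"

definition I :: "'a mat_rep set set" where "I = invariants (dual G) act q"

abbreviation Cq :: "'b set" where "Cq \<equiv> centralizer Q q"

abbreviation gam :: "'a mat_rep set \<Rightarrow> 'b \<Rightarrow> complex" where "gam C r \<equiv> gamma G H Q s R T C r q"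

text \<open>
  The adjoint of \<open>T q C\<close> is its inverse.  For \<open>C\<close> fixed by \<open>q\<close>, the map \<open>g s(q) \<mapsto> R C g T\<^sup>-\<^sup>1\<close> extends
  the representation \<open>R C\<close> (projectively) to \<open>X\<close>, and \<open>F C\<close> is its trace.
\<close>

definition F :: "'a mat_rep set \<Rightarrow> 'a \<Rightarrow> complex" where
  "F C x = (if x \<in> X then mtrace (R C (x \<otimes> inv (s q)) * mat_adjoint (T q C)) else 0)"

lemma I_dual: "C \<in> I \<Longrightarrow> C \<in> dual G" and act_q: "C \<in> I \<Longrightarrow> act q C = C"
  by (simp_all add: I_def invariants_def)

lemma Cq_Q: "r \<in> Cq \<Longrightarrow> r \<in> carrier Q" and Cq_comm: "r \<in> Cq \<Longrightarrow> r \<otimes>\<^bsub>Q\<^esub> q = q \<otimes>\<^bsub>Q\<^esub> r"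
  by (simp_all add: centralizer_def)

lemma act_I: assumes "C \<in> I" "r \<in> Cq" shows "act r C \<in> I"
proof -
  have "act q (act r C) = act r (act q C)"
    using act_act I_dual[OF assms(1)] Cq_Q[OF assms(2)] q_Q Cq_comm[OF assms(2)] by simp
  then show ?thesis
    using act_dual[OF I_dual[OF assms(1)] Cq_Q[OF assms(2)]] act_q[OF assms(1)]
    by (simp add: I_def invariants_def)
qed

lemma X_H: "x \<in> X \<Longrightarrow> x \<in> carrier H"
  by (simp add: X_def)

lemma G_sq_X: "g \<in> carrier G \<Longrightarrow> g \<otimes> s q \<in> X"
  using q_Q by (simp add: X_def G_iff j_s)

lemma X_sq_G: "x \<in> X \<Longrightarrow> x \<otimes> inv (s q) \<in> carrier G"
  using q_Q by (simp add: X_def G_iff j_s)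

lemma cj_X:
  assumes "h \<in> carrier H" "j h \<in> Cq" "x \<in> X"
  shows "cj h x \<in> X"
proof -
  have "j (cj h x) = j h \<otimes>\<^bsub>Q\<^esub> q \<otimes>\<^bsub>Q\<^esub> inv\<^bsub>Q\<^esub> (j h)"
    using assms by (simp add: X_def)
  also have "\<dots> = q"
    using Cq_comm[OF assms(2)] Cq_Q[OF assms(2)] q_Q by (simp add: Q.m_assoc)
  finally show ?thesis using assms by (simp add: X_def)
qed

lemma one_Cq: "\<one>\<^bsub>Q\<^esub> \<in> Cq"
  using q_Q by (simp add: centralizer_def)

lemma sum_X: "(\<Sum>x\<in>X. f x) = (\<Sum>g\<in>carrier G. f (g \<otimes> s q))"
  by (rule sum.reindex_bij_witness[of _ "\<lambda>g. g \<otimes> s q" "\<lambda>x. x \<otimes> inv (s q)"])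
    (use q_Q G_sq_X X_sq_G in \<open>auto simp: H.m_assoc X_H G_H\<close>)

lemma finite_X: "finite X"
proof -
  have "X \<subseteq> (\<lambda>g. g \<otimes> s q) ` carrier G"
  proof
    fix x assume x: "x \<in> X"
    then have "x = (x \<otimes> inv (s q)) \<otimes> s q" using q_Q by (simp add: H.m_assoc X_H)
    then show "x \<in> (\<lambda>g. g \<otimes> s q) ` carrier G" using X_sq_G[OF x] by (rule image_eqI)
  qed
  then show ?thesis using finite_G finite_surj by blast
qed

lemma F_outside: "x \<notin> X \<Longrightarrow> F C x = 0"
  by (simp add: F_def)

lemma F_sq: "g \<in> carrier G \<Longrightarrow> F C (g \<otimes> s q) = mtrace (R C g * mat_adjoint (T q C))"
  using q_Q G_sq_X by (simp add: F_def H.m_assoc G_H)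

text \<open>In the coordinate \<open>g = x \<otimes> inv (s q)\<close>, conjugation by
  \<open>h\<close> multiplies \<open>g\<close> by \<open>h\<close> on the left and by
  \<open>cj (s q) (inv h)\<close> on the right. As \<open>q\<close> fixes \<open>C\<close>, the
  intertwiner turns the right factor into \<open>R C (inv h)\<close>, which cancels
  \<open>R C h\<close> under the trace.\<close>

lemma F_conj_G:
  assumes C: "C \<in> I" and x: "x \<in> X" and h: "h \<in> carrier G"
  shows "F C (cj h x) = F C x"
proof -
  define g where "g = x \<otimes> inv (s q)"
  note Cd = I_dual[OF C]
  have g: "g \<in> carrier G" unfolding g_def using x by (rule X_sq_G)
  have hi: "inv h \<in> carrier G" using h by (rule G_inv_closed)
  have k: "cj (s q) (inv h) \<in> carrier G" using cj_G[OF s_H[OF q_Q] hi] .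
  have gk: "g \<otimes> cj (s q) (inv h) \<in> carrier G" using G.m_closed[OF g k] by simp
  have jh: "j h \<in> Cq" using h one_Cq by (simp add: G_iff)
  have cx: "cj h x \<in> X" using cj_X[OF G_H[OF h] jh x] .
  have "cj h x \<otimes> inv (s q) = h \<otimes> (g \<otimes> cj (s q) (inv h))"
    unfolding g_def using x h q_Q by (simp add: H.m_assoc X_H G_H H.inv_cancel)
  then have "R C (cj h x \<otimes> inv (s q)) = R C h * (R C g * R C (cj (s q) (inv h)))"
    using R_mult[OF Cd h gk] R_mult[OF Cd g k] by simp
  also have "R C (cj (s q) (inv h)) = mat_adjoint (T q C) * R C (inv h) * T q C"
    using T_conj[OF Cd q_Q hi] act_q[OF C] by simp
  finally have "F C (cj h x) =
      mtrace ((R C h * (R C g * (mat_adjoint (T q C) * R C (inv h) * T q C))) * mat_adjoint (T q C))"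
    using cx by (simp add: F_def)
  also have "\<dots> = mtrace (R C g * mat_adjoint (T q C))"
    by (rule mtrace_conj_cancel[OF R_carrier[OF Cd h] R_carrier[OF Cd g]
          mat_adjoint_carrier[OF T_carrier[OF Cd q_Q]] R_carrier[OF Cd hi] T_carrier[OF Cd q_Q]
          R_inv(2)[OF Cd h] T_adjoint(1)[OF Cd q_Q]])
  also have "\<dots> = F C x" using x by (simp add: F_def g_def)
  finally show ?thesis .
qed

text \<open>This is where \<open>gamma\<close> arises: the representation part is moved by
  \<open>T r C\<close>, and passing \<open>T r C\<close> across the intertwiner of \<open>q\<close>
  costs the ratio of the cocycle values at \<open>(r, q)\<close> and \<open>(q, r)\<close>.\<close>

lemma F_conj_s:
  assumes C: "C \<in> I" and x: "x \<in> X" and r: "r \<in> Cq"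
  shows "F C (cj (s r) x) = gam C r * F (act r C) x"
proof -
  define g where "g = x \<otimes> inv (s q)"
  let ?n = "d C"
  note Cd = I_dual[OF C] and rQ = Cq_Q[OF r]
  have rC: "act r C \<in> dual G" using act_dual[OF Cd rQ] .
  have drC: "d (act r C) = ?n" using d_act[OF Cd rQ] .
  have g: "g \<in> carrier G" unfolding g_def using x by (rule X_sq_G)
  have k: "cj (s r) g \<in> carrier G" using cj_G[OF s_H[OF rQ] g] .
  have t1: "t r q \<in> carrier G" and t2: "t q r \<in> carrier G" using t_G rQ q_Q by auto
  note t1i = G_inv_closed[OF t1] and t2i = G_inv_closed[OF t2]
  have tt: "t r q \<otimes> inv (t q r) \<in> carrier G" using G.m_closed[OF t1 t2i] by simp
  have cx: "cj (s r) x \<in> X" using cj_X[of "s r" x] r rQ x by (simp add: j_s)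
  have qr: "q \<otimes>\<^bsub>Q\<^esub> r \<in> carrier Q" using q_Q rQ by simp
  \<comment> \<open>As \<open>r\<close> and \<open>q\<close> commute, both values of
    \<open>tau\<close> contain the same section value of the product, which cancels.\<close>
  have "cj (s r) g \<otimes> (t r q \<otimes> inv (t q r)) = cj (s r) x \<otimes> inv (s q)"
    unfolding g_def tau_def Cq_comm[OF r]
    using x q_Q rQ qr by (simp add: H.m_assoc H.inv_mult_group X_H H.inv_cancel)
  then have "R C (cj (s r) x \<otimes> inv (s q)) = R C (cj (s r) g) * (R C (t r q) * R C (inv (t q r)))"
    using R_mult[OF Cd k tt] R_mult[OF Cd t1 t2i] by simp
  also have "R C (cj (s r) g) = mat_adjoint (T r C) * R (act r C) g * T r C"
    by (rule T_conj[OF Cd rQ g])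
  finally have "F C (cj (s r) x) = mtrace ((mat_adjoint (T r C) * R (act r C) g * T r C) *
      (R C (t r q) * R C (inv (t q r))) * mat_adjoint (T q C))"
    using cx by (simp add: F_def)
  also have "\<dots> = cocycle G H Q s R T C r q * inverse (cocycle G H Q s R T C q r) *
      mtrace (R (act r C) g * mat_adjoint (T q (act r C)))"
  proof (rule mtrace_cocycle_identity)
    show "R (act r C) g \<in> carrier_mat ?n ?n" using R_act_carrier[OF Cd rQ g] .
    show Tr: "T r C \<in> carrier_mat ?n ?n" and Tq: "T q C \<in> carrier_mat ?n ?n"
      using T_carrier[OF Cd rQ] T_carrier[OF Cd q_Q] .
    show Tq': "T q (act r C) \<in> carrier_mat ?n ?n" using T_carrier[OF rC q_Q] drC by simp
    show "mat_adjoint (T r C) \<in> carrier_mat ?n ?n" "mat_adjoint (T q C) \<in> carrier_mat ?n ?n"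
      "mat_adjoint (T q (act r C)) \<in> carrier_mat ?n ?n"
      using Tr Tq Tq' by simp_all
    show "T (q \<otimes>\<^bsub>Q\<^esub> r) C \<in> carrier_mat ?n ?n" using T_carrier[OF Cd qr] .
    show "R C (t r q) \<in> carrier_mat ?n ?n" "R C (inv (t r q)) \<in> carrier_mat ?n ?n"
      "R C (inv (t q r)) \<in> carrier_mat ?n ?n"
      using R_carrier[OF Cd t1] R_carrier[OF Cd t1i] R_carrier[OF Cd t2i] .
    show "T q (act r C) * T r C = cocycle G H Q s R T C r q \<cdot>\<^sub>m (T (q \<otimes>\<^bsub>Q\<^esub> r) C * R C (inv (t r q)))"
      using cocycle_spec[OF Cd rQ q_Q] unfolding Cq_comm[OF r] by (rule conjunct2)
    show "T r C * T q C = cocycle G H Q s R T C q r \<cdot>\<^sub>m (T (q \<otimes>\<^bsub>Q\<^esub> r) C * R C (inv (t q r)))"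
      using cocycle_spec[OF Cd q_Q rQ] unfolding act_q[OF C] by (rule conjunct2)
    show "cocycle G H Q s R T C q r \<noteq> 0"
      using cocycle_spec[OF Cd q_Q rQ] by auto
    show "R C (inv (t r q)) * R C (t r q) = 1\<^sub>m ?n" using R_inv(2)[OF Cd t1] .
    show "mat_adjoint (T q (act r C)) * T q (act r C) = 1\<^sub>m ?n"
      using T_adjoint(2)[OF rC q_Q] drC by simp
    show "T q C * mat_adjoint (T q C) = 1\<^sub>m ?n" "T r C * mat_adjoint (T r C) = 1\<^sub>m ?n"
      using T_adjoint(1)[OF Cd q_Q] T_adjoint(1)[OF Cd rQ] .
  qed
  also have "mtrace (R (act r C) g * mat_adjoint (T q (act r C))) = F (act r C) x"
    using x by (simp add: F_def g_def)
  finally show ?thesis by (simp add: gamma_def)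
qed

text \<open>Unitarity rewrites the conjugate of \<open>F D\<close> as a trace against
  \<open>R D\<close> at the inverse element, so Schur orthogonality applies. For
  \<open>C = D\<close> the trace of \<open>T q C\<close> times its adjoint is \<open>d C\<close>,
  which cancels the denominator and leaves the same norm for every class.\<close>

lemma F_orthogonal:
  assumes C: "C \<in> I" and D: "D \<in> I"
  shows "(\<Sum>x\<in>X. F C x * cnj (F D x)) = (if C = D then of_nat (card (carrier G)) else 0)"
proof -
  note Cd = I_dual[OF C] and Dd = I_dual[OF D]
  note TC = T_carrier[OF Cd q_Q] and TD = T_carrier[OF Dd q_Q]
  have "(\<Sum>x\<in>X. F C x * cnj (F D x)) =
    (\<Sum>g\<in>carrier G. mtrace (R C g * mat_adjoint (T q C)) * mtrace (T q D * R D (inv\<^bsub>G\<^esub> g)))"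
    unfolding sum_X
  proof (intro sum.cong refl)
    fix g assume g: "g \<in> carrier G"
    have "cnj (F D (g \<otimes> s q)) = mtrace (T q D * R D (inv\<^bsub>G\<^esub> g))"
      unfolding F_sq[OF g] cnj_mtrace_mult_adjoint[OF R_carrier[OF Dd g] TD] R_adjoint[OF Dd g] G_inv[OF g] ..
    then show "F C (g \<otimes> s q) * cnj (F D (g \<otimes> s q)) =
        mtrace (R C g * mat_adjoint (T q C)) * mtrace (T q D * R D (inv\<^bsub>G\<^esub> g))"
      by (simp add: F_sq[OF g])
  qed
  also have "\<dots> = (if C = D then of_nat (card (carrier G)) else 0)"
  proof (cases "C = D")
    case True
    have "of_nat (card (carrier G)) / of_nat (d C) * mtrace (T q C * mat_adjoint (T q C)) =
      (of_nat (card (carrier G)) :: complex)"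
      unfolding T_adjoint(1)[OF Cd q_Q] using d_pos[OF Cd] by simp
    with schur_orthogonality_trace_eq[OF group_G R_irr[OF Cd] mat_adjoint_carrier[OF TC] TC]
    show ?thesis using True by simp
  next
    case False
    then have "(R C, R D) \<notin> rep_iso G" using R_eqI[OF Cd Dd] by auto
    from schur_orthogonality_trace_neq[OF group_G R_irr[OF Cd] R_irr[OF Dd] this
        mat_adjoint_carrier[OF TC] TD]
    show ?thesis using False by simp
  qed
  finally show ?thesis .
qed

text \<open>
  Invariance of \<open>f\<close> makes its Fourier coefficient at \<open>R C\<close>, multiplied by the inverse of \<open>T q C\<close>, an
  intertwiner between \<open>R C\<close> and \<open>R (act q C)\<close>: it vanishes unless \<open>q\<close> fixes \<open>C\<close>, and then it is a scalar
  that is read off from the inner product of \<open>f\<close> and \<open>F C\<close>.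
\<close>

lemma perp_F_zero:
  assumes inv: "\<And>x h. x \<in> X \<Longrightarrow> h \<in> carrier G \<Longrightarrow> f (cj h x) = f x"
    and perp: "\<And>C. C \<in> I \<Longrightarrow> (\<Sum>x\<in>X. f x * cnj (F C x)) = 0"
    and x: "x \<in> X"
  shows "f x = 0"
proof -
  \<comment> \<open>With the conjugate, the trace of the Fourier coefficient times the inverse of
    \<open>T q C\<close> becomes the conjugate of the inner product of \<open>f\<close> with
    \<open>F C\<close>.\<close>
  define e where "e g = cnj (f (g \<otimes> s q))" for g
  \<comment> \<open>This twisted conjugation of \<open>g\<close> is conjugation of the point
    \<open>g \<otimes> s q\<close> by \<open>inv h\<close>.\<close>
  have e_conj: "e (inv h \<otimes> (g \<otimes> cj (s q) h)) = e g" if g: "g \<in> carrier G" and h: "h \<in> carrier G" for g h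
  proof -
    have "inv h \<otimes> (g \<otimes> cj (s q) h) \<otimes> s q = cj (inv h) (g \<otimes> s q)"
      using g h q_Q by (simp add: H.m_assoc G_H)
    then show ?thesis
      unfolding e_def using inv[OF G_sq_X[OF g] G_inv_closed[OF h]] by simp
  qed
  have zero_R: "wsum (carrier G) e (R C) (d C) = 0\<^sub>m (d C) (d C)" if C: "C \<in> dual G" for C
  proof -
    let ?n = "d C" and ?D = "act q C"
    let ?A = "wsum (carrier G) e (R C) ?n"
    note Rc = R_carrier[OF C] and Tc = T_carrier[OF C q_Q]
    note Tac = mat_adjoint_carrier[OF Tc]
    note asc = assoc_mult_mat[of _ ?n ?n _ ?n _ ?n] and mc = mult_carrier_mat[of _ ?n ?n _ ?n]
    have D: "?D \<in> dual G" using act_dual[OF C q_Q] .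
    have dD: "d ?D = ?n" using d_act[OF C q_Q] .
    define B where "B = ?A * mat_adjoint (T q C)"
    have Bc: "B \<in> carrier_mat ?n ?n" unfolding B_def using Tac by (intro mc) auto
    \<comment> \<open>Shifting the summation variable by \<open>inv h\<close> on the left and by
      \<open>cj (s q) h\<close> on the right preserves the sum, and \<open>e_conj\<close> removes
      the effect on \<open>e\<close>.\<close>
    have A_tw: "R C h * ?A = ?A * R C (cj (s q) h)" if h: "h \<in> carrier G" for h
    proof -
      have k: "cj (s q) h \<in> carrier G" using cj_G[OF s_H[OF q_Q] h] .
      have hi: "inv h \<in> carrier G" using h by (rule G_inv_closed)
      have "(\<Sum>g\<in>carrier G. e g * R C (h \<otimes> g) $$ (a, b)) =
        (\<Sum>g\<in>carrier G. e g * R C (g \<otimes> cj (s q) h) $$ (a, b))" for a b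
      proof -
        have "(\<Sum>g\<in>carrier G. e g * R C (h \<otimes> g) $$ (a, b)) =
          (\<Sum>g\<in>carrier G. e (inv h \<otimes> g) * R C (h \<otimes> (inv h \<otimes> g)) $$ (a, b))"
          using sum_translate_left[OF group_G hi, of "\<lambda>g. e g * R C (h \<otimes> g) $$ (a, b)"] by simp
        also have "\<dots> = (\<Sum>g\<in>carrier G. e (inv h \<otimes> g) * R C g $$ (a, b))"
          using h by (intro sum.cong refl) (simp add: H.inv_cancel G_H)
        also have "\<dots> = (\<Sum>g\<in>carrier G. e (inv h \<otimes> (g \<otimes> cj (s q) h)) * R C (g \<otimes> cj (s q) h) $$ (a, b))"
          using sum_translate_right[OF group_G k, of "\<lambda>g. e (inv h \<otimes> g) * R C g $$ (a, b)"] by simp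
        also have "\<dots> = (\<Sum>g\<in>carrier G. e g * R C (g \<otimes> cj (s q) h) $$ (a, b))"
          using e_conj[OF _ h] by (intro sum.cong refl) simp
        finally show ?thesis .
      qed
      then have "wsum (carrier G) e (\<lambda>g. R C (h \<otimes> g)) ?n = wsum (carrier G) e (\<lambda>g. R C (g \<otimes> cj (s q) h)) ?n"
        unfolding wsum_def by simp
      moreover have "R C h * ?A = wsum (carrier G) e (\<lambda>g. R C (h \<otimes> g)) ?n"
      proof -
        have "R C h * ?A = wsum (carrier G) e (\<lambda>g. R C h * R C g) ?n"
          by (rule wsum_left[OF Rc[OF h]]) (rule Rc)
        also have "\<dots> = wsum (carrier G) e (\<lambda>g. R C (h \<otimes> g)) ?n"
          by (rule wsum_cong) (simp add: R_mult[OF C h])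
        finally show ?thesis .
      qed
      moreover have "?A * R C (cj (s q) h) = wsum (carrier G) e (\<lambda>g. R C (g \<otimes> cj (s q) h)) ?n"
      proof -
        have "?A * R C (cj (s q) h) = wsum (carrier G) e (\<lambda>g. R C g * R C (cj (s q) h)) ?n"
          by (rule wsum_right[OF Rc[OF k]]) (rule Rc)
        also have "\<dots> = wsum (carrier G) e (\<lambda>g. R C (g \<otimes> cj (s q) h)) ?n"
          by (rule wsum_cong) (simp add: R_mult[OF C _ k])
        finally show ?thesis .
      qed
      ultimately show ?thesis by simp
    qed
    have B_tw: "R C h * B = B * R ?D h" if h: "h \<in> carrier G" for h
    proof -
      note RD = R_act_carrier[OF C q_Q h]
      have "R C h * B = (R C h * ?A) * mat_adjoint (T q C)"
        unfolding B_def by (rule asc[OF Rc[OF h] wsum_carrier Tac, symmetric])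
      also have "\<dots> = (?A * (mat_adjoint (T q C) * R ?D h * T q C)) * mat_adjoint (T q C)"
        unfolding A_tw[OF h] T_conj[OF C q_Q h] ..
      also have "\<dots> = (B * R ?D h) * (T q C * mat_adjoint (T q C))"
        unfolding B_def using Tac Tc RD wsum_carrier[of "carrier G" e "R C" ?n] by (simp add: asc mc)
      also have "\<dots> = B * R ?D h"
        unfolding T_adjoint(1)[OF C q_Q] by (rule right_mult_one_mat[OF mc[OF Bc RD]])
      finally show ?thesis .
    qed
    have "B = 0\<^sub>m ?n ?n"
    proof (cases "?D = C")
      case False
      then have "(R C, R ?D) \<notin> rep_iso G" using R_eqI[OF C D] by auto
      from intertwiner_zero[OF group_G R_irr[OF C] R_irr[OF D] this _ B_tw] Bc dD
      show ?thesis by simp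
    next
      case True
      then have CI: "C \<in> I" using C by (simp add: I_def invariants_def)
      from schur_scalar[OF group_G R_irr[OF C] Bc B_tw[unfolded True]]
      obtain c where c: "B = c \<cdot>\<^sub>m 1\<^sub>m ?n" by blast
      have "c * of_nat ?n = mtrace B" unfolding c by (simp add: mtrace_smult[of _ ?n])
      also have "B = wsum (carrier G) e (\<lambda>g. R C g * mat_adjoint (T q C)) ?n"
        unfolding B_def by (rule wsum_right[OF Tac]) (rule Rc)
      also have "mtrace \<dots> = (\<Sum>g\<in>carrier G. e g * mtrace (R C g * mat_adjoint (T q C)))"
        by (rule mtrace_wsum) (rule mc[OF Rc Tac])
      also have "\<dots> = cnj (\<Sum>x\<in>X. f x * cnj (F C x))"
        unfolding sum_X cnj_sum by (intro sum.cong refl) (simp add: e_def F_sq)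
      also have "\<dots> = 0" using perp[OF CI] by simp
      finally have "c = 0" using d_pos[OF C] by simp
      then show ?thesis unfolding c by (intro eq_matI) auto
    qed
    have "?A = ?A * (mat_adjoint (T q C) * T q C)"
      unfolding T_adjoint(2)[OF C q_Q] by (rule right_mult_one_mat[OF wsum_carrier, symmetric])
    also have "\<dots> = B * T q C"
      unfolding B_def by (rule asc[OF wsum_carrier Tac Tc, symmetric])
    also have "\<dots> = 0\<^sub>m ?n ?n" unfolding \<open>B = 0\<^sub>m ?n ?n\<close> using Tc by simp
    finally show ?thesis .
  qed
  \<comment> \<open>Completeness quantifies over all irreducible representations, so the vanishing
    at the chosen one is transported along an isomorphism \<open>P\<close>.\<close>
  have "e g = 0" if g: "g \<in> carrier G" for g
  proof (rule matrix_coefficients_complete[OF group_G finite_G _ g])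
    fix n \<rho> k l assume r: "irreducible_rep G n \<rho>" and kl: "k < n" "l < n"
    have ri: "\<rho> \<in> irreducible_reps G" using r by (auto simp: irreducible_reps_def)
    have C: "cls \<rho> \<in> dual G" using cls_dual[OF ri] .
    define \<sigma> where "\<sigma> = R (cls \<rho>)"
    have "(\<rho>, \<sigma>) \<in> rep_iso G" using R_in[OF C] by (simp add: \<sigma>_def)
    then obtain m P P' where *: "irreducible_rep G m \<rho>" "irreducible_rep G m \<sigma>" "P \<in> carrier_mat m m"
      "P' \<in> carrier_mat m m" "P * P' = 1\<^sub>m m" "P' * P = 1\<^sub>m m" "\<forall>g \<in> carrier G. P * \<rho> g = \<sigma> g * P"
      unfolding rep_iso_iff[OF group_G] by blast
    have m: "m = n" using irreducible_rep_dim[OF group_G r] irreducible_rep_dim[OF group_G *(1)] by simp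
    have dn: "d (cls \<rho>) = n" using irreducible_rep_dim[OF group_G *(2)] m by (simp add: \<sigma>_def)
    note * = *[unfolded m]
    note rc = irreducible_rep_carrier[OF group_G r] and sc = irreducible_rep_carrier[OF group_G *(2)]
    note asc = assoc_mult_mat[of _ n n _ n _ n] and mc = mult_carrier_mat[of _ n n _ n]
    have "wsum (carrier G) e \<rho> n = wsum (carrier G) e (\<lambda>g. P' * (\<sigma> g * P)) n"
    proof (rule wsum_cong)
      fix g assume g: "g \<in> carrier G"
      have "P' * (\<sigma> g * P) = (P' * P) * \<rho> g"
        unfolding *(7)[rule_format, OF g, symmetric] by (rule asc[OF *(4,3) rc[OF g], symmetric])
      then show "\<rho> g = P' * (\<sigma> g * P)" unfolding *(6) using rc[OF g] by simp
    qed
    also have "\<dots> = P' * wsum (carrier G) e (\<lambda>g. \<sigma> g * P) n"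
      by (rule wsum_left[symmetric, OF *(4)]) (rule mc[OF sc *(3)])
    also have "wsum (carrier G) e (\<lambda>g. \<sigma> g * P) n = wsum (carrier G) e \<sigma> n * P"
      by (rule wsum_right[symmetric, OF *(3)]) (rule sc)
    also have "wsum (carrier G) e \<sigma> n = 0\<^sub>m n n"
      using zero_R[OF C] unfolding dn \<sigma>_def .
    also have "P' * (0\<^sub>m n n * P) = 0\<^sub>m n n" using *(3,4) by simp
    finally have "wsum (carrier G) e \<rho> n $$ (k, l) = 0" using kl by simp
    then show "(\<Sum>g\<in>carrier G. e g * \<rho> g $$ (k, l)) = 0" using kl by (simp add: wsum_index)
  qed
  from this[OF X_sq_G[OF x]] have "f (x \<otimes> inv (s q) \<otimes> s q) = 0"
    by (simp add: e_def)
  then show ?thesis using x q_Q by (simp add: H.m_assoc X_H)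
qed

end

section \<open>Counting\<close>

lemma sum_mult_cnj_nonzero:
  assumes X: "finite X" and x: "x \<in> X" "f x \<noteq> 0"
  shows "(\<Sum>x\<in>X. f x * cnj (f x)) \<noteq> 0"
proof
  assume "(\<Sum>x\<in>X. f x * cnj (f x)) = 0"
  then have "complex_of_real (\<Sum>x\<in>X. (cmod (f x))\<^sup>2) = 0"
    by (simp only: of_real_sum complex_norm_square)
  then have "(\<Sum>x\<in>X. (cmod (f x))\<^sup>2) = 0"
    by (simp only: of_real_eq_0_iff)
  then have "\<forall>x\<in>X. f x = 0"
    using X by (simp add: sum_nonneg_eq_0_iff)
  with x show False by blast
qed

text \<open>Injectivity of the indexing lets a basis be counted by its index set, here by orbits or
  conjugacy classes.\<close>

lemma orthogonal_family:
  fixes u :: "'i \<Rightarrow> 'x \<Rightarrow> complex"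
  assumes nz: "\<And>i. i \<in> S \<Longrightarrow> (\<Sum>x\<in>X. u i x * cnj (u i x)) \<noteq> 0"
    and orth: "\<And>i k. i \<in> S \<Longrightarrow> k \<in> S \<Longrightarrow> i \<noteq> k \<Longrightarrow> (\<Sum>x\<in>X. u i x * cnj (u k x)) = 0"
  shows "inj_on u S" and "fs.independent (u ` S)"
proof -
  show "inj_on u S"
  proof (rule inj_onI, rule ccontr)
    fix i k assume ik: "i \<in> S" "k \<in> S" "u i = u k" "i \<noteq> k"
    then show False using nz[OF ik(1)] orth[OF ik(1,2,4)] by simp
  qed
  show "fs.independent (u ` S)"
  proof (rule orthogonal_independent[of _ X])
    show "(\<Sum>x\<in>X. f x * cnj (f x)) \<noteq> 0" if "f \<in> u ` S" for f
      using that nz by auto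
    show "(\<Sum>x\<in>X. f x * cnj (g x)) = 0" if "f \<in> u ` S" "g \<in> u ` S" "f \<noteq> g" for f g
      using that orth by auto
  qed
qed

context extension_fiber
begin

definition K :: "'a set" where "K = {h \<in> carrier H. j h \<in> Cq}"

definition V :: "('a \<Rightarrow> complex) set" where
  "V = {f. (\<forall>x. x \<notin> X \<longrightarrow> f x = 0) \<and> (\<forall>h\<in>K. \<forall>x\<in>X. f (cj h x) = f x)}"

lemma card_G: "card (carrier G) \<noteq> 0"
  using finite_G G.one_closed by auto

lemma F_family:
  "inj_on F I" "fs.independent (F ` I)"
  using orthogonal_family[where S = I and X = X and u = F] card_G by (simp_all add: F_orthogonal)

text \<open>The functions \<open>F C\<close> are independent and supported on the finite set
  \<open>X\<close>, and \<open>F\<close> is injective on \<open>I\<close>.\<close>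

lemma finite_I: "finite I"
proof -
  have "finite (F ` I)"
    by (rule finite_independent_functions[OF finite_X F_family(2)]) (auto simp: F_outside)
  then show ?thesis using F_family(1) finite_imageD by blast
qed

text \<open>The coefficients \<open>a C\<close> are those of the orthogonal projection onto the span
  of the \<open>F C\<close>. The remainder is still invariant and is perpendicular to every
  \<open>F C\<close>, so it vanishes.\<close>

lemma F_expansion:
  assumes off: "\<And>x. x \<notin> X \<Longrightarrow> f x = 0"
    and inv: "\<And>x h. x \<in> X \<Longrightarrow> h \<in> carrier G \<Longrightarrow> f (cj h x) = f x"
  shows "\<exists>a. f = (\<Sum>C\<in>I. fscale (a C) (F C))"
proof -
  define a where "a C = (\<Sum>x\<in>X. f x * cnj (F C x)) / of_nat (card (carrier G))" for C
  define e where "e x = f x - (\<Sum>C\<in>I. a C * F C x)" for x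
  have "e x = 0" if x: "x \<in> X" for x
  proof (rule perp_F_zero[OF _ _ x])
    fix x h assume x: "x \<in> X" and h: "h \<in> carrier G"
    show "e (cj h x) = e x"
      unfolding e_def inv[OF x h] using F_conj_G[OF _ x h] by simp
  next
    fix D assume D: "D \<in> I"
    have "(\<Sum>x\<in>X. (\<Sum>C\<in>I. a C * F C x) * cnj (F D x)) = (\<Sum>C\<in>I. a C * (\<Sum>x\<in>X. F C x * cnj (F D x)))"
      by (simp add: sum_distrib_left sum_distrib_right mult.assoc) (rule sum.swap)
    also have "\<dots> = (\<Sum>C\<in>I. if C = D then a D * of_nat (card (carrier G)) else 0)"
      using D by (intro sum.cong refl) (simp add: F_orthogonal)
    also have "\<dots> = a D * of_nat (card (carrier G))"
      using finite_I D by simp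
    also have "\<dots> = (\<Sum>x\<in>X. f x * cnj (F D x))"
      using card_G by (simp add: a_def)
    finally show "(\<Sum>x\<in>X. e x * cnj (F D x)) = 0"
      by (simp add: e_def left_diff_distrib sum_subtractf)
  qed
  then have "f x = (\<Sum>C\<in>I. a C * F C x)" for x
    by (cases "x \<in> X") (auto simp: e_def off F_outside)
  then have "f = (\<Sum>C\<in>I. fscale (a C) (F C))"
    by (auto simp: fun_eq_iff sum_fun_apply)
  then show ?thesis by (rule exI[of _ a])
qed

section \<open>The centralizer of \<open>q\<close> and its preimage in \<open>H\<close>\<close>

lemma Cq_mult: "r \<in> Cq \<Longrightarrow> r' \<in> Cq \<Longrightarrow> r \<otimes>\<^bsub>Q\<^esub> r' \<in> Cq"
proof -
  assume r: "r \<in> Cq" "r' \<in> Cq"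
  have "r \<otimes>\<^bsub>Q\<^esub> r' \<otimes>\<^bsub>Q\<^esub> q = r \<otimes>\<^bsub>Q\<^esub> (q \<otimes>\<^bsub>Q\<^esub> r')"
    using r q_Q Cq_Q Cq_comm by (simp add: Q.m_assoc)
  also have "\<dots> = q \<otimes>\<^bsub>Q\<^esub> (r \<otimes>\<^bsub>Q\<^esub> r')"
    using r q_Q Cq_Q Cq_comm by (simp flip: Q.m_assoc)
  finally show ?thesis
    using Cq_Q[OF r(1)] Cq_Q[OF r(2)] by (simp add: centralizer_def)
qed

lemma Cq_inv: assumes "r \<in> Cq" shows "inv\<^bsub>Q\<^esub> r \<in> Cq"
proof -
  note r = Cq_Q[OF assms]
  have "inv\<^bsub>Q\<^esub> r \<otimes>\<^bsub>Q\<^esub> q = inv\<^bsub>Q\<^esub> r \<otimes>\<^bsub>Q\<^esub> (q \<otimes>\<^bsub>Q\<^esub> r) \<otimes>\<^bsub>Q\<^esub> inv\<^bsub>Q\<^esub> r"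
    using r q_Q by (simp add: Q.m_assoc)
  also have "\<dots> = q \<otimes>\<^bsub>Q\<^esub> inv\<^bsub>Q\<^esub> r"
    unfolding Cq_comm[OF assms, symmetric] using r q_Q by (simp flip: Q.m_assoc)
  finally show ?thesis using r by (simp add: centralizer_def)
qed

lemma finite_Cq: "finite Cq"
  using finite_Q by (simp add: centralizer_def)

lemma K_H: "h \<in> K \<Longrightarrow> h \<in> carrier H" and K_Cq: "h \<in> K \<Longrightarrow> j h \<in> Cq"
  by (simp_all add: K_def)

lemma K_X: "h \<in> K \<Longrightarrow> x \<in> X \<Longrightarrow> cj h x \<in> X"
  by (rule cj_X) (simp_all add: K_def)

lemma K_mult: "h \<in> K \<Longrightarrow> k \<in> K \<Longrightarrow> h \<otimes> k \<in> K"
  using Cq_mult by (simp add: K_def)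

lemma K_inv: "h \<in> K \<Longrightarrow> inv h \<in> K"
  using Cq_inv by (simp add: K_def)

lemma G_K: "g \<in> carrier G \<Longrightarrow> g \<in> K"
  using one_Cq by (simp add: K_def G_iff)

lemma s_K: "r \<in> Cq \<Longrightarrow> s r \<in> K"
  using Cq_Q by (simp add: K_def j_s)

lemma sum_K_right:
  assumes "k \<in> K"
  shows "(\<Sum>h\<in>K. f (h \<otimes> k)) = (\<Sum>h\<in>K. f h)"
  by (rule sum.reindex_bij_witness[of _ "\<lambda>h. h \<otimes> inv k" "\<lambda>h. h \<otimes> k"])
    (use assms K_mult K_inv in \<open>auto simp: H.m_assoc K_H\<close>)

lemma sum_K_left:
  assumes "k \<in> K"
  shows "(\<Sum>h\<in>K. f (k \<otimes> h)) = (\<Sum>h\<in>K. f h)"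
  by (rule sum.reindex_bij_witness[of _ "\<lambda>h. inv k \<otimes> h" "\<lambda>h. k \<otimes> h"])
    (use assms K_mult K_inv in \<open>auto simp: H.inv_cancel K_H\<close>)

text \<open>Splits a sum over \<open>K\<close> into a part over \<open>G\<close>, under which
  \<open>F C\<close> is invariant, and a part over the centralizer, which brings in
  \<open>gam\<close>.\<close>

lemma bij_K: "bij_betw (\<lambda>(r, g). g \<otimes> s r) (Cq \<times> carrier G) K"
proof (rule bij_betwI)
  show "(\<lambda>(r, g). g \<otimes> s r) \<in> Cq \<times> carrier G \<rightarrow> K"
    using K_mult G_K s_K by auto
  show "(\<lambda>h. (j h, h \<otimes> inv (s (j h)))) \<in> K \<rightarrow> Cq \<times> carrier G"
    using Cq_Q by (auto simp: K_def G_iff j_s)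
next
  fix p assume "p \<in> Cq \<times> carrier G"
  then obtain r g where p: "p = (r, g)" "r \<in> Cq" "g \<in> carrier G" by blast
  have "j (g \<otimes> s r) = r" using p Cq_Q by (simp add: G_iff j_s)
  then show "(j ((\<lambda>(r, g). g \<otimes> s r) p), (\<lambda>(r, g). g \<otimes> s r) p \<otimes> inv (s (j ((\<lambda>(r, g). g \<otimes> s r) p)))) = p"
    using p Cq_Q by (simp add: H.m_assoc G_H)
next
  fix h assume "h \<in> K"
  then show "(\<lambda>(r, g). g \<otimes> s r) (j h, h \<otimes> inv (s (j h))) = h"
    using Cq_Q by (simp add: K_def H.m_assoc)
qed

lemma finite_K: "finite K"
  using bij_betw_finite[OF bij_K] finite_Cq finite_G by simp

lemma sum_K: "(\<Sum>h\<in>K. f h) = (\<Sum>r\<in>Cq. \<Sum>g\<in>carrier G. f (g \<otimes> s r))"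
  using sum.reindex_bij_betw[OF bij_K, of f]
  by (simp add: sum.cartesian_product case_prod_beta)

text \<open>The average over \<open>K\<close> without normalization; \<open>card K\<close> is
  divided out only when a function of \<open>V\<close> is expanded.\<close>

definition E :: "'a mat_rep set \<Rightarrow> 'a \<Rightarrow> complex" where
  "E C x = (if x \<in> X then \<Sum>h\<in>K. F C (cj h x) else 0)"

lemma E_V: "E C \<in> V"
proof -
  have "E C (cj k x) = E C x" if k: "k \<in> K" and x: "x \<in> X" for k x
  proof -
    have "E C (cj k x) = (\<Sum>h\<in>K. F C (cj h (cj k x)))"
      using K_X[OF k x] by (simp add: E_def)
    also have "\<dots> = (\<Sum>h\<in>K. F C (cj (h \<otimes> k) x))"
      using cj_cj[OF K_H[OF k] K_H X_H[OF x]] by (intro sum.cong refl) simp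
    also have "\<dots> = (\<Sum>h\<in>K. F C (cj h x))"
      by (rule sum_K_right[OF k, of "\<lambda>h. F C (cj h x)"])
    finally show ?thesis using x by (simp add: E_def)
  qed
  then show ?thesis by (simp add: V_def E_def)
qed

text \<open>Replacing \<open>h\<close> by \<open>s r \<otimes> h\<close> permutes \<open>K\<close>,
  and \<open>F_conj_s\<close> extracts the factor from each summand. Hence \<open>E\<close> is
  determined up to a scalar on each orbit.\<close>

lemma E_act:
  assumes C: "C \<in> I" and r: "r \<in> Cq"
  shows "E C = fscale (gam C r) (E (act r C))"
proof
  fix x
  show "E C x = fscale (gam C r) (E (act r C)) x"
  proof (cases "x \<in> X")
    case True
    have "E C x = (\<Sum>h\<in>K. F C (cj (s r \<otimes> h) x))"
      using True sum_K_left[OF s_K[OF r], of "\<lambda>h. F C (cj h x)"] by (simp add: E_def)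
    also have "\<dots> = (\<Sum>h\<in>K. gam C r * F (act r C) (cj h x))"
    proof (intro sum.cong refl)
      fix h assume h: "h \<in> K"
      have "cj (s r \<otimes> h) x = cj (s r) (cj h x)"
        by (rule cj_cj[OF K_H[OF h] s_H[OF Cq_Q[OF r]] X_H[OF True], symmetric])
      then show "F C (cj (s r \<otimes> h) x) = gam C r * F (act r C) (cj h x)"
        using F_conj_s[OF C K_X[OF h True] r] by simp
    qed
    finally show ?thesis using True by (simp add: E_def sum_distrib_left)
  qed (simp add: E_def)
qed

lemma E_expand:
  assumes C: "C \<in> I" and x: "x \<in> X"
  shows "E C x = of_nat (card (carrier G)) * (\<Sum>r\<in>Cq. gam C r * F (act r C) x)"
proof -
  have "E C x = (\<Sum>r\<in>Cq. \<Sum>g\<in>carrier G. F C (cj (g \<otimes> s r) x))"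
    using x by (simp add: E_def sum_K)
  also have "\<dots> = (\<Sum>r\<in>Cq. \<Sum>g\<in>carrier G. gam C r * F (act r C) x)"
  proof (intro sum.cong refl)
    fix r g assume r: "r \<in> Cq" and g: "g \<in> carrier G"
    have "cj (g \<otimes> s r) x = cj g (cj (s r) x)"
      by (rule cj_cj[OF s_H[OF Cq_Q[OF r]] G_H[OF g] X_H[OF x], symmetric])
    then show "F C (cj (g \<otimes> s r) x) = gam C r * F (act r C) x"
      using F_conj_G[OF C K_X[OF s_K[OF r] x] g] F_conj_s[OF C x r] by simp
  qed
  finally show ?thesis by (simp add: sum_distrib_left)
qed

text \<open>One factor \<open>card (carrier G)\<close> comes from summing over \<open>G\<close>
  inside \<open>K\<close>, the other from the norm of \<open>F D\<close>. What remains is the sum of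
  \<open>gam C r\<close> over all \<open>r\<close> that carry \<open>C\<close> to
  \<open>D\<close>.\<close>

lemma E_F:
  assumes C: "C \<in> I" and D: "D \<in> I"
  shows "(\<Sum>x\<in>X. E C x * cnj (F D x)) =
    (of_nat (card (carrier G)))\<^sup>2 * (\<Sum>r\<in>Cq. if act r C = D then gam C r else 0)"
proof -
  let ?n = "of_nat (card (carrier G)) :: complex"
  have "(\<Sum>x\<in>X. E C x * cnj (F D x)) =
    (\<Sum>x\<in>X. \<Sum>r\<in>Cq. ?n * (gam C r * (F (act r C) x * cnj (F D x))))"
    using E_expand[OF C] by (intro sum.cong refl) (simp add: sum_distrib_left sum_distrib_right mult.assoc)
  also have "\<dots> = (\<Sum>r\<in>Cq. ?n * (gam C r * (\<Sum>x\<in>X. F (act r C) x * cnj (F D x))))"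
    by (subst sum.swap) (simp add: sum_distrib_left)
  also have "\<dots> = (\<Sum>r\<in>Cq. ?n\<^sup>2 * (if act r C = D then gam C r else 0))"
    using F_orthogonal[OF act_I[OF C] D] by (intro sum.cong refl) (simp add: power2_eq_square)
  finally show ?thesis by (simp add: sum_distrib_left)
qed

section \<open>Orbits of the centralizer and the nonvanishing of averages\<close>

abbreviation "CQ \<equiv> Q\<lparr>carrier := Cq\<rparr>"

abbreviation orb :: "'a mat_rep set \<Rightarrow> 'a mat_rep set set" where
  "orb \<equiv> orbit CQ act"

definition good :: "'a mat_rep set \<Rightarrow> bool" where
  "good C \<longleftrightarrow> (\<forall>r \<in> stabilizer CQ act C. gam C r = 1)"

lemma orb_iff: "D \<in> orb C \<longleftrightarrow> (\<exists>r\<in>Cq. D = act r C)"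
  by (auto simp: orbit_def)

lemma orb_refl: "C \<in> I \<Longrightarrow> C \<in> orb C"
  unfolding orb_iff by (rule bexI[OF _ one_Cq]) (simp add: act_one I_dual)

lemma orb_I: "C \<in> I \<Longrightarrow> D \<in> orb C \<Longrightarrow> D \<in> I"
  using act_I unfolding orb_iff by blast

lemma orb_subset:
  assumes C: "C \<in> I" and D: "D \<in> orb C"
  shows "orb D \<subseteq> orb C"
proof
  fix B assume "B \<in> orb D"
  then obtain r r' where r: "r \<in> Cq" "D = act r C" "r' \<in> Cq" "B = act r' D"
    using D unfolding orb_iff by blast
  then have "B = act (r \<otimes>\<^bsub>Q\<^esub> r') C"
    using act_act[OF I_dual[OF C]] Cq_Q by simp
  then show "B \<in> orb C" unfolding orb_iff using Cq_mult[OF r(1,3)] by blast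
qed

lemma orb_eq:
  assumes C: "C \<in> I" and D: "D \<in> orb C"
  shows "orb D = orb C"
proof
  show "orb D \<subseteq> orb C" by (rule orb_subset[OF C D])
  obtain r where r: "r \<in> Cq" "D = act r C" using D unfolding orb_iff by blast
  have "act (inv\<^bsub>Q\<^esub> r) D = C"
    using act_act[OF I_dual[OF C] Cq_Q[OF r(1)] Cq_Q[OF Cq_inv[OF r(1)]]] act_one[OF I_dual[OF C]]
      r Cq_Q by simp
  then have "C \<in> orb D" unfolding orb_iff using Cq_inv[OF r(1)] by blast
  then show "orb C \<subseteq> orb D" by (rule orb_subset[OF orb_I[OF C D]])
qed

text \<open>With all factors on the stabilizer equal to 1, the sum in \<open>E_F\<close> for
  \<open>D = C\<close> counts the stabilizer, which contains the identity.\<close>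

lemma E_nonzero:
  assumes C: "C \<in> I" and good: "good C"
  shows "\<exists>x\<in>X. E C x \<noteq> 0"
proof (rule ccontr)
  assume "\<not> (\<exists>x\<in>X. E C x \<noteq> 0)"
  then have "(\<Sum>x\<in>X. E C x * cnj (F C x)) = 0" by simp
  then have "(\<Sum>r\<in>Cq. if act r C = C then gam C r else 0) = 0"
    unfolding E_F[OF C C] using card_G by simp
  also have "(\<Sum>r\<in>Cq. if act r C = C then gam C r else 0) = (\<Sum>r\<in>Cq. if act r C = C then 1 else 0)"
    using good by (intro sum.cong refl) (simp add: good_def stabilizer_def)
  also have "\<dots> = of_nat (card {r \<in> Cq. act r C = C})"
    using finite_Cq by (simp add: sum.If_cases Int_def)
  finally have "{r \<in> Cq. act r C = C} = {}"
    using finite_Cq by simp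
  then show False using one_Cq act_one[OF I_dual[OF C]] by blast
qed

text \<open>For \<open>r\<close> in the stabilizer, \<open>E_act\<close> relates \<open>E C\<close>
  to itself with factor \<open>gam C r\<close>; a point where \<open>E C\<close> is nonzero forces
  the factor to be 1.\<close>

lemma good_if_E_nonzero:
  assumes C: "C \<in> I" and nz: "E C \<noteq> 0"
  shows "good C"
  unfolding good_def
proof
  fix r assume "r \<in> stabilizer CQ act C"
  then have r: "r \<in> Cq" "act r C = C" by (simp_all add: stabilizer_def)
  obtain x where x: "E C x \<noteq> 0" using nz by (auto simp: fun_eq_iff)
  have "E C x = gam C r * E C x" using fun_cong[OF E_act[OF C r(1)], of x] r(2) by simp
  then show "gam C r = 1" using x by simp
qed

text \<open>Each average involves only the functions \<open>F\<close> of classes in its own orbit,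
  and distinct orbits are disjoint.\<close>

lemma E_orthogonal:
  assumes C: "C \<in> I" and D: "D \<in> I" and ne: "orb C \<noteq> orb D"
  shows "(\<Sum>x\<in>X. E C x * cnj (E D x)) = 0"
proof -
  have zero: "(\<Sum>x\<in>X. E C x * cnj (F (act r D) x)) = 0" if r: "r \<in> Cq" for r
  proof -
    have "act r' C \<noteq> act r D" if r': "r' \<in> Cq" for r'
    proof
      assume eq: "act r' C = act r D"
      have "act r' C \<in> orb C" "act r D \<in> orb D" using r r' unfolding orb_iff by blast+
      then have "orb C = orb D" using eq orb_eq[OF C] orb_eq[OF D] by metis
      with ne show False ..
    qed
    then show ?thesis unfolding E_F[OF C act_I[OF D r]] by simp
  qed
  have "(\<Sum>x\<in>X. E C x * cnj (E D x)) =
    (\<Sum>x\<in>X. \<Sum>r\<in>Cq. of_nat (card (carrier G)) * cnj (gam D r) * (E C x * cnj (F (act r D) x)))"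
    using E_expand[OF D] by (intro sum.cong refl) (simp add: sum_distrib_left mult_ac)
  also have "\<dots> = (\<Sum>r\<in>Cq. of_nat (card (carrier G)) * cnj (gam D r) * (\<Sum>x\<in>X. E C x * cnj (F (act r D) x)))"
    by (subst sum.swap) (simp add: sum_distrib_left)
  also have "\<dots> = 0" using zero by simp
  finally show ?thesis .
qed

text \<open>One average per good orbit gives a basis of \<open>V\<close>: orthogonality yields
  independence, and averages from the other orbits vanish, so they add nothing to the span.\<close>

lemma card_good_orbits: "card {O\<^sub>i \<in> orbits CQ I act. \<exists>C\<in>O\<^sub>i. good C} = fs.dim V"
proof -
  define GO where "GO = {O\<^sub>i \<in> orbits CQ I act. \<exists>C\<in>O\<^sub>i. good C}"
  \<comment> \<open>The class that presents the orbit need not be the one known to be good;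
    \<open>orb_eq\<close> lets the good class generate the orbit.\<close>
  have "\<exists>C. C \<in> I \<and> orb C = Oi \<and> good C" if O: "Oi \<in> GO" for Oi
  proof -
    obtain B C where B: "Oi = orb B" "B \<in> I" "C \<in> Oi" "good C"
      using O by (auto simp: GO_def orbits_def)
    then show ?thesis using orb_I[OF B(2)] orb_eq[OF B(2)] by auto
  qed
  then obtain c where c: "\<And>Oi. Oi \<in> GO \<Longrightarrow> c Oi \<in> I \<and> orb (c Oi) = Oi \<and> good (c Oi)"
    by metis
  let ?B = "(\<lambda>Oi. E (c Oi)) ` GO"
  have nz: "(\<Sum>x\<in>X. E (c Oi) x * cnj (E (c Oi) x)) \<noteq> 0" if "Oi \<in> GO" for Oi
    using E_nonzero[of "c Oi"] c[OF that] sum_mult_cnj_nonzero[OF finite_X, of _ "E (c Oi)"] by blast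
  have orth: "(\<Sum>x\<in>X. E (c Oi) x * cnj (E (c Oi') x)) = 0"
    if "Oi \<in> GO" "Oi' \<in> GO" "Oi \<noteq> Oi'" for Oi Oi'
    using E_orthogonal[of "c Oi" "c Oi'"] c[OF that(1)] c[OF that(2)] that(3) by simp
  have fam: "inj_on (\<lambda>Oi. E (c Oi)) GO" "fs.independent ?B"
    using orthogonal_family[where S = GO and X = X and u = "\<lambda>Oi. E (c Oi)", OF nz orth] by simp_all
  \<comment> \<open>Any class counts here, not only a chosen representative: \<open>E C\<close> is
    zero, or its orbit is good and \<open>E_act\<close> makes \<open>E C\<close> a multiple of the
    chosen average.\<close>
  have E_span: "E C \<in> fs.span ?B" if C: "C \<in> I" for C
  proof (cases "E C = 0")
    case True
    then show ?thesis by (simp only: fs.span_zero)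
  next
    case False
    have "good C" by (rule good_if_E_nonzero[OF C False])
    then have O: "orb C \<in> GO" using C orb_refl[OF C] by (auto simp: GO_def orbits_def)
    have "c (orb C) \<in> orb C" using c[OF O] orb_refl[of "c (orb C)"] by simp
    then obtain r where r: "r \<in> Cq" "c (orb C) = act r C" unfolding orb_iff by blast
    have "E C = fscale (gam C r) (E (c (orb C)))" unfolding r(2) by (rule E_act[OF C r(1)])
    moreover have "E (c (orb C)) \<in> fs.span ?B" using O by (intro fs.span_base imageI)
    ultimately show ?thesis by (simp only: fs.span_scale)
  qed
  have "V \<subseteq> fs.span ?B"
  proof
    fix f assume f: "f \<in> V"
    have off: "f x = 0" if "x \<notin> X" for x using f that by (simp add: V_def)
    have inv: "f (cj h x) = f x" if "x \<in> X" "h \<in> K" for x h using f that by (simp add: V_def)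
    have "\<exists>a. f = (\<Sum>C\<in>I. fscale (a C) (F C))"
      by (rule F_expansion) (simp_all add: off inv G_K)
    then obtain a where a: "f = (\<Sum>C\<in>I. fscale (a C) (F C))" ..
    let ?k = "of_nat (card K) :: complex"
    have k: "?k \<noteq> 0" using finite_K G_K[OF G.one_closed] by auto
    \<comment> \<open>Averaging the expansion of \<open>f\<close> over \<open>K\<close> fixes the
      invariant function \<open>f\<close> and turns each \<open>F C\<close> into \<open>E C\<close>
      divided by \<open>card K\<close>.\<close>
    have "f = (\<Sum>C\<in>I. fscale (a C / ?k) (E C))"
    proof
      fix x
      show "f x = (\<Sum>C\<in>I. fscale (a C / ?k) (E C)) x"
      proof (cases "x \<in> X")
        case True
        have "?k * f x = (\<Sum>h\<in>K. f (cj h x))" using inv[OF True] by simp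
        also have "\<dots> = (\<Sum>h\<in>K. \<Sum>C\<in>I. a C * F C (cj h x))"
          by (subst a) (simp add: sum_fun_apply)
        also have "\<dots> = (\<Sum>C\<in>I. a C * E C x)"
          using True by (subst sum.swap) (simp add: E_def sum_distrib_left)
        finally have "f x = (\<Sum>C\<in>I. a C * E C x) / ?k" using k by (simp add: field_simps)
        also have "\<dots> = (\<Sum>C\<in>I. fscale (a C / ?k) (E C)) x"
          by (simp add: sum_fun_apply sum_divide_distrib)
        finally show ?thesis .
      next
        case False
        then show ?thesis by (simp add: off sum_fun_apply E_def)
      qed
    qed
    also have "\<dots> \<in> fs.span ?B"
      by (intro fs.span_sum fs.span_scale E_span)
    finally show "f \<in> fs.span ?B" .
  qed
  moreover have "?B \<subseteq> V" using E_V by blast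
  ultimately have "card ?B = fs.dim V" using fam(2) by (intro fs.basis_card_eq_dim)
  then show ?thesis unfolding GO_def[symmetric] using card_image[OF fam(1)] by simp
qed

section \<open>Conjugacy classes of \<open>H\<close> over the class of \<open>q\<close>\<close>

lemma conj_class_iff: "x \<in> carrier H \<Longrightarrow> y \<in> conj_class H x \<longleftrightarrow> (\<exists>h\<in>carrier H. y = cj h x)"
  by (auto simp: conj_class_def orbit_def conj_act_cj)

lemma conj_class_refl: "x \<in> carrier H \<Longrightarrow> x \<in> conj_class H x"
  unfolding conj_class_iff by (rule bexI[of _ \<one>]) simp_all

lemma conj_class_H: "x \<in> carrier H \<Longrightarrow> y \<in> conj_class H x \<Longrightarrow> y \<in> carrier H"
  by (auto simp: conj_class_iff)

lemma conj_class_eq: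
  assumes x: "x \<in> carrier H" and y: "y \<in> conj_class H x"
  shows "conj_class H y = conj_class H x"
proof -
  have sub: "conj_class H b \<subseteq> conj_class H a" if a: "a \<in> carrier H" and b: "b \<in> conj_class H a" for a b
  proof
    fix z assume z: "z \<in> conj_class H b"
    obtain h where h: "h \<in> carrier H" "b = cj h a"
      using b unfolding conj_class_iff[OF a] by blast
    obtain k where k: "k \<in> carrier H" "z = cj k b"
      using z unfolding conj_class_iff[OF conj_class_H[OF a b]] by blast
    have "z = cj (k \<otimes> h) a" unfolding k(2) h(2) by (rule cj_cj[OF h(1) k(1) a])
    then show "z \<in> conj_class H a"
      unfolding conj_class_iff[OF a] using H.m_closed[OF k(1) h(1)] by blast
  qed
  obtain h where h: "h \<in> carrier H" "y = cj h x" using y conj_class_iff[OF x] by blast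
  then have "x = cj (inv h) y" using x by (simp add: H.m_assoc H.inv_cancel)
  then have "x \<in> conj_class H y"
    unfolding conj_class_iff[OF conj_class_H[OF x y]] using h by blast
  then show ?thesis using sub[OF x y] sub[OF conj_class_H[OF x y]] by blast
qed

text \<open>A class of \<open>H\<close> lying over the class of \<open>q\<close> always meets the
  fiber, because the section lifts the element of \<open>Q\<close> that conjugates its image to
  \<open>q\<close>.\<close>

lemma fiber_conj_classes:
  "{L \<in> conj_classes H. L \<subseteq> j -` conj_class Q q} = conj_class H ` X"
proof (intro equalityI subsetI)
  fix L assume "L \<in> {L \<in> conj_classes H. L \<subseteq> j -` conj_class Q q}"
  then obtain x where x: "x \<in> carrier H" "L = conj_class H x" and L: "L \<subseteq> j -` conj_class Q q"
    by (auto simp: conj_classes_def orbits_def conj_class_def)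
  have "j x \<in> conj_class Q q" using L x conj_class_refl by blast
  then obtain r where r: "r \<in> carrier Q" "j x = r \<otimes>\<^bsub>Q\<^esub> q \<otimes>\<^bsub>Q\<^esub> inv\<^bsub>Q\<^esub> r"
    using q_Q by (auto simp: conj_class_def orbit_def conj_act_def)
  define y where "y = cj (inv (s r)) x"
  have y: "y \<in> conj_class H x"
    unfolding conj_class_iff[OF x(1)] y_def using r by (intro bexI[of _ "inv (s r)"]) auto
  have "j y = inv\<^bsub>Q\<^esub> r \<otimes>\<^bsub>Q\<^esub> (r \<otimes>\<^bsub>Q\<^esub> q \<otimes>\<^bsub>Q\<^esub> inv\<^bsub>Q\<^esub> r) \<otimes>\<^bsub>Q\<^esub> r"
    using r x by (simp add: y_def j_s)
  also have "\<dots> = q" using r(1) q_Q by (simp add: Q.m_assoc Q.inv_cancel)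
  finally have "y \<in> X" using conj_class_H[OF x(1) y] by (simp add: X_def)
  then show "L \<in> conj_class H ` X" using conj_class_eq[OF x(1) y] x(2) by blast
next
  fix L assume "L \<in> conj_class H ` X"
  then obtain x where x: "x \<in> X" "L = conj_class H x" by blast
  have "L \<subseteq> j -` conj_class Q q"
  proof
    fix y assume "y \<in> L"
    then obtain h where h: "h \<in> carrier H" "y = cj h x"
      using x conj_class_iff[OF X_H[OF x(1)]] by blast
    then have "j y = conj_act Q (j h) q" using x q_Q by (simp add: X_def conj_act_def)
    then show "y \<in> j -` conj_class Q q"
      using j.hom_closed[OF h(1)] by (auto simp: conj_class_def orbit_def)
  qed
  then show "L \<in> {L \<in> conj_classes H. L \<subseteq> j -` conj_class Q q}"
    using x X_H by (auto simp: conj_classes_def orbits_def conj_class_def)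
qed

text \<open>Distinct classes are disjoint, so their indicators are orthogonal. They span
  \<open>V\<close> because conjugacy in \<open>H\<close> between points of the fiber is conjugacy
  under \<open>K\<close>.\<close>

lemma card_fiber_conj_classes: "card {L \<in> conj_classes H. L \<subseteq> j -` conj_class Q q} = fs.dim V"
  unfolding fiber_conj_classes
proof -
  \<comment> \<open>The indicator is cut off at \<open>X\<close>, since a class of \<open>H\<close>
    may leave the fiber while functions in \<open>V\<close> vanish outside it.\<close>
  define ind where "ind L x = (if x \<in> L \<and> x \<in> X then 1 else 0 :: complex)" for L x
  let ?CC = "conj_class H ` X"
  have nz: "(\<Sum>x\<in>X. ind L x * cnj (ind L x)) \<noteq> 0" if L: "L \<in> ?CC" for L
  proof -
    obtain x where "x \<in> X" "L = conj_class H x" using L by blast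
    then have "x \<in> X" "ind L x \<noteq> 0" using conj_class_refl[OF X_H] by (auto simp: ind_def)
    then show ?thesis by (rule sum_mult_cnj_nonzero[OF finite_X])
  qed
  have orth: "(\<Sum>x\<in>X. ind L x * cnj (ind L' x)) = 0" if "L \<in> ?CC" "L' \<in> ?CC" "L \<noteq> L'" for L L'
  proof -
    have "L = conj_class H x" if "L \<in> ?CC" "x \<in> L" for L x
      using that conj_class_eq X_H by blast
    then have "\<not> (x \<in> L \<and> x \<in> L')" for x using that by metis
    then show ?thesis by (intro sum.neutral) (auto simp: ind_def)
  qed
  have fam: "inj_on ind ?CC" "fs.independent (ind ` ?CC)"
    using orthogonal_family[where S = ?CC and X = X and u = ind, OF nz orth] by simp_all
  have "ind (conj_class H y) \<in> V" if y: "y \<in> X" for y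
  proof -
    have "cj h x \<in> conj_class H y \<longleftrightarrow> x \<in> conj_class H y" if h: "h \<in> K" and x: "x \<in> X" for h x
    proof -
      have "cj h x \<in> conj_class H x"
        unfolding conj_class_iff[OF X_H[OF x]] using K_H[OF h] by blast
      then have "conj_class H (cj h x) = conj_class H x" by (rule conj_class_eq[OF X_H[OF x]])
      then show ?thesis
        using conj_class_eq[OF X_H[OF y]] conj_class_refl[OF X_H[OF x]] conj_class_refl[OF X_H[OF K_X[OF h x]]]
        by metis
    qed
    then show ?thesis by (simp add: V_def ind_def K_X)
  qed
  then have "ind ` ?CC \<subseteq> V" by blast
  moreover have "V \<subseteq> fs.span (ind ` ?CC)"
  proof
    fix f assume f: "f \<in> V"
    have off: "f x = 0" if "x \<notin> X" for x using f that by (simp add: V_def)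
    \<comment> \<open>An element conjugating one point of the fiber to another has image commuting
      with \<open>q\<close>, so it lies in \<open>K\<close> and the invariance of \<open>f\<close>
      applies.\<close>
    have const: "f y = f x" if x: "x \<in> X" and y: "y \<in> X" "y \<in> conj_class H x" for x y
    proof -
      obtain h where h: "h \<in> carrier H" "y = cj h x" using y conj_class_iff[OF X_H[OF x]] by blast
      have "q = j h \<otimes>\<^bsub>Q\<^esub> q \<otimes>\<^bsub>Q\<^esub> inv\<^bsub>Q\<^esub> (j h)" using h x y(1) by (simp add: X_def)
      then have "q \<otimes>\<^bsub>Q\<^esub> j h = j h \<otimes>\<^bsub>Q\<^esub> q \<otimes>\<^bsub>Q\<^esub> inv\<^bsub>Q\<^esub> (j h) \<otimes>\<^bsub>Q\<^esub> j h" by simp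
      also have "\<dots> = j h \<otimes>\<^bsub>Q\<^esub> q" using h q_Q by (simp add: Q.m_assoc)
      finally have "h \<in> K" using h by (simp add: K_def centralizer_def)
      then show ?thesis using f x h by (simp add: V_def)
    qed
    \<comment> \<open>\<open>f\<close> is constant on the part of a class inside \<open>X\<close>,
      so its value at any point there serves as the coefficient.\<close>
    define rep where "rep L = (SOME x. x \<in> L \<and> x \<in> X)" for L :: "'a set"
    have "f = (\<Sum>L\<in>?CC. fscale (f (rep L)) (ind L))"
    proof
      fix x
      show "f x = (\<Sum>L\<in>?CC. fscale (f (rep L)) (ind L)) x"
      proof (cases "x \<in> X")
        case True
        let ?L = "conj_class H x"
        have "rep ?L \<in> ?L \<and> rep ?L \<in> X"
          unfolding rep_def by (rule someI[of _ x]) (rule conjI[OF conj_class_refl[OF X_H[OF True]] True])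
        then have "f (rep ?L) = f x" using const[OF True, of "rep ?L"] by simp
        have "(\<Sum>L\<in>?CC. fscale (f (rep L)) (ind L)) x = (\<Sum>L\<in>?CC. if L = ?L then f (rep ?L) else 0)"
          unfolding sum_fun_apply
        proof (intro sum.cong refl)
          fix L assume "L \<in> ?CC"
          then obtain y where y: "y \<in> X" "L = conj_class H y" by blast
          have "x \<in> L \<longleftrightarrow> L = ?L"
            using conj_class_eq[OF X_H[OF y(1)]] conj_class_refl[OF X_H[OF True]] y(2) by blast
          then show "fscale (f (rep L)) (ind L) x = (if L = ?L then f (rep ?L) else 0)"
            using True by (simp add: ind_def)
        qed
        also have "\<dots> = f x" using True finite_X \<open>f (rep ?L) = f x\<close> by simp
        finally show ?thesis ..
      next
        case False
        then show ?thesis by (simp add: off sum_fun_apply ind_def)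
      qed
    qed
    also have "\<dots> \<in> fs.span (ind ` ?CC)"
      by (intro fs.span_sum fs.span_scale fs.span_base) auto
    finally show "f \<in> fs.span (ind ` ?CC)" .
  qed
  ultimately have "card (ind ` ?CC) = fs.dim V" using fam(2) by (intro fs.basis_card_eq_dim)
  then show "card ?CC = fs.dim V" using card_image[OF fam(1)] by simp
qed

end

theorem theorem3p1:
  fixes G H :: "('a, 'm) monoid_scheme"
    and Q :: "('b, 'n) monoid_scheme"
    and j :: "'a \<Rightarrow> 'b"
    and s :: "'b \<Rightarrow> 'a"
    and R :: "'a mat_rep set \<Rightarrow> 'a mat_rep"
    and T :: "'b \<Rightarrow> 'a mat_rep set \<Rightarrow> complex mat"
    and q :: 'b
  assumes "group H" and "group Q"
    and "j \<in> epi H Q"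
    and "G = H\<lparr>carrier := kernel H Q j\<rparr>"
    and "finite (carrier G)" and "finite (carrier Q)"
    and "s \<in> carrier Q \<rightarrow> carrier H"
    and "\<And>r. r \<in> carrier Q \<Longrightarrow> j (s r) = r"
    and "s \<one>\<^bsub>Q\<^esub> = \<one>\<^bsub>H\<^esub>"
    and "unitary_representatives G R"
    and "unitary_intertwiners G H Q s R T"
    and "q \<in> carrier Q"
  shows "card {K \<in> conj_classes H. K \<subseteq> j -` conj_class Q q} =
         card {O\<^sub>i \<in> orbits (Q\<lparr>carrier := centralizer Q q\<rparr>)
                          (invariants (dual G) (dual_act G H s) q) (dual_act G H s).
               \<exists>\<rho>\<^sub>i \<in> O\<^sub>i.
                 \<forall>q\<^sub>1 \<in> stabilizer (Q\<lparr>carrier := centralizer Q q\<rparr>) (dual_act G H s) \<rho>\<^sub>i.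
                   gamma G H Q s R T \<rho>\<^sub>i q\<^sub>1 q = 1}"
proof -
  interpret extension_fiber H G Q j s R T q
    by (intro extension_fiber.intro extension_data.intro extension_fiber_axioms.intro assms)
  show ?thesis
    using card_fiber_conj_classes card_good_orbits unfolding good_def I_def by simp
qed

end
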